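(* Let $s\in\mathbb Z\setminus\{0\}$, let $(B_1,B_2)$ be the pair of type A, B or C of the context, and write $d_1=(x,y)^{\mathsf T}$, $d_2=(a,b)^{\mathsf T}\in\mathbb Z^2$. Consider the data $$\begin{array}{c|c|c|c|c}\text{type}&(m_1,m_2;h)&(z_1,z_2)&k_\rho&\nu_\rho\\\hline A&(3,4;1)&\left(\tfrac s3(x^2-xy+y^2),-\tfrac s2(a^2+b^2)\right)&2x-y+3b&6\\ B&(4,6;1)&\left(\tfrac s2(x^2+y^2),-s(a^2+ab+b^2)\right)&x+y+2b&2\\ C&(3,6;2)&\left(\tfrac s3(x^2-xy+y^2),-s(a^2+ab+b^2)\right)&x+y+3b&3\end{array}$$ For each row, the two elliptic relations $T(B_i,d_i,z_i)^{m_i}=I$ ($i=1,2$) can be satisfied with integers $z_i$ exactly when the displayed central coordinates are integral (and then $z_1,z_2$ are the displayed values). On the square-zero locus $a=y$, the coordinate $k=k_\rho$, up to sign, is the complete conjugacy invariant under the integral Heisenberg subgroup and the central Levi involution. There the central obstruction in $H^2(C_{m_1}*C_{m_2},\mathbb Z)\cong\mathbb Z/m_1\oplus\mathbb Z/m_2$ is $$\begin{array}{c|c}A&(-sk^2\bmod3,\;2sk^2\bmod4)\\ B&(-2sk^2\bmod4,\;0\bmod6)\\ C&(-sk^2\bmod3,\;0\bmod6),\end{array}$$ so a lift exists if and only if $s k^2/\nu_\rho\in\mathbb Z$, equivalently $\nu_\rho\mid sk^2$. For $k\ne0$ (and a lift $T_i=T(B_i,d_i,z_i)$ on the square-zero locus),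 write $P=T_1T_2$, $N=P-I=\log P$, and $\Lambda_N=V\cap\operatorname{im}(N\otimes\mathbb Q)=\ker(N:V\to V)$. Then $\Lambda_N$ has rank two and the monodromy image has index $$d_{\mathrm{cusp}}=[\Lambda_N:N(V)]=\frac{|s|k^2}{\nu_\rho}.$$ For the periodic $A_2$ compactification with cusp matrix given by the induced map $V/\Lambda_N\to\Lambda_N$ (see context), this saturation index equals the number of components of the normalized central fibre.
   Context: Types: A: $B_1=\begin{pmatrix}-1&1\\-1&0\end{pmatrix}$, $B_2=\begin{pmatrix}0&-1\\1&0\end{pmatrix}$; B: $B_1=\begin{pmatrix}0&1\\-1&0\end{pmatrix}$, $B_2=\begin{pmatrix}0&-1\\1&1\end{pmatrix}$; C: $B_1=\begin{pmatrix}-1&1\\-1&0\end{pmatrix}$, $B_2=\begin{pmatrix}0&-1\\1&1\end{pmatrix}$. $B_i$ has order $m_i$, $B_1B_2=U_h=\begin{pmatrix}1&h\\0&1\end{pmatrix}$, and $\nu_\rho=|\det(I-B_1)\det(I-B_2)|$. Let $J_s=s\begin{pmatrix}0&1\\-1&0\end{pmatrix}$, $\omega(u,v)=u^{\mathsf T}J_sv$, $V=\mathbb Z\gamma\oplus\mathbb Z^2\oplus\mathbb Z\delta\cong\mathbb Z^4$, and $$T(B,d,z)=\begin{pmatrix}1&d^{\mathsf T}J_sB&z\\0&B&d\\0&0&1\end{pmatrix},\qquad B\in SL_2(\mathbb Z),\ d\in\mathbb Z^2,\ z\in\mathbb Z,$$ with $T(B,d,z)T(B',d',z')=T(BB',d+Bd',z+z'+d^{\mathsf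 T}J_sBd')$. The integral Heisenberg subgroup is $\{T(I,u,z)\}$; the central Levi involution is $T(-I,0,0)$; both act on lifts $(T_1,T_2)$ by simultaneous conjugation. A lift is a pair $T_i=T(B_i,d_i,z_i)$, $z_i\in\mathbb Z$, with $T_i^{m_i}=I$. The square-zero locus is the set of $(d_1,d_2)$ for which $(T_1T_2-I)^2=0$ (independent of $z_i$), which is $a=y$. The central obstruction of $(d_1,d_2)$ is the class $(\kappa_{m_1}(B_1,d_1)\bmod m_1,\ \kappa_{m_2}(B_2,d_2)\bmod m_2)$ with $\kappa_m(B,u)=\sum_{0\le i<j<m}\omega(B^iu,B^ju)$; it is the obstruction to lifting the affine representation $g_i\mapsto(B_i,d_i)$ of $C_{m_1}*C_{m_2}$ to the group of matrices $T(B,d,z)$. Periodic $A_2$ compactification with nonsingular cusp matrix $M\in M_2(\mathbb Z)$: let $Y$ be the toric threefold of the fan of cones over $\Delta\times\{1\}\subset\mathbb R^2\oplus\mathbb R$, $\Delta$ running over the triangles $\operatorname{conv}(v,v+e_1,v+e_2)$, $\operatorname{conv}(v+e_1+e_2,v+e_1,v+e_2)$, $v\in\mathbb Z^2$, with last coordinate character $t$; for $D(t)$ a holomorphic $2\times2$ matrix near $0$, it is the quotient of $\{|t|<\epsilon\}\subset Y$ ($\epsilon$ small) by $(x,t)\mapsto(e^{2\pi iD(t)\nu}t^\nu x,t)$, $\nu\in M\mathbb Z^2$; the central fibre is $t=0$. *)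

theory Defs
  imports "HOL-Analysis.Analysis"
begin

section \<open>Integral lifts\<close>

datatype lift_type = TypeA | TypeB | TypeC

(* The ring multiplication of the vec type is componentwise, hence powers of matrices
   are iterated matrix products and not "^". *)
definition mpow :: "'a::semiring_1^'n^'n \<Rightarrow> nat \<Rightarrow> 'a^'n^'n" where
  "mpow A n = (((**) A) ^^ n) (mat 1)"

definition mat_order :: "'a::semiring_1^'n^'n \<Rightarrow> nat" where
  "mat_order A = (LEAST n. 0 < n \<and> mpow A n = mat 1)"

definition vec2 :: "'a::zero \<Rightarrow> 'a \<Rightarrow> 'a^2" where
  "vec2 x y = vector [x, y]"

definition mat2 :: "'a::zero \<Rightarrow> 'a \<Rightarrow> 'a \<Rightarrow> 'a \<Rightarrow> 'a^2^2" where
  "mat2 p q r s = vector [vec2 p q, vec2 r s]"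

fun B1 :: "lift_type \<Rightarrow> int^2^2" where
  "B1 TypeA = mat2 (-1) 1 (-1) 0"
| "B1 TypeB = mat2 0 1 (-1) 0"
| "B1 TypeC = mat2 (-1) 1 (-1) 0"

fun B2 :: "lift_type \<Rightarrow> int^2^2" where
  "B2 TypeA = mat2 0 (-1) 1 0"
| "B2 TypeB = mat2 0 (-1) 1 1"
| "B2 TypeC = mat2 0 (-1) 1 1"

definition m1 :: "lift_type \<Rightarrow> nat" where "m1 \<rho> = mat_order (B1 \<rho>)"
definition m2 :: "lift_type \<Rightarrow> nat" where "m2 \<rho> = mat_order (B2 \<rho>)"

definition Ush :: "int \<Rightarrow> int^2^2" where "Ush h = mat2 1 h 0 1"

definition nu :: "lift_type \<Rightarrow> int" where
  "nu \<rho> = \<bar>det (mat 1 - B1 \<rho>) * det (mat 1 - B2 \<rho>)\<bar>"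

definition Jmat :: "int \<Rightarrow> int^2^2" where "Jmat s = mat2 0 s (- s) 0"

definition omega :: "int \<Rightarrow> int^2 \<Rightarrow> int^2 \<Rightarrow> int" where
  "omega s u v = scalar_product u (Jmat s *v v)"

(* V = Z gamma + Z^2 + Z delta, in this order of coordinates. *)
definition Tmat :: "int \<Rightarrow> int^2^2 \<Rightarrow> int^2 \<Rightarrow> int \<Rightarrow> int^4^4" where
  "Tmat s B d z =
     (let r = d v* (Jmat s ** B) in
      vector [vector [1, r $ 1, r $ 2, z],
              vector [0, B $ 1 $ 1, B $ 1 $ 2, d $ 1],
              vector [0, B $ 2 $ 1, B $ 2 $ 2, d $ 2],
              vector [0, 0, 0, 1]])"

(* The group generated by the integral Heisenberg subgroup and the central Levi involution;
   the set of generators is closed under inverses. *)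
inductive_set heis_levi :: "int \<Rightarrow> (int^4^4) set" for s :: int where
  heis: "Tmat s (mat 1) u z \<in> heis_levi s"
| levi: "Tmat s (- mat 1) 0 0 \<in> heis_levi s"
| mult: "g \<in> heis_levi s \<Longrightarrow> h \<in> heis_levi s \<Longrightarrow> g ** h \<in> heis_levi s"

definition is_lift :: "int \<Rightarrow> lift_type \<Rightarrow> int^2 \<Rightarrow> int^2 \<Rightarrow> int \<Rightarrow> int \<Rightarrow> bool" where
  "is_lift s \<rho> d1 d2 z1 z2 \<longleftrightarrow>
     mpow (Tmat s (B1 \<rho>) d1 z1) (m1 \<rho>) = mat 1 \<and>
     mpow (Tmat s (B2 \<rho>) d2 z2) (m2 \<rho>) = mat 1"

definition monodromy :: "int \<Rightarrow> lift_type \<Rightarrow> int^2 \<Rightarrow> int^2 \<Rightarrow> int \<Rightarrow> int \<Rightarrow> int^4^4" where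
  "monodromy s \<rho> d1 d2 z1 z2 = Tmat s (B1 \<rho>) d1 z1 ** Tmat s (B2 \<rho>) d2 z2"

fun z1_coord :: "int \<Rightarrow> lift_type \<Rightarrow> int \<Rightarrow> int \<Rightarrow> rat" where
  "z1_coord s TypeA x y = of_int s / 3 * of_int (x^2 - x*y + y^2)"
| "z1_coord s TypeB x y = of_int s / 2 * of_int (x^2 + y^2)"
| "z1_coord s TypeC x y = of_int s / 3 * of_int (x^2 - x*y + y^2)"

fun z2_coord :: "int \<Rightarrow> lift_type \<Rightarrow> int \<Rightarrow> int \<Rightarrow> rat" where
  "z2_coord s TypeA a b = - (of_int s / 2) * of_int (a^2 + b^2)"
| "z2_coord s TypeB a b = - of_int s * of_int (a^2 + a*b + b^2)"
| "z2_coord s TypeC a b = - of_int s * of_int (a^2 + a*b + b^2)"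

fun k_coord :: "lift_type \<Rightarrow> int \<Rightarrow> int \<Rightarrow> int \<Rightarrow> int" where
  "k_coord TypeA x y b = 2*x - y + 3*b"
| "k_coord TypeB x y b = x + y + 2*b"
| "k_coord TypeC x y b = x + y + 3*b"

definition kappa :: "int \<Rightarrow> nat \<Rightarrow> int^2^2 \<Rightarrow> int^2 \<Rightarrow> int" where
  "kappa s m B u = (\<Sum>j<m. \<Sum>i<j. omega s (mpow B i *v u) (mpow B j *v u))"

(* An element of Z/m1 + Z/m2, given by the pair of residues in {0..<m1} and {0..<m2}. *)
definition central_obstruction :: "int \<Rightarrow> lift_type \<Rightarrow> int^2 \<Rightarrow> int^2 \<Rightarrow> int \<times> int" where
  "central_obstruction s \<rho> d1 d2 =
     (kappa s (m1 \<rho>) (B1 \<rho>) d1 mod int (m1 \<rho>), kappa s (m2 \<rho>) (B2 \<rho>) d2 mod int (m2 \<rho>))"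


section \<open>Lattices\<close>

definition saturation :: "int^4^4 \<Rightarrow> (int^4) set" where
  "saturation N =
     {v. (\<chi> i. of_int (v $ i)) \<in> range (\<lambda>w :: rat^4. map_matrix of_int N *v w)}"

definition lcosets :: "('a::plus) set \<Rightarrow> 'a set \<Rightarrow> 'a set set" where
  "lcosets L H = (\<lambda>v. (+) v ` H) ` L"

definition lattice_index :: "('a::plus) set \<Rightarrow> 'a set \<Rightarrow> nat" where
  "lattice_index L H = card (lcosets L H)"

definition int_comb :: "('n \<Rightarrow> int^'m) \<Rightarrow> int^'n \<Rightarrow> int^'m" where
  "int_comb b c = (\<Sum>i\<in>UNIV. c $ i *s b i)"

definition is_Z_basis :: "('n::finite \<Rightarrow> int^'m) \<Rightarrow> (int^'m) set \<Rightarrow> bool" where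
  "is_Z_basis b L \<longleftrightarrow> bij_betw (int_comb b) UNIV L"

definition is_quotient_basis :: "('n::finite \<Rightarrow> int^'m) \<Rightarrow> (int^'m) set \<Rightarrow> bool" where
  "is_quotient_basis b L \<longleftrightarrow> bij_betw (\<lambda>c. (+) (int_comb b c) ` L) UNIV (lcosets UNIV L)"

(* The matrix, in some pair of Z-bases, of the map V/Lambda \<rightarrow> Lambda induced by N;
   Lambda is the saturation of the image of N. *)
definition is_cusp_matrix :: "int^4^4 \<Rightarrow> int^2^2 \<Rightarrow> bool" where
  "is_cusp_matrix N M \<longleftrightarrow>
     (\<exists>v l :: 2 \<Rightarrow> int^4. is_quotient_basis v (saturation N) \<and> is_Z_basis l (saturation N) \<and>
        (\<forall>j. N *v v j = (\<Sum>i\<in>UNIV. M $ i $ j *s l i)))"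

(* For unipotent P of size 4 the logarithm series stops after the cube of P - 1. *)
definition unipotent_log :: "rat^4^4 \<Rightarrow> rat^4^4" where
  "unipotent_log P = (\<Sum>j=1..3. map_matrix (\<lambda>c. (-1) ^ (j + 1) / of_nat j * c) (mpow (P - mat 1) j))"


section \<open>Reduced complex spaces and normalization\<close>

(* A reduced complex space is a topological space with a sheaf of complex-valued functions.
   A section over an open set U is a total function of which only the values on U matter. *)
record 'a cspace =
  ctop :: "'a topology"
  sections :: "'a set \<Rightarrow> ('a \<Rightarrow> complex) set"

definition function_sheaf :: "'a cspace \<Rightarrow> bool" where
  "function_sheaf X \<longleftrightarrow>
     (\<forall>U f g. openin (ctop X) U \<longrightarrow> (\<forall>p\<in>U. f p = g p) \<longrightarrow> f \<in> sections X U \<longrightarrow> g \<in> sections X U) \<and>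
     (\<forall>U f. openin (ctop X) U \<longrightarrow>
        (f \<in> sections X U \<longleftrightarrow>
           (\<forall>p\<in>U. \<exists>W. openin (ctop X) W \<and> p \<in> W \<and> W \<subseteq> U \<and> f \<in> sections X W)))"

definition open_subspace :: "'a cspace \<Rightarrow> 'a set \<Rightarrow> 'a cspace" where
  "open_subspace X U = \<lparr>ctop = subtopology (ctop X) U, sections = sections X\<rparr>"

(* The induced reduced structure on an analytic subset A: local restrictions of sections. *)
definition closed_subspace :: "'a cspace \<Rightarrow> 'a set \<Rightarrow> 'a cspace" where
  "closed_subspace X A =
     \<lparr>ctop = subtopology (ctop X) A,
      sections = (\<lambda>U. {f. \<forall>p\<in>U. \<exists>W F. openin (ctop X) W \<and> p \<in> W \<and> F \<in> sections X W \<and>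
                                     (\<forall>q\<in>W \<inter> U. f q = F q)})\<rparr>"

definition biholomorphic_map :: "'a cspace \<Rightarrow> 'b cspace \<Rightarrow> ('a \<Rightarrow> 'b) \<Rightarrow> bool" where
  "biholomorphic_map X Y f \<longleftrightarrow>
     homeomorphic_map (ctop X) (ctop Y) f \<and>
     (\<forall>W g. openin (ctop Y) W \<longrightarrow>
        (g \<in> sections Y W \<longleftrightarrow> g \<circ> f \<in> sections X {p \<in> topspace (ctop X). f p \<in> W}))"

definition analytic_subset :: "'a cspace \<Rightarrow> 'a set \<Rightarrow> bool" where
  "analytic_subset X A \<longleftrightarrow>
     closedin (ctop X) A \<and>
     (\<forall>p\<in>topspace (ctop X). \<exists>W F. openin (ctop X) W \<and> p \<in> W \<and> finite F \<and> F \<subseteq> sections X W \<and>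
        A \<inter> W = {q \<in> W. \<forall>f\<in>F. f q = 0})"

definition thin_subset :: "'a cspace \<Rightarrow> 'a set \<Rightarrow> bool" where
  "thin_subset X A \<longleftrightarrow> analytic_subset X A \<and> ctop X interior_of A = {}"

(* C^n is realised as the sequences vanishing from index n on.  A function on an open subset
   is holomorphic iff it is continuous and holomorphic in each variable separately. *)
definition Cn :: "nat \<Rightarrow> (nat \<Rightarrow> complex) set" where
  "Cn n = {w. \<forall>i\<ge>n. w i = 0}"

definition holomorphic_Cn :: "nat \<Rightarrow> (nat \<Rightarrow> complex) set \<Rightarrow> ((nat \<Rightarrow> complex) \<Rightarrow> complex) \<Rightarrow> bool" where
  "holomorphic_Cn n G g \<longleftrightarrow>
     openin (top_of_set (Cn n)) G \<and> continuous_on G g \<and>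
     (\<forall>w\<in>G. \<forall>i<n. (\<lambda>\<zeta>. g (w(i := \<zeta>))) field_differentiable at (w i))"

definition affine_cspace :: "nat \<Rightarrow> (nat \<Rightarrow> complex) cspace" where
  "affine_cspace n = \<lparr>ctop = top_of_set (Cn n), sections = (\<lambda>G. {g. holomorphic_Cn n G g})\<rparr>"

definition reduced_complex_space :: "'a cspace \<Rightarrow> bool" where
  "reduced_complex_space X \<longleftrightarrow>
     Hausdorff_space (ctop X) \<and> function_sheaf X \<and>
     (\<forall>p\<in>topspace (ctop X). \<exists>U n G Z c.
        openin (ctop X) U \<and> p \<in> U \<and> openin (top_of_set (Cn n)) G \<and>
        analytic_subset (open_subspace (affine_cspace n) G) Z \<and>
        biholomorphic_map (open_subspace X U)
          (closed_subspace (open_subspace (affine_cspace n) G) Z) c)"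

(* Normality: every weakly holomorphic function is holomorphic. *)
definition normal_complex_space :: "'a cspace \<Rightarrow> bool" where
  "normal_complex_space X \<longleftrightarrow>
     reduced_complex_space X \<and>
     (\<forall>U A f. openin (ctop X) U \<longrightarrow> thin_subset (open_subspace X U) A \<longrightarrow>
        f \<in> sections X (U - A) \<longrightarrow>
        (\<forall>p\<in>U. \<exists>W C. openin (ctop X) W \<and> p \<in> W \<and> (\<forall>q\<in>W \<inter> (U - A). norm (f q) \<le> C)) \<longrightarrow>
        (\<exists>F\<in>sections X U. \<forall>q\<in>U - A. F q = f q))"

definition holomorphic_map :: "'a cspace \<Rightarrow> 'b cspace \<Rightarrow> ('a \<Rightarrow> 'b) \<Rightarrow> bool" where
  "holomorphic_map X Y f \<longleftrightarrow>
     continuous_map (ctop X) (ctop Y) f \<and>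
     (\<forall>W g. openin (ctop Y) W \<longrightarrow> g \<in> sections Y W \<longrightarrow>
        g \<circ> f \<in> sections X {p \<in> topspace (ctop X). f p \<in> W})"

definition finite_map :: "'a cspace \<Rightarrow> 'b cspace \<Rightarrow> ('a \<Rightarrow> 'b) \<Rightarrow> bool" where
  "finite_map X Y f \<longleftrightarrow>
     proper_map (ctop X) (ctop Y) f \<and>
     (\<forall>q\<in>topspace (ctop Y). finite {p \<in> topspace (ctop X). f p = q})"

(* X' together with f is a normalization of X. *)
definition is_normalization :: "'b cspace \<Rightarrow> ('b \<Rightarrow> 'a) \<Rightarrow> 'a cspace \<Rightarrow> bool" where
  "is_normalization X' f X \<longleftrightarrow>
     normal_complex_space X' \<and> holomorphic_map X' X f \<and> finite_map X' X f \<and>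
     f ` topspace (ctop X') = topspace (ctop X) \<and>
     (\<exists>A A'. thin_subset X A \<and> A' = {p \<in> topspace (ctop X'). f p \<in> A} \<and>
        ctop X' interior_of A' = {} \<and>
        biholomorphic_map (open_subspace X' (topspace (ctop X') - A'))
          (open_subspace X (topspace (ctop X) - A)) f)"


section \<open>The periodic toric threefold and its quotient\<close>

type_synonym cone = "(int^2) set"
type_synonym character = "(int^2) \<times> int"
type_synonym affine_point = "cone \<times> (character \<Rightarrow> complex)"
type_synonym toric_point = "affine_point set"

definition upper_triangle :: "int^2 \<Rightarrow> (int^2) set" where
  "upper_triangle v = {v, v + axis 1 1, v + axis 2 1}"

definition lower_triangle :: "int^2 \<Rightarrow> (int^2) set" where
  "lower_triangle v = {v + axis 1 1 + axis 2 1, v + axis 1 1, v + axis 2 1}"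

(* A cone of the fan is recorded by the set of the v in Z^2 such that (v,1) spans one of its rays.
   Its faces are the subsets (the empty set is the zero cone), and two cones of the fan
   intersect in the cone recorded by the intersection of the two sets. *)
definition fan :: "cone set" where
  "fan = {\<sigma>. \<exists>v. \<sigma> \<subseteq> upper_triangle v \<or> \<sigma> \<subseteq> lower_triangle v}"

(* The lattice points of the dual cone. *)
definition dual_monoid :: "cone \<Rightarrow> character set" where
  "dual_monoid \<sigma> = {(a, c). \<forall>v\<in>\<sigma>. scalar_product a v + c \<ge> 0}"

(* The points of the affine toric variety of a cone are the monoid homomorphisms from
   the dual monoid to the multiplicative monoid of C, extended by 0. *)
definition affine_toric :: "cone \<Rightarrow> (character \<Rightarrow> complex) set" where
  "affine_toric \<sigma> =
     {\<phi>. \<phi> 0 = 1 \<and> (\<forall>m\<in>dual_monoid \<sigma>. \<forall>n\<in>dual_monoid \<sigma>. \<phi> (m + n) = \<phi> m * \<phi> n) \<and>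
         (\<forall>m. m \<notin> dual_monoid \<sigma> \<longrightarrow> \<phi> m = 0)}"

(* Gluing along the common face; the inclusion of the chart of a face restricts homomorphisms. *)
definition glue :: "(affine_point \<times> affine_point) set" where
  "glue = {((\<sigma>, \<phi>), (\<sigma>', \<phi>')).
     \<sigma> \<in> fan \<and> \<phi> \<in> affine_toric \<sigma> \<and> \<sigma>' \<in> fan \<and> \<phi>' \<in> affine_toric \<sigma>' \<and>
     (\<exists>\<psi>\<in>affine_toric (\<sigma> \<inter> \<sigma>').
        (\<forall>m\<in>dual_monoid \<sigma>. \<psi> m = \<phi> m) \<and> (\<forall>m\<in>dual_monoid \<sigma>'. \<psi> m = \<phi>' m))}"

definition chart :: "cone \<Rightarrow> (character \<Rightarrow> complex) \<Rightarrow> toric_point" where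
  "chart \<sigma> \<phi> = glue `` {(\<sigma>, \<phi>)}"

definition toric_points :: "toric_point set" where
  "toric_points = Sigma fan affine_toric // glue"

(* Charts carry the topology of pointwise convergence, and the toric threefold the final one. *)
definition toric_topology :: "toric_point topology" where
  "toric_topology = topology (\<lambda>W. W \<subseteq> toric_points \<and>
     (\<forall>\<sigma>\<in>fan. openin (top_of_set (affine_toric \<sigma>)) {\<phi> \<in> affine_toric \<sigma>. chart \<sigma> \<phi> \<in> W}))"

definition eval_characters :: "nat \<Rightarrow> (nat \<Rightarrow> character) \<Rightarrow> (character \<Rightarrow> complex) \<Rightarrow> nat \<Rightarrow> complex" where
  "eval_characters n \<mu> \<phi> = (\<lambda>i. if i < n then \<phi> (\<mu> i) else 0)"

(* On each chart, the holomorphic functions are locally the holomorphic functions of finitely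
   many characters that are regular there. *)
definition toric_threefold :: "toric_point cspace" where
  "toric_threefold =
     \<lparr>ctop = toric_topology,
      sections = (\<lambda>W. {f. \<forall>\<sigma>\<in>fan. \<forall>\<phi>\<in>affine_toric \<sigma>. chart \<sigma> \<phi> \<in> W \<longrightarrow>
        (\<exists>n \<mu> G g. (\<forall>i<n. \<mu> i \<in> dual_monoid \<sigma>) \<and> holomorphic_Cn n G g \<and>
           eval_characters n \<mu> \<phi> \<in> G \<and>
           (\<forall>\<psi>\<in>affine_toric \<sigma>. chart \<sigma> \<psi> \<in> W \<longrightarrow> eval_characters n \<mu> \<psi> \<in> G \<longrightarrow>
              f (chart \<sigma> \<psi>) = g (eval_characters n \<mu> \<psi>)))})\<rparr>"

(* The last coordinate character, which is regular on all charts and invariant under gluing. *)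
definition t_coord :: "toric_point \<Rightarrow> complex" where
  "t_coord y = snd (SOME p. p \<in> y) (0, 1)"

(* The point (x,t) of the torus is the homomorphism (a,c) \<mapsto> x^a t^c on the zero cone, so there
   the formula reads (x,t) \<mapsto> (exp(2 pi i D(t) nu) t^nu x, t).  Since the linear map
   (v,h) \<mapsto> (v + h nu, h) permutes the cones, the formula makes sense on all charts. *)
definition act_affine :: "(complex \<Rightarrow> complex^2^2) \<Rightarrow> int^2 \<Rightarrow> affine_point \<Rightarrow> affine_point" where
  "act_affine D \<nu> = (\<lambda>(\<sigma>, \<phi>). ((+) \<nu> ` \<sigma>,
     \<lambda>(a, c). exp (2 * of_real pi * \<i> *
                   scalar_product (\<chi> i. of_int (a $ i)) (D (\<phi> (0, 1)) *v (\<chi> i. of_int (\<nu> $ i)))) *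
              \<phi> (a, c + scalar_product a \<nu>)))"

definition act :: "(complex \<Rightarrow> complex^2^2) \<Rightarrow> int^2 \<Rightarrow> toric_point \<Rightarrow> toric_point" where
  "act D \<nu> y = act_affine D \<nu> ` y"

definition tube :: "real \<Rightarrow> toric_point set" where
  "tube \<epsilon> = {y \<in> toric_points. norm (t_coord y) < \<epsilon>}"

definition orbit :: "int^2^2 \<Rightarrow> (complex \<Rightarrow> complex^2^2) \<Rightarrow> toric_point \<Rightarrow> toric_point set" where
  "orbit M D y = (\<lambda>v. act D (M *v v) y) ` UNIV"

(* The quotient of the tube by the action of M Z^2, with the quotient topology; its holomorphic
   functions are the invariant ones upstairs.  A point is an orbit, hence \<Union>W is the preimage of W. *)
definition compactification :: "int^2^2 \<Rightarrow> (complex \<Rightarrow> complex^2^2) \<Rightarrow> real \<Rightarrow> toric_point set cspace" where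
  "compactification M D \<epsilon> =
     \<lparr>ctop = topology (\<lambda>W. W \<subseteq> orbit M D ` tube \<epsilon> \<and> openin toric_topology (\<Union>W)),
      sections = (\<lambda>W. {f. (\<lambda>y. f (orbit M D y)) \<in> sections toric_threefold (\<Union>W)})\<rparr>"

definition central_fibre :: "int^2^2 \<Rightarrow> (complex \<Rightarrow> complex^2^2) \<Rightarrow> real \<Rightarrow> toric_point set cspace" where
  "central_fibre M D \<epsilon> =
     closed_subspace (compactification M D \<epsilon>) (orbit M D ` {y \<in> tube \<epsilon>. t_coord y = 0})"

end

theory Submission
  imports Defs "HOL-Complex_Analysis.Complex_Analysis"
begin

text \<open>Apart from the components of the normalization everything is a computation with the
  matrices \<open>T(B, d, z)\<close>: the \<open>m\<^sub>i\<close>-th power of \<open>T(B\<^sub>i, d\<^sub>i, z)\<close> is the central element with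
  coordinate \<open>m\<^sub>i z + \<kappa>\<close>, the orbits of the Heisenberg translations on the square-zero locus are
  the level sets of \<open>k\<close>, and there the logarithm of the monodromy acts from \<open>V/\<Lambda>\<close> to \<open>\<Lambda>\<close>
  by a matrix of determinant \<open>s k\<^sup>2 / \<nu>\<close>.

  For the components let \<open>f\<close> be the normalization, an isomorphism off a thin set \<open>A\<close>. For a class
  \<open>k\<close> of \<open>\<int>\<^sup>2\<close> modulo the cusp lattice let \<open>C\<^sub>k\<close> be the part off \<open>A\<close> of the open stratum of the
  central fibre that belongs to \<open>k\<close>, lifted along \<open>f\<close>. The \<open>C\<^sub>k\<close> are connected with dense union, so
  it suffices that their closures are disjoint. If an analytic set that misses all \<open>C\<^sub>k\<close>
  contained, near one of its points, the overlap \<open>R\<close> of the closure of \<open>C\<^sub>k\<close> with the closure of the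
  other strata, then by normality the indicator function of the closure of \<open>C\<^sub>k\<close> would extend
  to a continuous function with values 0 and 1, which is impossible. In particular \<open>R\<close> has no
  isolated points, hence it meets the preimage of a double curve of the central fibre. As \<open>f\<close> is
  finite, its inverse extends from the open stratum continuously to the double curve and holomorphically
  along it. Near a suitable point \<open>R\<close> therefore lies on a holomorphic curve, which in a chart is the
  graph of a function and so analytic: a contradiction.\<close>

no_notation fps_nth (infixl "$" 75)

section \<open>Holomorphic functions along curves\<close>

text \<open>Only one-variable complex analysis enters: \<open>holomorphic_Cn\<close> asks for
  continuity and separate differentiability, so sections are merely restricted to holomorphic
  curves, mostly lines in a chart of the toric threefold. The obstacle is that the thin set is
  arbitrary. It may contain whole double curves, which is exactly where closures of different strata
  have to be compared; hence the inverse is extended by topology first and shown to be holomorphic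
  afterwards. Strata are compared one class against all other classes and not sheet by sheet, so a
  component that crosses itself in the quotient needs no analysis. Triple points of the fibre and
  critical points of the curve are both avoided by moving to another point of the overlap, which
  exists because no point of it is isolated. Once the closures are disjoint they are clopen and are
  the components. Their number is that of the cosets of the cusp lattice, hence
  \<open>\<bar>det M\<bar>\<close>; the induced map carries this index to that of
  \<open>N(V)\<close> in its saturation.\<close>

lemma open_separately_holomorphic_along_graph:
  fixes G :: "complex \<Rightarrow> complex \<Rightarrow> complex"
  assumes cont: "continuous_on (S \<times> T) (\<lambda>(x, y). G x y)" and S: "open S" and T: "open T"
    and hol1: "\<And>y. y \<in> T \<Longrightarrow> (\<lambda>x. G x y) holomorphic_on S"
    and hol2: "\<And>x. x \<in> S \<Longrightarrow> G x holomorphic_on T"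
    and k: "k holomorphic_on S" "k ` S \<subseteq> T"
  shows "(\<lambda>x. G x (k x)) holomorphic_on S"
proof -
  have "(\<lambda>x. G x (k x)) field_differentiable at z" if z: "z \<in> S" for z
  proof -
    obtain r where r: "r > 0" "cball z (2 * r) \<subseteq> S"
    proof -
      obtain r where "r > 0" "cball z r \<subseteq> S" using S z open_contains_cball by blast
      then show ?thesis using that[of "r/2"] by auto
    qed
    have kz: "k z \<in> T" using k z by auto
    \<comment> \<open>The mixed difference of \<open>G\<close> at \<open>z\<close>, up to a
      constant. It is \<open>o(x - z)\<close>, so the composite differs from two one-variable
      functions only by a function with derivative 0.\<close>
    define R where "R = (\<lambda>x. G x (k x) - G x (k z) - G z (k x))"
    have R0: "(R has_field_derivative 0) (at z)"
      unfolding has_field_derivative_iff tendsto_iff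
    proof (intro allI impI)
      fix e :: real assume e: "e > 0"
      obtain q where q: "q > 0" "cball (k z) q \<subseteq> T" using T kz open_contains_cball by blast
      have "compact (cball z (2*r) \<times> cball (k z) q)" by (intro compact_Times) auto
      moreover have "continuous_on (cball z (2*r) \<times> cball (k z) q) (\<lambda>(x,y). G x y)"
        by (rule continuous_on_subset[OF cont]) (use r q in auto)
      ultimately have "uniformly_continuous_on (cball z (2*r) \<times> cball (k z) q) (\<lambda>(x,y). G x y)"
        using compact_uniformly_continuous by blast
      then obtain d where d: "d > 0" "\<And>p p'. p \<in> cball z (2*r) \<times> cball (k z) q \<Longrightarrow>
          p' \<in> cball z (2*r) \<times> cball (k z) q \<Longrightarrow> dist p' p < d \<Longrightarrow>
          dist ((\<lambda>(x,y). G x y) p') ((\<lambda>(x,y). G x y) p) < e * r / 2"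
        unfolding uniformly_continuous_on_def using e r by (metis mult_pos_pos half_gt_zero)
      have small: "cmod (G x y - G x (k z)) \<le> e * r / 2"
        if "x \<in> cball z (2*r)" "dist y (k z) < min d q" for x y
        using d(2)[of "(x, k z)" "(x, y)"] that q by (auto simp: dist_norm dist_Pair_Pair dist_commute norm_minus_commute)
      have lip: "cmod ((G x y - G x (k z)) - (G z y - G z (k z))) \<le> e / 2 * cmod (x - z)"
        if x: "x \<in> ball z r" and y: "dist y (k z) < min d q" for x y
      proof -
        define D where "D = (\<lambda>x. G x y - G x (k z))"
        have yT: "y \<in> T" using y q by (auto simp: dist_commute)
        have holD: "D holomorphic_on S" unfolding D_def by (intro holomorphic_intros hol1 yT kz)
        \<comment> \<open>Cauchy's estimate on \<open>cball w r\<close>, which stays in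
          \<open>cball z (2 * r)\<close>: the bound \<open>e * r / 2\<close> on \<open>D\<close>
          loses the factor \<open>r\<close>.\<close>
        have dD: "cmod (deriv D w) \<le> e / 2" if "w \<in> ball z r" for w
        proof -
          have sub: "cball w r \<subseteq> cball z (2*r)"
          proof
            fix u assume "u \<in> cball w r"
            then show "u \<in> cball z (2*r)" using that dist_triangle[of z u w] by (simp add: dist_commute)
          qed
          have "norm ((deriv ^^ 1) D w) \<le> fact 1 * (e * r / 2) / r ^ 1"
            by (rule Cauchy_inequality)
              (use sub r holD small y in \<open>auto simp: D_def dist_norm norm_minus_commute subset_eq
                 intro!: holomorphic_on_subset[OF holD] holomorphic_on_imp_continuous_on\<close>)
          then show ?thesis using r by simp
        qed
        have "cmod (D x - D z) \<le> e / 2 * cmod (x - z)"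
        proof (rule field_differentiable_bound[of "ball z r" D "deriv D"])
          fix w assume w: "w \<in> ball z r"
          then have "w \<in> S" using r by (auto simp: subset_eq)
          then show "(D has_field_derivative deriv D w) (at w within ball z r)"
            using holD S holomorphic_derivI by blast
        qed (use dD x r in auto)
        then show ?thesis by (simp add: D_def)
      qed
      have "isCont k z" using k z S holomorphic_on_imp_continuous_on continuous_on_eq_continuous_at by blast
      then have "\<forall>\<^sub>F x in at z. dist (k x) (k z) < min d q"
        unfolding isCont_def tendsto_iff using d q by (metis min_less_iff_conj)
      moreover have "\<forall>\<^sub>F x in at z. x \<in> ball z r"
        using r eventually_at_ball[of r z UNIV] by simp
      moreover have "\<forall>\<^sub>F x in at z. x \<noteq> z" by (simp add: eventually_at_filter)
      ultimately show "\<forall>\<^sub>F x in at z. dist ((R x - R z) / (x - z)) 0 < e"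
      proof eventually_elim
        case (elim x)
        have "R x - R z = ((G x (k x) - G x (k z)) - (G z (k x) - G z (k z)))"
          by (simp add: R_def)
        then have "cmod (R x - R z) \<le> e / 2 * cmod (x - z)" using lip[of x "k x"] elim by simp
        then have "cmod ((R x - R z) / (x - z)) \<le> e/2" using elim by (simp add: norm_divide divide_simps)
        then show ?case using e by simp
      qed
    qed
    have d1: "(\<lambda>x. G x (k z)) field_differentiable at z"
      using hol1[OF kz] S z holomorphic_on_imp_differentiable_at by blast
    have d2: "(\<lambda>x. G z (k x)) holomorphic_on S"
      using holomorphic_on_compose_gen[OF k(1) hol2[OF z] k(2)] by (simp add: o_def)
    then have d2: "(\<lambda>x. G z (k x)) field_differentiable at z"
      using S z holomorphic_on_imp_differentiable_at by blast
    have "(\<lambda>x. R x + G x (k z) + G z (k x)) field_differentiable at z"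
      using R0 d1 d2 field_differentiable_def by (intro field_differentiable_add) blast+
    then show ?thesis by (simp add: R_def)
  qed
  then show ?thesis using S holomorphic_on_def field_differentiable_at_within by blast
qed

text \<open>Coordinates from \<open>n\<close> on vanish on \<open>Cn n\<close>, so a basic open set
  of the product topology constrains only finitely many of them and contains a polydisc of one
  common radius.\<close>

lemma Cn_box:
  assumes G: "openin (top_of_set (Cn n)) G" and w: "w \<in> G"
  obtains e where "e > 0" "\<And>w'. w' \<in> Cn n \<Longrightarrow> (\<And>i. i < n \<Longrightarrow> dist (w' i) (w i) < e) \<Longrightarrow> w' \<in> G"
proof -
  obtain V where V: "open V" "G = Cn n \<inter> V" using G by (auto simp: openin_open)
  then have "openin (product_topology (\<lambda>i. euclidean) UNIV) V" "w \<in> V"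
    using w by (auto simp: open_fun_def)
  then obtain X where X: "w \<in> (\<Pi>\<^sub>E i\<in>UNIV. X i)" "\<And>i. open (X i)" "(\<Pi>\<^sub>E i\<in>UNIV. X i) \<subseteq> V"
    using product_topology_open_contains_basis[of "\<lambda>i. euclidean" UNIV V w] by auto
  have "\<exists>e>0. ball (w i) e \<subseteq> X i" for i
    using X(1,2) open_contains_ball[of "X i"] by (auto simp: PiE_iff)
  then obtain e where e: "\<And>i. e i > 0" "\<And>i. ball (w i) (e i) \<subseteq> X i" by metis
  \<comment> \<open>The inserted 1 keeps the set nonempty when \<open>n = 0\<close>.\<close>
  define d where "d = Min (insert 1 (e ` {..<n}))"
  have d: "d > 0" "\<And>i. i < n \<Longrightarrow> d \<le> e i" using e(1) by (auto simp: d_def)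
  have "w' \<in> G" if "w' \<in> Cn n" "\<And>i. i < n \<Longrightarrow> dist (w' i) (w i) < d" for w'
  proof -
    have "w' i \<in> X i" for i
    proof (cases "i < n")
      case True then show ?thesis using that(2)[OF True] d(2)[OF True] e(2)[of i] by (auto simp: dist_commute subset_eq)
    next
      case False
      then have "w' i = w i" using that(1) w V by (auto simp: Cn_def)
      then show ?thesis using X(1) by auto
    qed
    then show ?thesis using X(3) V that(1) by (auto simp: PiE_iff)
  qed
  then show ?thesis using that d(1) by blast
qed

text \<open>The coordinates of the curve are released one at a time; each release is an instance of
  the lemma on graphs, so joint differentiability of \<open>g\<close> is never invoked.\<close>

lemma holomorphic_Cn_along_curve:
  assumes g: "holomorphic_Cn n G g" and S: "open S"
    and h: "\<And>i. i < n \<Longrightarrow> (\<lambda>x. h x i) holomorphic_on S" and hG: "\<And>x. x \<in> S \<Longrightarrow> h x \<in> G"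
  shows "(\<lambda>x. g (h x)) holomorphic_on S"
proof -
  have G: "openin (top_of_set (Cn n)) G" and cont: "continuous_on G g"
    and sep: "\<And>w i. w \<in> G \<Longrightarrow> i < n \<Longrightarrow> (\<lambda>\<zeta>. g (w(i := \<zeta>))) field_differentiable at (w i)"
    using g by (auto simp: holomorphic_Cn_def)
  have GC: "G \<subseteq> Cn n" using G openin_subset by fastforce
  have "(\<lambda>x. g (h x)) field_differentiable at z" if z: "z \<in> S" for z
  proof -
    define w0 where "w0 = h z"
    obtain e where e: "e > 0" "\<And>w'. w' \<in> Cn n \<Longrightarrow> (\<And>i. i < n \<Longrightarrow> dist (w' i) (w0 i) < e) \<Longrightarrow> w' \<in> G"
      using Cn_box[OF G hG[OF z]] w0_def by metis
    define S' where "S' = S \<inter> (\<Inter>i\<in>{..<n}. S \<inter> (\<lambda>x. h x i) -` ball (w0 i) e)"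
    have S': "open S'" unfolding S'_def
      by (intro open_Int S open_INT finite_lessThan ballI continuous_open_preimage
          holomorphic_on_imp_continuous_on h open_ball) simp_all
    have memS': "x \<in> S" "\<And>i. i < n \<Longrightarrow> dist (h x i) (w0 i) < e" if "x \<in> S'" for x
    proof -
      show "x \<in> S" using that by (simp add: S'_def)
      show "dist (h x i) (w0 i) < e" if i: "i < n" for i
        using \<open>x \<in> S'\<close> i by (auto simp: S'_def dist_commute split: if_splits)
    qed
    have zS': "z \<in> S'" using z e by (auto simp: S'_def w0_def)
    \<comment> \<open>The first \<open>j\<close> coordinates follow the curve, the others are frozen
      at \<open>w\<close>. The induction keeps \<open>w\<close> arbitrary because freezing
      coordinate \<open>j\<close> at \<open>y\<close> replaces \<open>w\<close> by
      \<open>w(j := y)\<close>.\<close>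
    define m where "m = (\<lambda>j w x i. if i < j then h x i else w i :: complex)"
    have mem: "(m j w x)(j := y) \<in> G"
      if "j < n" "w \<in> Cn n" "\<And>i. i < n \<Longrightarrow> dist (w i) (w0 i) < e" "x \<in> S'" "dist y (w0 j) < e" for j w x y
    proof (rule e(2))
      show "(m j w x)(j := y) \<in> Cn n" using that(1,2) by (simp add: m_def Cn_def)
      show "dist (((m j w x)(j := y)) i) (w0 i) < e" if "i < n" for i
        using that \<open>dist y (w0 j) < e\<close> memS'(2)[OF \<open>x \<in> S'\<close> that] \<open>\<And>i. i < n \<Longrightarrow> dist (w i) (w0 i) < e\<close> by (simp add: m_def)
    qed
    have "(\<lambda>x. g (m j w x)) holomorphic_on S'"
      if "j \<le> n" "w \<in> Cn n" "\<And>i. i < n \<Longrightarrow> dist (w i) (w0 i) < e" for j w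
      using that
    proof (induction j arbitrary: w)
      case 0
      then show ?case by (simp add: m_def)
    next
      case (Suc j)
      then have j: "j < n" by simp
      have eq: "m (Suc j) w x = (m j w x)(j := h x j)" for x by (auto simp: m_def fun_eq_iff less_Suc_eq)
      have "(\<lambda>x. g ((m j w x)(j := h x j))) holomorphic_on S'"
      proof (rule open_separately_holomorphic_along_graph[where T = "ball (w0 j) e" and G = "\<lambda>x y. g ((m j w x)(j := y))"])
        have hc: "continuous_on (S' \<times> ball (w0 j) e) (\<lambda>p. h (fst p) i)" if "i < n" for i
          by (rule continuous_on_compose2[OF holomorphic_on_imp_continuous_on[OF h[OF that]] continuous_on_fst])
             (auto dest: memS' intro: continuous_on_id)
        show "continuous_on (S' \<times> ball (w0 j) e) (\<lambda>(x, y). g ((m j w x)(j := y)))"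
          unfolding case_prod_beta
        proof (rule continuous_on_compose2[OF cont])
          show "continuous_on (S' \<times> ball (w0 j) e) (\<lambda>p. (m j w (fst p))(j := snd p))"
          proof (rule continuous_on_coordinatewise_then_product)
            fix i show "continuous_on (S' \<times> ball (w0 j) e) (\<lambda>p. ((m j w (fst p))(j := snd p)) i)"
              using hc[of i] j by (cases "i = j"; cases "i < j") (auto simp: m_def intro: continuous_intros)
          qed
        qed (use mem Suc j in \<open>auto simp: dist_commute\<close>)
        show "(\<lambda>x. g ((m j w x)(j := y))) holomorphic_on S'" if "y \<in> ball (w0 j) e" for y
        proof -
          have "(\<lambda>x. g (m j (w(j := y)) x)) holomorphic_on S'"
            by (rule Suc.IH) (use Suc.prems j that in \<open>auto simp: Cn_def dist_commute\<close>)
          moreover have "m j (w(j := y)) x = (m j w x)(j := y)" for x by (auto simp: m_def fun_eq_iff)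
          ultimately show ?thesis by simp
        qed
        show "(\<lambda>y. g ((m j w x)(j := y))) holomorphic_on ball (w0 j) e" if x: "x \<in> S'" for x
        proof (rule holomorphic_onI)
          fix y assume y: "y \<in> ball (w0 j) e"
          then have "(m j w x)(j := y) \<in> G" using mem[of j w x y] j Suc.prems x by (auto simp: dist_commute)
          from sep[OF this j] have "(\<lambda>y. g ((m j w x)(j := y))) field_differentiable at y" by simp
          then show "(\<lambda>y. g ((m j w x)(j := y))) field_differentiable at y within ball (w0 j) e"
            using field_differentiable_at_within by blast
        qed
        show "(\<lambda>x. h x j) holomorphic_on S'" by (rule holomorphic_on_subset[OF h[OF j]]) (use memS' in auto)
        show "(\<lambda>x. h x j) ` S' \<subseteq> ball (w0 j) e" using memS'(2)[OF _ j] by (auto simp: dist_commute)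
      qed (use S' in auto)
      then show ?case by (simp only: eq)
    qed
    from this[of n w0] have "(\<lambda>x. g (m n w0 x)) holomorphic_on S'"
      using GC hG z e by (auto simp: w0_def)
    moreover have "m n w0 x = h x" if "x \<in> S'" for x
    proof -
      have "h x \<in> Cn n" "w0 \<in> Cn n" using hG GC z memS'(1)[OF that] by (auto simp: w0_def)
      then show ?thesis by (simp add: m_def fun_eq_iff Cn_def)
    qed
    ultimately have "(\<lambda>x. g (h x)) holomorphic_on S'" by (simp cong: holomorphic_cong)
    then show ?thesis using S' zS' holomorphic_on_imp_differentiable_at by blast
  qed
  then show ?thesis using S holomorphic_on_def field_differentiable_at_within by blast
qed

text \<open>The shape that an \<open>analytic_subset\<close> takes after pulling back to a curve:
  relatively closed, with local holomorphic equations.\<close>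

definition locally_analytic_set :: "complex set \<Rightarrow> complex set \<Rightarrow> bool" where
  "locally_analytic_set S Z \<longleftrightarrow> Z \<subseteq> S \<and> openin (top_of_set S) (S - Z) \<and>
     (\<forall>z\<in>S. \<exists>W F. open W \<and> z \<in> W \<and> W \<subseteq> S \<and> (\<forall>f\<in>F. f holomorphic_on W) \<and> Z \<inter> W = {x\<in>W. \<forall>f\<in>F. f x = 0})"

text \<open>Identity theorem: the accumulation points in \<open>S\<close> form a relatively closed
  set, which is open because every local equation vanishes near each of them. Connectedness leaves
  the empty set or all of \<open>S\<close>.\<close>

lemma locally_analytic_set_cases:
  assumes S: "open S" "connected S" and Z: "locally_analytic_set S Z"
  shows "Z = S \<or> Z sparse_in S"
proof -
  define acc where "acc = {z \<in> S. z islimpt Z}"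
  have ZS: "Z \<subseteq> S" and cl: "openin (top_of_set S) (S - Z)" using Z by (auto simp: locally_analytic_set_def)
  have "\<exists>T. open T \<and> z \<in> T \<and> T \<subseteq> acc" if z: "z \<in> acc" for z
  proof -
    obtain W F where W: "open W" "z \<in> W" "W \<subseteq> S" "\<forall>f\<in>F. f holomorphic_on W" "Z \<inter> W = {x\<in>W. \<forall>f\<in>F. f x = 0}"
    proof -
      have "z \<in> S" using z by (simp add: acc_def)
      moreover have "\<forall>z\<in>S. \<exists>W F. open W \<and> z \<in> W \<and> W \<subseteq> S \<and> (\<forall>f\<in>F. f holomorphic_on W) \<and> Z \<inter> W = {x\<in>W. \<forall>f\<in>F. f x = 0}"
        using Z by (simp add: locally_analytic_set_def)
      ultimately have "\<exists>W F. open W \<and> z \<in> W \<and> W \<subseteq> S \<and> (\<forall>f\<in>F. f holomorphic_on W) \<and> Z \<inter> W = {x\<in>W. \<forall>f\<in>F. f x = 0}"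
        by (rule bspec[rotated])
      then show ?thesis by (elim exE conjE) (rule that)
    qed
    obtain e where e: "e > 0" "ball z e \<subseteq> W" using openE[OF W(1,2)] by blast
    have lim: "z islimpt (Z \<inter> ball z e)"
    proof (rule islimptI)
      fix T assume T: "z \<in> T" "open T"
      have "z islimpt Z" using z by (simp add: acc_def)
      then obtain y where "y \<in> Z" "y \<in> T \<inter> ball z e" "y \<noteq> z"
        by (rule islimptE[of z Z "T \<inter> ball z e"]) (use T e in auto)
      then show "\<exists>y\<in>Z \<inter> ball z e. y \<in> T \<and> y \<noteq> z" by auto
    qed
    have zero: "f w = 0" if f: "f \<in> F" and w: "w \<in> ball z e" for f w
    proof (rule analytic_continuation[of f "ball z e" "Z \<inter> ball z e" z])
      show "f holomorphic_on ball z e" using W(4) f e(2) holomorphic_on_subset by blast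
      show "f x = 0" if "x \<in> Z \<inter> ball z e" for x
      proof -
        have "x \<in> Z \<inter> W" using that e by auto
        then show ?thesis using W(5) f by simp
      qed
    qed (use lim w e in auto)
    have "ball z e \<subseteq> Z \<inter> W" unfolding W(5) using e zero by auto
    then have "y islimpt Z" if "y \<in> ball z e" for y
      by (meson inf.boundedE interiorI interior_limit_point open_ball that)
    then have "ball z e \<subseteq> acc" using W(3) e by (auto simp: acc_def)
    then show ?thesis using e by (intro exI[of _ "ball z e"]) auto
  qed
  then have "open acc" by (subst open_subopen) blast
  then have 1: "openin (top_of_set S) acc" unfolding openin_open acc_def by blast
  have 2: "openin (top_of_set S) (S - acc)"
  proof -
    have "S - acc = S \<inter> - {z. z islimpt Z}" by (auto simp: acc_def)
    moreover have "open (- {z. z islimpt Z})" using closed_limpts by (simp add: closed_def Compl_eq)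
    ultimately show ?thesis by auto
  qed
  have "acc = {} \<or> acc = S"
    using S(2) 1 2 unfolding connected_clopen closedin_def by (auto simp: acc_def)
  then show ?thesis
  proof
    assume "acc = {}" then show ?thesis using S by (auto simp: sparse_in_open acc_def)
  next
    assume a: "acc = S"
    have "S - Z = {}"
    proof (rule ccontr)
      assume "S - Z \<noteq> {}"
      then obtain z where z: "z \<in> S - Z" by auto
      obtain V where "open V" "S - Z = S \<inter> V" using cl by (auto simp: openin_open)
      then have "open (S - Z)" using S by auto
      then show False using a z islimptE[of z Z "S - Z"] unfolding acc_def by blast
    qed
    then show ?thesis using ZS by auto
  qed
qed

lemma connected_diff_locally_analytic_set:
  assumes "open S" "connected S" "locally_analytic_set S Z"
  shows "connected (S - Z)"
  using locally_analytic_set_cases[OF assms] sparse_imp_connected[of S Z] assms by auto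

lemma holomorphic_off_sparse:
  assumes S: "open S" and f: "continuous_on S f" "f holomorphic_on S - Z" and Z: "Z sparse_in S"
  shows "f holomorphic_on S"
proof -
  have "f field_differentiable at z" if z: "z \<in> S" for z
  proof -
    obtain B where B: "open B" "z \<in> B" "\<forall>y\<in>B. y \<noteq> z \<longrightarrow> y \<notin> Z" using sparse_in_not_in[OF Z z] by blast
    have "f holomorphic_on (S \<inter> B)"
      by (rule no_isolated_singularity[of "S \<inter> B" f "{z}"])
        (use S B f in \<open>auto intro: continuous_on_subset holomorphic_on_subset\<close>)
    then show ?thesis using B S z holomorphic_on_imp_differentiable_at by blast
  qed
  then show ?thesis using S holomorphic_on_def field_differentiable_at_within by blast
qed

section \<open>The toric threefold\<close>

text \<open>The pairing of a character with the ray spanned by \<open>(u, 1)\<close>.\<close>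

definition pr :: "character \<Rightarrow> int^2 \<Rightarrow> int" where
  "pr m u = scalar_product (fst m) u + snd m"

lemma scalar_product_2: "scalar_product (a::'a::semiring_1^2) b = a$1 * b$1 + a$2 * b$2"
  by (simp add: scalar_product_def sum_2)

lemma pr_add [simp]: "pr (m + n) u = pr m u + pr n u"
  and pr_diff [simp]: "pr (m - n) u = pr m u - pr n u"
  and pr_uminus [simp]: "pr (- m) u = - pr m u"
  and pr_zero [simp]: "pr 0 u = 0"
  and pr_height [simp]: "pr (0, 1) u = 1"
  by (simp_all add: pr_def scalar_product_2 algebra_simps)

lemma pr_sum: "pr (sum g I) u = (\<Sum>i\<in>I. pr (g i) u)"
  by (induction I rule: infinite_finite_induct) auto

lemma dual_monoid_iff: "m \<in> dual_monoid \<sigma> \<longleftrightarrow> (\<forall>u\<in>\<sigma>. 0 \<le> pr m u)"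
  by (cases m) (simp add: dual_monoid_def pr_def)

definition triangle :: "cone \<Rightarrow> bool" where
  "triangle \<sigma> \<longleftrightarrow> (\<exists>v. \<sigma> = upper_triangle v \<or> \<sigma> = lower_triangle v)"

lemma fan_iff: "\<sigma> \<in> fan \<longleftrightarrow> (\<exists>\<sigma>'. triangle \<sigma>' \<and> \<sigma> \<subseteq> \<sigma>')"
  by (auto simp: fan_def triangle_def)

lemma triangle_fan: "triangle \<sigma> \<Longrightarrow> \<sigma> \<in> fan"
  by (auto simp: fan_iff)

lemma fan_subset: "\<sigma> \<in> fan \<Longrightarrow> \<rho> \<subseteq> \<sigma> \<Longrightarrow> \<rho> \<in> fan"
  by (auto simp: fan_iff)

lemma triangle_finite: "triangle \<sigma> \<Longrightarrow> finite \<sigma>"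
  by (auto simp: triangle_def upper_triangle_def lower_triangle_def)

lemma fan_finite: "\<sigma> \<in> fan \<Longrightarrow> finite \<sigma>"
  using triangle_finite finite_subset by (auto simp: fan_iff)

lemma axis_2 [simp]: "axis (1::2) (c::'a::zero) $ 1 = c" "axis (1::2) (c::'a::zero) $ 2 = 0" "axis (2::2) (c::'a::zero) $ 1 = 0"
  "axis (2::2) (c::'a::zero) $ 2 = c"
  by (auto simp: axis_def)

lemma triangle_card: "triangle \<sigma> \<Longrightarrow> card \<sigma> = 3"
  by (auto simp: triangle_def upper_triangle_def lower_triangle_def vec_eq_iff exhaust_2 forall_2)

text \<open>The vectors \<open>(u, 1)\<close> over the vertices of a triangle form a basis of the
  rank three lattice. This unimodularity is what makes every chart an affine space.\<close>

lemma triangle_interpolation: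
  assumes "triangle \<sigma>" shows "\<exists>!m. \<forall>u\<in>\<sigma>. pr m u = h u"
proof -
  obtain v where "\<sigma> = upper_triangle v \<or> \<sigma> = lower_triangle v" using assms by (auto simp: triangle_def)
  then show ?thesis
  proof
    assume s: "\<sigma> = upper_triangle v"
    define e1 e2 :: "int^2" where "e1 = axis 1 1" and "e2 = axis 2 1"
    define a1 a2 where "a1 = h (v + e1) - h v" and "a2 = h (v + e2) - h v"
    show ?thesis
    proof (rule ex1I[of _ "(vector [a1, a2], h v - a1 * v $ 1 - a2 * v $ 2)"])
      show "\<forall>u\<in>\<sigma>. pr (vector [a1, a2], h v - a1 * v $ 1 - a2 * v $ 2) u = h u"
        by (auto simp: s upper_triangle_def pr_def scalar_product_2 e1_def e2_def a1_def a2_def algebra_simps)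
    next
      fix m assume "\<forall>u\<in>\<sigma>. pr m u = h u"
      then have "pr m v = h v" "pr m (v + e1) = h (v + e1)" "pr m (v + e2) = h (v + e2)"
        by (auto simp: s upper_triangle_def e1_def e2_def)
      moreover have "pr m (v + e1) = pr m v + fst m $ 1" "pr m (v + e2) = pr m v + fst m $ 2"
        by (simp_all add: pr_def scalar_product_2 e1_def e2_def algebra_simps)
      ultimately have "fst m $ 1 = a1" "fst m $ 2 = a2" "snd m = h v - a1 * v $ 1 - a2 * v $ 2"
        by (auto simp: a1_def a2_def pr_def scalar_product_2)
      then show "m = (vector [a1, a2], h v - a1 * v $ 1 - a2 * v $ 2)"
        by (simp add: prod_eq_iff vec_eq_iff forall_2)
    qed
  next
    assume s: "\<sigma> = lower_triangle v"
    define e1 e2 :: "int^2" where "e1 = axis 1 1" and "e2 = axis 2 1"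
    define w where "w = v + e1 + e2"
    define a1 a2 where "a1 = h w - h (v + e2)" and "a2 = h w - h (v + e1)"
    show ?thesis
    proof (rule ex1I[of _ "(vector [a1, a2], h w - a1 * w $ 1 - a2 * w $ 2)"])
      show "\<forall>u\<in>\<sigma>. pr (vector [a1, a2], h w - a1 * w $ 1 - a2 * w $ 2) u = h u"
        by (auto simp: s lower_triangle_def pr_def scalar_product_2 e1_def e2_def a1_def a2_def w_def algebra_simps)
    next
      fix m assume "\<forall>u\<in>\<sigma>. pr m u = h u"
      then have "pr m w = h w" "pr m (v + e1) = h (v + e1)" "pr m (v + e2) = h (v + e2)"
        by (auto simp: s lower_triangle_def e1_def e2_def w_def)
      moreover have "pr m w = pr m (v + e2) + fst m $ 1" "pr m w = pr m (v + e1) + fst m $ 2"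
        by (simp_all add: pr_def scalar_product_2 e1_def e2_def w_def algebra_simps)
      ultimately have "fst m $ 1 = a1" "fst m $ 2 = a2" "fst m $ 1 * w $ 1 + fst m $ 2 * w $ 2 + snd m = h w"
        by (simp_all add: a1_def a2_def pr_def scalar_product_2)
      then show "m = (vector [a1, a2], h w - a1 * w $ 1 - a2 * w $ 2)"
        by (auto simp: prod_eq_iff vec_eq_iff forall_2)
    qed
  qed
qed

lemma fan_interpolation:
  assumes "\<sigma> \<in> fan" obtains m where "\<And>u. u \<in> \<sigma> \<Longrightarrow> pr m u = h u"
  using assms triangle_interpolation unfolding fan_iff by (metis subsetD)

section \<open>Points as monoid homomorphisms, and their gluing\<close>

lemma affine_toricD:
  assumes "\<phi> \<in> affine_toric \<sigma>"
  shows "\<phi> 0 = 1" "m \<in> dual_monoid \<sigma> \<Longrightarrow> n \<in> dual_monoid \<sigma> \<Longrightarrow> \<phi> (m + n) = \<phi> m * \<phi> n"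
    "m \<notin> dual_monoid \<sigma> \<Longrightarrow> \<phi> m = 0"
  using assms unfolding affine_toric_def by blast+

lemma affine_toric_sum:
  assumes "\<phi> \<in> affine_toric \<sigma>" "finite I" "\<And>i. i \<in> I \<Longrightarrow> g i \<in> dual_monoid \<sigma>"
  shows "sum g I \<in> dual_monoid \<sigma> \<and> \<phi> (sum g I) = (\<Prod>i\<in>I. \<phi> (g i))"
  using assms(2,3)
proof (induction I rule: finite_induct)
  case empty
  then show ?case using affine_toricD(1)[OF assms(1)] by (simp add: dual_monoid_iff)
next
  case (insert i I)
  then show ?case using affine_toricD(2)[OF assms(1), of "g i" "sum g I"] by (auto simp: dual_monoid_iff)
qed

text \<open>The face whose torus orbit contains the point. Together with
  \<open>fraction_values\<close> it is a complete invariant of the glued point, see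
  \<open>glue_iff\<close>.\<close>

definition vanishing_rays :: "cone \<Rightarrow> (character \<Rightarrow> complex) \<Rightarrow> cone" where
  "vanishing_rays \<sigma> \<phi> = {u\<in>\<sigma>. \<forall>m\<in>dual_monoid \<sigma>. 0 < pr m u \<longrightarrow> \<phi> m = 0}"

text \<open>The values on the torus of the orbit through the point, hence independent of the chart.\<close>

definition fraction_values :: "cone \<Rightarrow> (character \<Rightarrow> complex) \<Rightarrow> (character \<times> complex) set" where
  "fraction_values \<sigma> \<phi> = {(k - l, \<phi> k / \<phi> l) | k l. k \<in> dual_monoid \<sigma> \<and> l \<in> dual_monoid \<sigma> \<and> \<phi> k \<noteq> 0 \<and> \<phi> l \<noteq> 0}"

text \<open>For the converse, \<open>k\<close> is dominated by a character \<open>K\<close> that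
  does not vanish at the point; then \<open>\<phi> k\<close> is a factor of the nonzero value
  \<open>\<phi> K\<close>.\<close>

lemma affine_toric_nonzero_iff:
  assumes \<sigma>: "\<sigma> \<in> fan" and \<phi>: "\<phi> \<in> affine_toric \<sigma>" and k: "k \<in> dual_monoid \<sigma>"
  shows "\<phi> k \<noteq> 0 \<longleftrightarrow> (\<forall>u\<in>vanishing_rays \<sigma> \<phi>. pr k u = 0)"
proof -
  have 1: "pr k u = 0" if "\<phi> k \<noteq> 0" "k \<in> dual_monoid \<sigma>" "u \<in> vanishing_rays \<sigma> \<phi>" for k u
    using that by (force simp: vanishing_rays_def dual_monoid_iff order_less_le)
  show ?thesis
  proof
    assume "\<phi> k \<noteq> 0" then show "\<forall>u\<in>vanishing_rays \<sigma> \<phi>. pr k u = 0" using 1 k by blast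
  next
    assume perp: "\<forall>u\<in>vanishing_rays \<sigma> \<phi>. pr k u = 0"
    define S where "S = \<sigma> - vanishing_rays \<sigma> \<phi>"
    have "\<forall>u\<in>S. \<exists>m\<in>dual_monoid \<sigma>. 0 < pr m u \<and> \<phi> m \<noteq> 0" by (auto simp: S_def vanishing_rays_def)
    then obtain g where g: "\<And>u. u \<in> S \<Longrightarrow> g u \<in> dual_monoid \<sigma> \<and> 0 < pr (g u) u \<and> \<phi> (g u) \<noteq> 0" by metis
    have fS: "finite S" using fan_finite[OF \<sigma>] by (simp add: S_def)
    \<comment> \<open>At each ray \<open>u\<close> outside the face, \<open>pr k u\<close> copies of
      \<open>g u\<close>, each of pairing at least 1 with \<open>u\<close>, so that their sum
      dominates \<open>k\<close> on every ray.\<close>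
    define I where "I = (SIGMA u:S. {..<nat (pr k u)})"
    define K where "K = (\<Sum>i\<in>I. g (fst i))"
    have fI: "finite I" using fS by (auto simp: I_def)
    have K: "K \<in> dual_monoid \<sigma>" "\<phi> K \<noteq> 0"
      using affine_toric_sum[OF \<phi> fI, of "\<lambda>i. g (fst i)"] g fI by (auto simp: K_def I_def)
    have "pr k u \<le> pr K u" if u: "u \<in> \<sigma>" for u
    proof (cases "u \<in> S")
      case False
      then show ?thesis using perp u K(1) by (auto simp: S_def dual_monoid_iff)
    next
      case True
      have "pr k u \<le> (\<Sum>i\<in>{u} \<times> {..<nat (pr k u)}. pr (g (fst i)) u)"
      proof -
        have "(\<Sum>i\<in>{u} \<times> {..<nat (pr k u)}. 1) \<le> (\<Sum>i\<in>{u} \<times> {..<nat (pr k u)}. pr (g (fst i)) u)"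
          by (rule sum_mono) (use g[OF True] in auto)
        moreover have "0 \<le> pr k u" using k u by (auto simp: dual_monoid_iff)
        ultimately show ?thesis by simp
      qed
      also have "\<dots> \<le> (\<Sum>i\<in>I. pr (g (fst i)) u)"
        by (rule sum_mono2[OF fI]) (use True g u in \<open>auto simp: I_def dual_monoid_iff\<close>)
      finally show ?thesis by (simp add: K_def pr_sum)
    qed
    then have "K - k \<in> dual_monoid \<sigma>" by (simp add: dual_monoid_iff)
    then have "\<phi> K = \<phi> k * \<phi> (K - k)" using affine_toricD(2)[OF \<phi> k, of "K - k"] by simp
    then show "\<phi> k \<noteq> 0" using K(2) by auto
  qed
qed

lemma fraction_values_single:
  assumes \<phi>: "\<phi> \<in> affine_toric \<sigma>" and "(m, z) \<in> fraction_values \<sigma> \<phi>" "(m, z') \<in> fraction_values \<sigma> \<phi>"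
  shows "z = z'"
proof -
  obtain k l where kl: "k \<in> dual_monoid \<sigma>" "l \<in> dual_monoid \<sigma>" "\<phi> k \<noteq> 0" "\<phi> l \<noteq> 0" "m = k - l" "z = \<phi> k / \<phi> l"
    using assms by (auto simp: fraction_values_def)
  obtain k' l' where kl': "k' \<in> dual_monoid \<sigma>" "l' \<in> dual_monoid \<sigma>" "\<phi> k' \<noteq> 0" "\<phi> l' \<noteq> 0" "m = k' - l'" "z' = \<phi> k' / \<phi> l'"
    using assms by (auto simp: fraction_values_def)
  have "k + l' = k' + l" using kl(5) kl'(5) by (simp add: algebra_simps)
  then have "\<phi> k * \<phi> l' = \<phi> k' * \<phi> l" using affine_toricD(2)[OF \<phi>] kl kl' by metis
  then show ?thesis using kl(4) kl'(4) unfolding kl(6) kl'(6) by (simp add: frac_eq_eq)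
qed

lemma fraction_values_total:
  assumes \<sigma>: "\<sigma> \<in> fan" and \<phi>: "\<phi> \<in> affine_toric \<sigma>"
  shows "(\<exists>z. (m, z) \<in> fraction_values \<sigma> \<phi>) \<longleftrightarrow> (\<forall>u\<in>vanishing_rays \<sigma> \<phi>. pr m u = 0)"
proof
  assume "\<exists>z. (m, z) \<in> fraction_values \<sigma> \<phi>"
  then obtain k l where "k \<in> dual_monoid \<sigma>" "l \<in> dual_monoid \<sigma>" "\<phi> k \<noteq> 0" "\<phi> l \<noteq> 0" "m = k - l"
    by (auto simp: fraction_values_def)
  then show "\<forall>u\<in>vanishing_rays \<sigma> \<phi>. pr m u = 0" using affine_toric_nonzero_iff[OF \<sigma> \<phi>] by simp
next
  assume perp: "\<forall>u\<in>vanishing_rays \<sigma> \<phi>. pr m u = 0"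
  \<comment> \<open>Adding absolute values makes numerator \<open>m + l\<close> and denominator
    \<open>l\<close> regular, while both still annihilate the vanishing rays.\<close>
  obtain l where l: "\<And>u. u \<in> \<sigma> \<Longrightarrow> pr l u = \<bar>pr m u\<bar>" using fan_interpolation[OF \<sigma>, of "\<lambda>u. \<bar>pr m u\<bar>"] by blast
  have sub: "vanishing_rays \<sigma> \<phi> \<subseteq> \<sigma>" by (auto simp: vanishing_rays_def)
  have d: "l \<in> dual_monoid \<sigma>" "m + l \<in> dual_monoid \<sigma>" using l by (auto simp: dual_monoid_iff)
  then have "\<phi> l \<noteq> 0" "\<phi> (m + l) \<noteq> 0"
    using perp l sub by (auto simp: affine_toric_nonzero_iff[OF \<sigma> \<phi>] subset_eq)
  then show "\<exists>z. (m, z) \<in> fraction_values \<sigma> \<phi>"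
    using d unfolding fraction_values_def
    by (intro exI[of _ "\<phi> (m + l) / \<phi> l"] CollectI exI[of _ "m + l"] exI[of _ l]) simp
qed

lemma fraction_values_self:
  assumes "\<phi> \<in> affine_toric \<sigma>" "m \<in> dual_monoid \<sigma>" "\<phi> m \<noteq> 0"
  shows "(m, \<phi> m) \<in> fraction_values \<sigma> \<phi>"
proof -
  have "(m - 0, \<phi> m / \<phi> 0) \<in> fraction_values \<sigma> \<phi>"
    unfolding fraction_values_def using assms affine_toricD(1)[OF assms(1)]
    by (intro CollectI exI[of _ m] exI[of _ 0]) (simp add: dual_monoid_iff)
  then show ?thesis using affine_toricD(1)[OF assms(1)] by simp
qed

text \<open>The chart of a face is a localization: characters that vanish on the face take
  invertible values under \<open>\<psi>\<close>, and multiplying by one that is large on the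
  remaining rays makes any character regular on the face regular on the whole cone.\<close>

lemma face_restriction:
  assumes \<sigma>: "\<sigma> \<in> fan" and \<rho>: "\<rho> \<subseteq> \<sigma>" and \<psi>: "\<psi> \<in> affine_toric \<rho>" and \<phi>: "\<phi> \<in> affine_toric \<sigma>"
    and eq: "\<And>m. m \<in> dual_monoid \<sigma> \<Longrightarrow> \<psi> m = \<phi> m"
  shows "vanishing_rays \<sigma> \<phi> = vanishing_rays \<rho> \<psi>" "fraction_values \<sigma> \<phi> = fraction_values \<rho> \<psi>"
proof -
  have dsub: "m \<in> dual_monoid \<rho>" if "m \<in> dual_monoid \<sigma>" for m using that \<rho> by (auto simp: dual_monoid_iff)
  have unit: "\<psi> l \<noteq> 0" if "\<And>u. u \<in> \<rho> \<Longrightarrow> pr l u = 0" for l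
  proof -
    have "l \<in> dual_monoid \<rho>" "- l \<in> dual_monoid \<rho>" using that by (auto simp: dual_monoid_iff)
    then have "\<psi> (l + - l) = \<psi> l * \<psi> (- l)" by (rule affine_toricD(2)[OF \<psi>])
    then show ?thesis using affine_toricD(1)[OF \<psi>] by auto
  qed
  have bump: "\<exists>l. (\<forall>u\<in>\<rho>. pr l u = 0) \<and> (\<forall>u\<in>\<sigma> - \<rho>. pr l u = h u)" for h
    using fan_interpolation[OF \<sigma>, of "\<lambda>u. if u \<in> \<rho> then 0 else h u"] \<rho> by (metis DiffE subsetD)
  show "vanishing_rays \<sigma> \<phi> = vanishing_rays \<rho> \<psi>"
  proof (intro set_eqI iffI)
    fix u assume u: "u \<in> vanishing_rays \<sigma> \<phi>"
    have "u \<in> \<rho>"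
    proof (rule ccontr)
      assume "u \<notin> \<rho>"
      obtain l where l: "\<forall>u\<in>\<rho>. pr l u = 0" "\<forall>u\<in>\<sigma> - \<rho>. pr l u = 1" using bump[of "\<lambda>_. 1"] by auto
      then have "l \<in> dual_monoid \<sigma>" by (auto simp: dual_monoid_iff)
        (metis DiffI order_refl zero_le_one)
      moreover have "pr l u > 0" using l u \<open>u \<notin> \<rho>\<close> by (auto simp: vanishing_rays_def)
      ultimately show False using u unit[of l] l eq by (auto simp: vanishing_rays_def)
    qed
    moreover have "\<psi> m = 0" if m: "m \<in> dual_monoid \<rho>" "pr m u > 0" for m
    proof -
      obtain l where l: "\<forall>u\<in>\<rho>. pr l u = 0" "\<forall>u\<in>\<sigma> - \<rho>. pr l u = \<bar>pr m u\<bar>" using bump[of "\<lambda>u. \<bar>pr m u\<bar>"] by blast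
      have "0 \<le> pr (m + l) v" if "v \<in> \<sigma>" for v
        using l m that by (cases "v \<in> \<rho>") (auto simp: dual_monoid_iff)
      then have d: "m + l \<in> dual_monoid \<sigma>" by (simp add: dual_monoid_iff)
      have "pr (m + l) u > 0" using l m \<open>u \<in> \<rho>\<close> by simp
      then have "\<phi> (m + l) = 0" using u d unfolding vanishing_rays_def by blast
      then have "\<psi> m * \<psi> l = 0" using eq[OF d] affine_toricD(2)[OF \<psi> m(1), of l] l by (auto simp: dual_monoid_iff)
      then show ?thesis using unit l by auto
    qed
    ultimately show "u \<in> vanishing_rays \<rho> \<psi>" by (auto simp: vanishing_rays_def)
  next
    fix u assume "u \<in> vanishing_rays \<rho> \<psi>"
    then show "u \<in> vanishing_rays \<sigma> \<phi>" using \<rho> eq dsub by (auto simp: vanishing_rays_def)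
  qed
  show "fraction_values \<sigma> \<phi> = fraction_values \<rho> \<psi>"
  proof (intro set_eqI iffI)
    fix p assume "p \<in> fraction_values \<sigma> \<phi>"
    then obtain k l where "k \<in> dual_monoid \<sigma>" "l \<in> dual_monoid \<sigma>" "\<phi> k \<noteq> 0" "\<phi> l \<noteq> 0" "p = (k - l, \<phi> k / \<phi> l)"
      unfolding fraction_values_def by blast
    then show "p \<in> fraction_values \<rho> \<psi>" unfolding fraction_values_def mem_Collect_eq
      by (intro exI[of _ k] exI[of _ l]) (simp add: dsub eq)
  next
    fix p assume "p \<in> fraction_values \<rho> \<psi>"
    then obtain k l where kl: "k \<in> dual_monoid \<rho>" "l \<in> dual_monoid \<rho>" "\<psi> k \<noteq> 0" "\<psi> l \<noteq> 0" "p = (k - l, \<psi> k / \<psi> l)"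
      unfolding fraction_values_def by blast
    obtain j where j: "\<forall>u\<in>\<rho>. pr j u = 0" "\<forall>u\<in>\<sigma> - \<rho>. pr j u = \<bar>pr k u\<bar> + \<bar>pr l u\<bar>" using bump[of "\<lambda>u. \<bar>pr k u\<bar> + \<bar>pr l u\<bar>"] by blast
    have jd: "j \<in> dual_monoid \<rho>" using j by (simp add: dual_monoid_iff)
    have "0 \<le> pr (k + j) v" "0 \<le> pr (l + j) v" if "v \<in> \<sigma>" for v
      using j kl(1,2) that unfolding dual_monoid_iff by (cases "v \<in> \<rho>"; simp)+
    then have d: "k + j \<in> dual_monoid \<sigma>" "l + j \<in> dual_monoid \<sigma>" unfolding dual_monoid_iff by blast+
    have v: "\<phi> (k + j) = \<psi> k * \<psi> j" "\<phi> (l + j) = \<psi> l * \<psi> j"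
      using eq[OF d(1)] eq[OF d(2)] affine_toricD(2)[OF \<psi> kl(1) jd] affine_toricD(2)[OF \<psi> kl(2) jd] by auto
    have "\<psi> j \<noteq> 0" using unit j by auto
    then have "p = ((k + j) - (l + j), \<phi> (k + j) / \<phi> (l + j))" "\<phi> (k + j) \<noteq> 0" "\<phi> (l + j) \<noteq> 0"
      using v kl by auto
    then show "p \<in> fraction_values \<sigma> \<phi>" using d unfolding fraction_values_def by blast
  qed
qed

text \<open>Trades the common extension to the intersection for the equality of two invariants
  attached to each chart separately. In this form symmetry and transitivity of the gluing are
  evident.\<close>

lemma glue_iff:
  assumes "\<sigma> \<in> fan" "\<phi> \<in> affine_toric \<sigma>" "\<sigma>' \<in> fan" "\<phi>' \<in> affine_toric \<sigma>'"
  shows "((\<sigma>, \<phi>), (\<sigma>', \<phi>')) \<in> glue \<longleftrightarrow>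
    vanishing_rays \<sigma> \<phi> = vanishing_rays \<sigma>' \<phi>' \<and> fraction_values \<sigma> \<phi> = fraction_values \<sigma>' \<phi>'"
proof
  assume "((\<sigma>, \<phi>), (\<sigma>', \<phi>')) \<in> glue"
  then obtain \<psi> where \<psi>: "\<psi> \<in> affine_toric (\<sigma> \<inter> \<sigma>')" "\<forall>m\<in>dual_monoid \<sigma>. \<psi> m = \<phi> m" "\<forall>m\<in>dual_monoid \<sigma>'. \<psi> m = \<phi>' m"
    by (auto simp: glue_def)
  show "vanishing_rays \<sigma> \<phi> = vanishing_rays \<sigma>' \<phi>' \<and> fraction_values \<sigma> \<phi> = fraction_values \<sigma>' \<phi>'"
    using face_restriction[of \<sigma> "\<sigma> \<inter> \<sigma>'" \<psi> \<phi>] face_restriction[of \<sigma>' "\<sigma> \<inter> \<sigma>'" \<psi> \<phi>'] assms \<psi> by auto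
next
  assume eq: "vanishing_rays \<sigma> \<phi> = vanishing_rays \<sigma>' \<phi>' \<and> fraction_values \<sigma> \<phi> = fraction_values \<sigma>' \<phi>'"
  define \<tau> where "\<tau> = vanishing_rays \<sigma> \<phi>"
  define H where "H = fraction_values \<sigma> \<phi>"
  define val where "val = (\<lambda>m. THE z. (m, z) \<in> H)"
  have val: "(m, z) \<in> H \<Longrightarrow> val m = z" for m z
    unfolding val_def using fraction_values_single[OF assms(2)] H_def by blast
  have tot: "(m, val m) \<in> H" if "\<forall>u\<in>\<tau>. pr m u = 0" for m
    using fraction_values_total[OF assms(1,2), of m] that val[of m] unfolding \<tau>_def H_def by blast
  have \<tau>: "\<tau> \<subseteq> \<sigma> \<inter> \<sigma>'" using eq by (auto simp: \<tau>_def vanishing_rays_def)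
  \<comment> \<open>The common extension: the shared fraction values on characters orthogonal to the
    face, and 0 on all other characters.\<close>
  define \<psi> where "\<psi> = (\<lambda>m. if m \<in> dual_monoid (\<sigma> \<inter> \<sigma>') \<and> (\<forall>u\<in>\<tau>. pr m u = 0) then val m else 0)"
  have restr: "\<psi> m = \<phi>1 m" if s: "\<sigma>1 \<in> fan" "\<phi>1 \<in> affine_toric \<sigma>1" "vanishing_rays \<sigma>1 \<phi>1 = \<tau>" "fraction_values \<sigma>1 \<phi>1 = H"
      "\<sigma> \<inter> \<sigma>' \<subseteq> \<sigma>1" "m \<in> dual_monoid \<sigma>1" for \<sigma>1 \<phi>1 m
  proof (cases "\<phi>1 m = 0")
    case True
    then show ?thesis using affine_toric_nonzero_iff[OF s(1,2,6)] s by (auto simp: \<psi>_def)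
  next
    case False
    have "m \<in> dual_monoid (\<sigma> \<inter> \<sigma>')" using s by (auto simp: dual_monoid_iff)
    then show ?thesis using affine_toric_nonzero_iff[OF s(1,2,6)] False s val fraction_values_self[OF s(2,6) False]
      by (auto simp: \<psi>_def)
  qed
  have "\<psi> \<in> affine_toric (\<sigma> \<inter> \<sigma>')"
  proof -
    have "\<psi> 0 = 1" using restr[OF assms(1,2), of 0] eq affine_toricD(1)[OF assms(2)]
      by (auto simp: \<tau>_def H_def dual_monoid_iff)
    moreover have "\<psi> (m + n) = \<psi> m * \<psi> n" if mn: "m \<in> dual_monoid (\<sigma> \<inter> \<sigma>')" "n \<in> dual_monoid (\<sigma> \<inter> \<sigma>')" for m n
    proof -
      have nn: "0 \<le> pr m u" "0 \<le> pr n u" if "u \<in> \<tau>" for u using mn \<tau> that by (auto simp: dual_monoid_iff)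
      have d: "m + n \<in> dual_monoid (\<sigma> \<inter> \<sigma>')" using mn by (auto simp: dual_monoid_iff)
      show ?thesis
      proof (cases "(\<forall>u\<in>\<tau>. pr m u = 0) \<and> (\<forall>u\<in>\<tau>. pr n u = 0)")
        case True
        obtain k l where kl: "k \<in> dual_monoid \<sigma>" "l \<in> dual_monoid \<sigma>" "\<phi> k \<noteq> 0" "\<phi> l \<noteq> 0" "m = k - l" "val m = \<phi> k / \<phi> l"
          using tot[of m] True by (auto simp: H_def fraction_values_def)
        obtain k' l' where kl': "k' \<in> dual_monoid \<sigma>" "l' \<in> dual_monoid \<sigma>" "\<phi> k' \<noteq> 0" "\<phi> l' \<noteq> 0" "n = k' - l'" "val n = \<phi> k' / \<phi> l'"
          using tot[of n] True by (auto simp: H_def fraction_values_def)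
        have "k + k' \<in> dual_monoid \<sigma>" "l + l' \<in> dual_monoid \<sigma>" using kl kl' by (auto simp: dual_monoid_iff)
        moreover have "m + n = (k + k') - (l + l')" using kl kl' by simp
        moreover have "\<phi> (k + k') = \<phi> k * \<phi> k'" "\<phi> (l + l') = \<phi> l * \<phi> l'"
          using affine_toricD(2)[OF assms(2)] kl kl' by auto
        ultimately have "(m + n, \<phi> k * \<phi> k' / (\<phi> l * \<phi> l')) \<in> H"
          unfolding H_def fraction_values_def using kl kl' by (smt (verit) mem_Collect_eq mult_eq_0_iff)
        then show ?thesis using val kl kl' True mn d by (auto simp: \<psi>_def)
      next
        case False
        then have "\<not> (\<forall>u\<in>\<tau>. pr (m + n) u = 0)" using nn by (metis add_nonneg_eq_0_iff pr_add)
        then show ?thesis using False by (auto simp: \<psi>_def)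
      qed
    qed
    ultimately show ?thesis by (auto simp: affine_toric_def \<psi>_def)
  qed
  then show "((\<sigma>, \<phi>), (\<sigma>', \<phi>')) \<in> glue"
    unfolding glue_def mem_Collect_eq case_prod_conv
    using assms restr[OF assms(1,2)] restr[OF assms(3,4)] eq unfolding \<tau>_def H_def by blast
qed

section \<open>Monomial coordinates on the charts of triangles\<close>

lemma continuous_on_coordinate: "continuous_on S (\<lambda>x :: 'a \<Rightarrow> 'b::topological_space. x i)"
  by (rule continuous_on_subset[OF continuous_on_product_coordinates]) simp

text \<open>Total in \<open>m\<close>, also for negative exponents: \<open>0 powi k\<close> is 1 for
  \<open>k = 0\<close> and 0 otherwise. Identities for products therefore need the vanishing
  coordinates to have exponent 0, or all exponents to be nonnegative.\<close>

definition mon :: "cone \<Rightarrow> (int^2 \<Rightarrow> complex) \<Rightarrow> character \<Rightarrow> complex" where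
  "mon \<sigma> x m = (\<Prod>u\<in>\<sigma>. x u powi pr m u)"

definition toric_hom :: "cone \<Rightarrow> (int^2 \<Rightarrow> complex) \<Rightarrow> character \<Rightarrow> complex" where
  "toric_hom \<sigma> x m = (if m \<in> dual_monoid \<sigma> then mon \<sigma> x m else 0)"

text \<open>For a triangle the values of \<open>x\<close> at the three vertices are coordinates on the chart, which is
  a copy of affine space; \<open>x\<close> vanishes exactly on the rays of the cone whose orbit contains the point.\<close>

definition tpoint :: "cone \<Rightarrow> (int^2 \<Rightarrow> complex) \<Rightarrow> toric_point" where
  "tpoint \<sigma> x = chart \<sigma> (toric_hom \<sigma> x)"

lemma power_int_add_nonneg:
  fixes x :: complex
  assumes "0 \<le> a" "0 \<le> b" shows "x powi (a + b) = x powi a * x powi b"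
  using assms by (simp add: power_int_def nat_add_distrib power_add)

lemma toric_hom_affine: "toric_hom \<sigma> x \<in> affine_toric \<sigma>"
proof -
  have "toric_hom \<sigma> x (m + n) = toric_hom \<sigma> x m * toric_hom \<sigma> x n"
    if "m \<in> dual_monoid \<sigma>" "n \<in> dual_monoid \<sigma>" for m n
  proof -
    have "m + n \<in> dual_monoid \<sigma>" using that by (simp add: dual_monoid_iff)
    moreover have "mon \<sigma> x (m + n) = mon \<sigma> x m * mon \<sigma> x n"
      unfolding mon_def prod.distrib[symmetric] using that
      by (intro prod.cong refl) (simp add: dual_monoid_iff power_int_add_nonneg)
    ultimately show ?thesis using that by (simp add: toric_hom_def)
  qed
  moreover have "toric_hom \<sigma> x 0 = 1" by (simp add: toric_hom_def mon_def dual_monoid_iff)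
  ultimately show ?thesis unfolding affine_toric_def by (simp add: toric_hom_def)
qed

lemma vanishing_rays_toric_hom:
  assumes \<sigma>: "\<sigma> \<in> fan" shows "vanishing_rays \<sigma> (toric_hom \<sigma> x) = {u\<in>\<sigma>. x u = 0}"
proof (intro set_eqI iffI)
  fix u assume u: "u \<in> vanishing_rays \<sigma> (toric_hom \<sigma> x)"
  then have us: "u \<in> \<sigma>" by (simp add: vanishing_rays_def)
  obtain m where m: "\<And>w. w \<in> \<sigma> \<Longrightarrow> pr m w = (if w = u then 1 else 0)"
    using fan_interpolation[OF \<sigma>, of "\<lambda>w. if w = u then 1 else 0"] by blast
  then have "m \<in> dual_monoid \<sigma>" by (simp add: dual_monoid_iff)
  then have "mon \<sigma> x m = 0" using u us m by (simp add: vanishing_rays_def toric_hom_def)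
  moreover have "mon \<sigma> x m = x u"
    unfolding mon_def using fan_finite[OF \<sigma>] us m
    by (simp add: prod.remove[of \<sigma> u])
  ultimately show "u \<in> {u\<in>\<sigma>. x u = 0}" using us by simp
next
  fix u assume u: "u \<in> {u\<in>\<sigma>. x u = 0}"
  have "mon \<sigma> x m = 0" if "0 < pr m u" for m
    unfolding mon_def using fan_finite[OF \<sigma>] u that by (intro prod_zero bexI[of _ u]) auto
  then show "u \<in> vanishing_rays \<sigma> (toric_hom \<sigma> x)" using u
    unfolding vanishing_rays_def toric_hom_def by simp
qed

lemma fraction_values_toric_hom:
  assumes \<sigma>: "\<sigma> \<in> fan"
  shows "fraction_values \<sigma> (toric_hom \<sigma> x) = {(m, mon \<sigma> x m) | m. \<forall>u\<in>\<sigma>. x u = 0 \<longrightarrow> pr m u = 0}"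
proof -
  let ?\<phi> = "toric_hom \<sigma> x"
  have perp: "(\<exists>z. (m, z) \<in> fraction_values \<sigma> ?\<phi>) \<longleftrightarrow> (\<forall>u\<in>\<sigma>. x u = 0 \<longrightarrow> pr m u = 0)" for m
    unfolding fraction_values_total[OF \<sigma> toric_hom_affine] vanishing_rays_toric_hom[OF \<sigma>] by auto
  have val: "z = mon \<sigma> x m" if mz: "(m, z) \<in> fraction_values \<sigma> ?\<phi>" for m z
  proof -
    obtain k l where kl: "k \<in> dual_monoid \<sigma>" "l \<in> dual_monoid \<sigma>" "?\<phi> k \<noteq> 0" "?\<phi> l \<noteq> 0" "m = k - l" "z = ?\<phi> k / ?\<phi> l"
      using mz unfolding fraction_values_def by blast
    have "\<forall>u\<in>\<sigma>. x u = 0 \<longrightarrow> pr k u = 0" "\<forall>u\<in>\<sigma>. x u = 0 \<longrightarrow> pr l u = 0"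
      using kl affine_toric_nonzero_iff[OF \<sigma> toric_hom_affine] by (auto simp: vanishing_rays_toric_hom[OF \<sigma>])
    then have "mon \<sigma> x k / mon \<sigma> x l = mon \<sigma> x (k - l)"
      unfolding mon_def prod_dividef[symmetric]
      by (intro prod.cong refl) (auto simp: power_int_diff)
    then show ?thesis using kl by (simp add: toric_hom_def)
  qed
  show ?thesis using perp val by (intro set_eqI) (force simp del: split_paired_All split_paired_Ex)
qed

lemma chart_eq_iff:
  assumes "\<sigma> \<in> fan" "\<phi> \<in> affine_toric \<sigma>" "\<sigma>' \<in> fan" "\<phi>' \<in> affine_toric \<sigma>'"
  shows "chart \<sigma> \<phi> = chart \<sigma>' \<phi>' \<longleftrightarrow>
    vanishing_rays \<sigma> \<phi> = vanishing_rays \<sigma>' \<phi>' \<and> fraction_values \<sigma> \<phi> = fraction_values \<sigma>' \<phi>'"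
proof
  assume "chart \<sigma> \<phi> = chart \<sigma>' \<phi>'"
  moreover have "(\<sigma>', \<phi>') \<in> chart \<sigma>' \<phi>'" using glue_iff[OF assms(3,4) assms(3,4)] by (simp add: chart_def)
  ultimately have "(\<sigma>', \<phi>') \<in> chart \<sigma> \<phi>" by simp
  then show "vanishing_rays \<sigma> \<phi> = vanishing_rays \<sigma>' \<phi>' \<and> fraction_values \<sigma> \<phi> = fraction_values \<sigma>' \<phi>'"
    using glue_iff[OF assms] by (simp add: chart_def)
next
  assume eq: "vanishing_rays \<sigma> \<phi> = vanishing_rays \<sigma>' \<phi>' \<and> fraction_values \<sigma> \<phi> = fraction_values \<sigma>' \<phi>'"
  have "p \<in> chart \<sigma> \<phi> \<longleftrightarrow> p \<in> chart \<sigma>' \<phi>'" for p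
  proof (cases p)
    case (Pair \<rho> \<psi>)
    show ?thesis
    proof (cases "\<rho> \<in> fan \<and> \<psi> \<in> affine_toric \<rho>")
      case True
      then show ?thesis using eq glue_iff[OF assms(1,2), of \<rho> \<psi>] glue_iff[OF assms(3,4), of \<rho> \<psi>]
        by (simp add: chart_def Pair)
    next
      case False
      then show ?thesis by (auto simp: chart_def Pair glue_def)
    qed
  qed
  then show "chart \<sigma> \<phi> = chart \<sigma>' \<phi>'" by blast
qed

lemma chart_member:
  assumes "\<sigma> \<in> fan" "\<phi> \<in> affine_toric \<sigma>"
  shows "p \<in> chart \<sigma> \<phi> \<longleftrightarrow> (\<exists>\<rho> \<psi>. p = (\<rho>, \<psi>) \<and> \<rho> \<in> fan \<and> \<psi> \<in> affine_toric \<rho> \<and> chart \<rho> \<psi> = chart \<sigma> \<phi>)"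
proof (cases p)
  case (Pair \<rho> \<psi>)
  show ?thesis
  proof (cases "\<rho> \<in> fan \<and> \<psi> \<in> affine_toric \<rho>")
    case True
    then show ?thesis using glue_iff[OF assms(1,2), of \<rho> \<psi>] chart_eq_iff[of \<rho> \<psi> \<sigma> \<phi>] assms
      by (auto simp: chart_def Pair)
  next
    case False
    then show ?thesis by (auto simp: chart_def Pair glue_def)
  qed
qed

lemma tpoint_eq_iff:
  assumes "\<sigma> \<in> fan" "\<sigma>' \<in> fan"
  shows "tpoint \<sigma> x = tpoint \<sigma>' x' \<longleftrightarrow> {u\<in>\<sigma>. x u = 0} = {u\<in>\<sigma>'. x' u = 0} \<and>
    (\<forall>m. (\<forall>u\<in>\<sigma>. x u = 0 \<longrightarrow> pr m u = 0) \<longrightarrow> mon \<sigma> x m = mon \<sigma>' x' m)"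
proof -
  have *: "{(m, f m) | m. P m} = {(m, g m) | m. Q m} \<longleftrightarrow> (\<forall>m. P m = Q m \<and> (P m \<longrightarrow> f m = g m))"
    for f g :: "character \<Rightarrow> complex" and P Q
    by (auto simp: set_eq_iff simp del: split_paired_All split_paired_Ex)
  show ?thesis
    unfolding tpoint_def chart_eq_iff[OF assms(1) toric_hom_affine assms(2) toric_hom_affine]
      vanishing_rays_toric_hom[OF assms(1)] vanishing_rays_toric_hom[OF assms(2)]
      fraction_values_toric_hom[OF assms(1)] fraction_values_toric_hom[OF assms(2)] *
  proof (rule conj_cong[OF refl])
    assume z: "{u\<in>\<sigma>. x u = 0} = {u\<in>\<sigma>'. x' u = 0}"
    have "(\<forall>u\<in>\<sigma>. x u = 0 \<longrightarrow> pr m u = 0) \<longleftrightarrow> (\<forall>u\<in>\<sigma>'. x' u = 0 \<longrightarrow> pr m u = 0)" for m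
      using z by blast
    then show "(\<forall>m. (\<forall>u\<in>\<sigma>. x u = 0 \<longrightarrow> pr m u = 0) = (\<forall>u\<in>\<sigma>'. x' u = 0 \<longrightarrow> pr m u = 0) \<and>
         ((\<forall>u\<in>\<sigma>. x u = 0 \<longrightarrow> pr m u = 0) \<longrightarrow> mon \<sigma> x m = mon \<sigma>' x' m)) \<longleftrightarrow>
      (\<forall>m. (\<forall>u\<in>\<sigma>. x u = 0 \<longrightarrow> pr m u = 0) \<longrightarrow> mon \<sigma> x m = mon \<sigma>' x' m)" by blast
  qed
qed

text \<open>The dual basis of a unimodular triangle. The values of a point at these characters are
  its affine coordinates.\<close>

definition dual_char :: "cone \<Rightarrow> int^2 \<Rightarrow> character" where
  "dual_char \<sigma> u = (THE m. \<forall>w\<in>\<sigma>. pr m w = (if w = u then 1 else 0))"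

lemma pr_dual_char: "triangle \<sigma> \<Longrightarrow> w \<in> \<sigma> \<Longrightarrow> pr (dual_char \<sigma> u) w = (if w = u then 1 else 0)"
  using theI'[OF triangle_interpolation[of \<sigma> "\<lambda>w. if w = u then 1 else 0"]] unfolding dual_char_def by blast

lemma dual_char_in: "triangle \<sigma> \<Longrightarrow> dual_char \<sigma> u \<in> dual_monoid \<sigma>"
  by (simp add: dual_monoid_iff pr_dual_char)

lemma character_eqI: "triangle \<sigma> \<Longrightarrow> (\<And>u. u \<in> \<sigma> \<Longrightarrow> pr m u = pr n u) \<Longrightarrow> m = n"
  using triangle_interpolation[of \<sigma> "pr n"] by (metis (no_types, lifting))

text \<open>Expansion of \<open>m\<close> in the dual basis, paired with a vector \<open>u\<close>
  that may lie outside the triangle. This is the exponent computation behind a change of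
  charts.\<close>

lemma sum_dual_char:
  assumes "triangle \<sigma>" shows "(\<Sum>w\<in>\<sigma>. pr (dual_char \<sigma> w) u * pr m w) = pr m u"
proof -
  define cs where "cs = (\<lambda>(k::int) n. (k *s fst n, k * snd n) :: character)"
  have pr_cs: "pr (cs k n) u = k * pr n u" for k n u
    by (simp add: pr_def cs_def scalar_product_2 algebra_simps)
  have "(\<Sum>w\<in>\<sigma>. cs (pr m w) (dual_char \<sigma> w)) = m"
    by (rule character_eqI[OF assms])
      (simp add: pr_sum pr_cs pr_dual_char assms triangle_finite if_distrib cong: if_cong)
  then have "pr m u = pr (\<Sum>w\<in>\<sigma>. cs (pr m w) (dual_char \<sigma> w)) u" by simp
  then show ?thesis by (simp add: pr_sum pr_cs mult.commute)
qed

lemma mon_dual_char: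
  assumes "triangle \<sigma>" "u \<in> \<sigma>" shows "mon \<sigma> x (dual_char \<sigma> u) = x u"
  unfolding mon_def using assms triangle_finite
  by (simp add: prod.remove[of \<sigma> u] pr_dual_char)

text \<open>A regular character is a nonnegative combination of the dual basis, so three
  unrestricted complex values determine the homomorphism.\<close>

lemma affine_toric_eq_toric_hom:
  assumes \<sigma>: "triangle \<sigma>" and \<phi>: "\<phi> \<in> affine_toric \<sigma>"
  shows "\<phi> = toric_hom \<sigma> (\<lambda>u. \<phi> (dual_char \<sigma> u))"
proof
  fix m
  show "\<phi> m = toric_hom \<sigma> (\<lambda>u. \<phi> (dual_char \<sigma> u)) m"
  proof (cases "m \<in> dual_monoid \<sigma>")
    case False
    then show ?thesis using affine_toricD(3)[OF \<phi>] by (simp add: toric_hom_def)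
  next
    case True
    define I where "I = (SIGMA u:\<sigma>. {..<nat (pr m u)})"
    have fI: "finite I" using triangle_finite[OF \<sigma>] by (auto simp: I_def)
    have "(\<Sum>i\<in>I. dual_char \<sigma> (fst i)) = m"
    proof (rule character_eqI[OF \<sigma>])
      fix u assume u: "u \<in> \<sigma>"
      have "pr (\<Sum>i\<in>I. dual_char \<sigma> (fst i)) u = (\<Sum>w\<in>\<sigma>. \<Sum>i<nat (pr m w). pr (dual_char \<sigma> w) u)"
        unfolding pr_sum I_def by (subst sum.Sigma) (auto simp: triangle_finite[OF \<sigma>] case_prod_beta)
      also have "\<dots> = pr m u"
        using True u by (simp add: pr_dual_char \<sigma> triangle_finite if_distrib dual_monoid_iff cong: if_cong)
      finally show "pr (\<Sum>i\<in>I. dual_char \<sigma> (fst i)) u = pr m u" .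
    qed
    then have "\<phi> m = (\<Prod>i\<in>I. \<phi> (dual_char \<sigma> (fst i)))"
      using affine_toric_sum[OF \<phi> fI, of "\<lambda>i. dual_char \<sigma> (fst i)"] dual_char_in[OF \<sigma>] by simp
    also have "\<dots> = (\<Prod>u\<in>\<sigma>. \<Prod>i<nat (pr m u). \<phi> (dual_char \<sigma> u))"
      unfolding I_def by (subst prod.Sigma) (auto simp: triangle_finite[OF \<sigma>] case_prod_beta)
    also have "\<dots> = mon \<sigma> (\<lambda>u. \<phi> (dual_char \<sigma> u)) m"
      unfolding mon_def using True by (intro prod.cong refl) (simp add: dual_monoid_iff power_int_def)
    finally show ?thesis using True by (simp add: toric_hom_def)
  qed
qed

text \<open>Restricting a homomorphism to the smaller dual monoid of a containing triangle does not
  change the glued point. Hence triangles alone serve as charts.\<close>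

lemma chart_eq_tpoint:
  assumes \<sigma>: "triangle \<sigma>" and \<rho>: "\<rho> \<subseteq> \<sigma>" and \<phi>: "\<phi> \<in> affine_toric \<rho>"
  shows "chart \<rho> \<phi> = tpoint \<sigma> (\<lambda>u. \<phi> (dual_char \<sigma> u))"
proof -
  define \<psi> where "\<psi> = (\<lambda>m. if m \<in> dual_monoid \<sigma> then \<phi> m else 0)"
  have dsub: "m \<in> dual_monoid \<rho>" if "m \<in> dual_monoid \<sigma>" for m using that \<rho> by (auto simp: dual_monoid_iff)
  have \<psi>: "\<psi> \<in> affine_toric \<sigma>"
    unfolding affine_toric_def \<psi>_def using affine_toricD[OF \<phi>] dsub by (auto simp: dual_monoid_iff simp del: split_paired_All)
  have f: "\<sigma> \<in> fan" "\<rho> \<in> fan" using triangle_fan[OF \<sigma>] fan_subset \<rho> by auto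
  have "chart \<rho> \<phi> = chart \<sigma> \<psi>"
    unfolding chart_eq_iff[OF f(2) \<phi> f(1) \<psi>]
    using face_restriction[OF f(1) \<rho> \<phi> \<psi>] by (simp add: \<psi>_def)
  moreover have "(\<lambda>u. \<psi> (dual_char \<sigma> u)) = (\<lambda>u. \<phi> (dual_char \<sigma> u))"
    using dual_char_in[OF \<sigma>] by (simp add: \<psi>_def)
  then have "\<psi> = toric_hom \<sigma> (\<lambda>u. \<phi> (dual_char \<sigma> u))"
    using affine_toric_eq_toric_hom[OF \<sigma> \<psi>] by simp
  ultimately show ?thesis by (simp add: tpoint_def)
qed

lemma chart_in_toric_points: "\<sigma> \<in> fan \<Longrightarrow> \<phi> \<in> affine_toric \<sigma> \<Longrightarrow> chart \<sigma> \<phi> \<in> toric_points"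
  unfolding toric_points_def chart_def by (auto intro: quotientI)

lemma tpoint_in: "\<sigma> \<in> fan \<Longrightarrow> tpoint \<sigma> x \<in> toric_points"
  unfolding tpoint_def by (intro chart_in_toric_points toric_hom_affine)

lemma toric_pointsE:
  assumes "y \<in> toric_points" obtains \<sigma> x where "triangle \<sigma>" "y = tpoint \<sigma> x"
proof -
  obtain \<rho> \<phi> where "\<rho> \<in> fan" "\<phi> \<in> affine_toric \<rho>" "y = chart \<rho> \<phi>"
    using assms by (auto simp: toric_points_def quotient_def chart_def)
  then show ?thesis using chart_eq_tpoint that by (metis fan_iff)
qed

lemma t_coord_chart:
  assumes "\<sigma> \<in> fan" "\<phi> \<in> affine_toric \<sigma>" shows "t_coord (chart \<sigma> \<phi>) = \<phi> (0, 1)"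
proof -
  have d: "(0, 1) \<in> dual_monoid \<rho>" for \<rho> by (simp add: dual_monoid_iff)
  have "snd p (0, 1) = \<phi> (0, 1)" if p: "p \<in> chart \<sigma> \<phi>" for p
  proof -
    obtain \<rho> \<xi> \<psi> where "p = (\<rho>, \<xi>)" "\<forall>m\<in>dual_monoid \<sigma>. \<psi> m = \<phi> m" "\<forall>m\<in>dual_monoid \<rho>. \<psi> m = \<xi> m"
      using p by (auto simp: chart_def glue_def)
    then show ?thesis using d by (metis snd_conv)
  qed
  moreover have "(\<sigma>, \<phi>) \<in> chart \<sigma> \<phi>" unfolding chart_member[OF assms] using assms by blast
  ultimately show ?thesis unfolding t_coord_def by (metis someI)
qed

lemma t_coord_tpoint:
  assumes "\<sigma> \<in> fan" shows "t_coord (tpoint \<sigma> x) = (\<Prod>u\<in>\<sigma>. x u)"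
  using t_coord_chart[OF assms toric_hom_affine]
  by (simp add: tpoint_def toric_hom_def mon_def dual_monoid_iff)

text \<open>The cone whose torus orbit contains the point.\<close>

definition min_cone :: "toric_point \<Rightarrow> cone" where
  "min_cone y = (\<Union>(\<sigma>, \<phi>)\<in>y. vanishing_rays \<sigma> \<phi>)"

lemma min_cone_chart:
  assumes "\<sigma> \<in> fan" "\<phi> \<in> affine_toric \<sigma>" shows "min_cone (chart \<sigma> \<phi>) = vanishing_rays \<sigma> \<phi>"
proof -
  have "vanishing_rays \<rho> \<psi> = vanishing_rays \<sigma> \<phi>" if "(\<rho>, \<psi>) \<in> chart \<sigma> \<phi>" for \<rho> \<psi>
    using that chart_member[OF assms] chart_eq_iff assms by auto
  moreover have "(\<sigma>, \<phi>) \<in> chart \<sigma> \<phi>" using assms chart_member by blast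
  ultimately show ?thesis unfolding min_cone_def by fast
qed

lemma min_cone_tpoint: "\<sigma> \<in> fan \<Longrightarrow> min_cone (tpoint \<sigma> x) = {u\<in>\<sigma>. x u = 0}"
  by (simp add: tpoint_def min_cone_chart toric_hom_affine vanishing_rays_toric_hom)

section \<open>The topology of the toric threefold\<close>

lemma openin_toric_topology:
  "openin toric_topology W \<longleftrightarrow> W \<subseteq> toric_points \<and>
     (\<forall>\<sigma>\<in>fan. openin (top_of_set (affine_toric \<sigma>)) {\<phi> \<in> affine_toric \<sigma>. chart \<sigma> \<phi> \<in> W})"
proof -
  have "istopology (\<lambda>W. W \<subseteq> toric_points \<and>
     (\<forall>\<sigma>\<in>fan. openin (top_of_set (affine_toric \<sigma>)) {\<phi> \<in> affine_toric \<sigma>. chart \<sigma> \<phi> \<in> W}))"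
    unfolding istopology_def
  proof (rule conjI; clarsimp)
    fix S T assume "\<forall>\<sigma>\<in>fan. openin (top_of_set (affine_toric \<sigma>)) {\<phi> \<in> affine_toric \<sigma>. chart \<sigma> \<phi> \<in> S}"
      "\<forall>\<sigma>\<in>fan. openin (top_of_set (affine_toric \<sigma>)) {\<phi> \<in> affine_toric \<sigma>. chart \<sigma> \<phi> \<in> T}" "S \<subseteq> toric_points" "T \<subseteq> toric_points"
    moreover have "{\<phi> \<in> affine_toric \<sigma>. chart \<sigma> \<phi> \<in> S \<and> chart \<sigma> \<phi> \<in> T} =
      {\<phi> \<in> affine_toric \<sigma>. chart \<sigma> \<phi> \<in> S} \<inter> {\<phi> \<in> affine_toric \<sigma>. chart \<sigma> \<phi> \<in> T}" for \<sigma> by auto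
    ultimately show "S \<inter> T \<subseteq> toric_points \<and> (\<forall>\<sigma>\<in>fan. openin (top_of_set (affine_toric \<sigma>)) {\<phi> \<in> affine_toric \<sigma>. chart \<sigma> \<phi> \<in> S \<and> chart \<sigma> \<phi> \<in> T})"
      by (auto intro: openin_Int)
  next
    fix K assume K: "\<forall>k\<in>K. k \<subseteq> toric_points \<and> (\<forall>\<sigma>\<in>fan. openin (top_of_set (affine_toric \<sigma>)) {\<phi> \<in> affine_toric \<sigma>. chart \<sigma> \<phi> \<in> k})"
    have "{\<phi> \<in> affine_toric \<sigma>. \<exists>k\<in>K. chart \<sigma> \<phi> \<in> k} = \<Union>((\<lambda>k. {\<phi> \<in> affine_toric \<sigma>. chart \<sigma> \<phi> \<in> k}) ` K)" for \<sigma> by auto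
    then show "\<Union> K \<subseteq> toric_points \<and> (\<forall>\<sigma>\<in>fan. openin (top_of_set (affine_toric \<sigma>)) {\<phi> \<in> affine_toric \<sigma>. \<exists>k\<in>K. chart \<sigma> \<phi> \<in> k})"
      using K by (auto intro!: openin_Union)
  qed
  then show ?thesis unfolding toric_topology_def by (simp add: topology_inverse')
qed

lemma continuous_on_toric_hom: "continuous_on S (\<lambda>x. toric_hom \<sigma> x m)"
proof (cases "m \<in> dual_monoid \<sigma>")
  case True
  then have "toric_hom \<sigma> x m = (\<Prod>u\<in>\<sigma>. x u ^ nat (pr m u))" for x
    by (simp add: toric_hom_def mon_def dual_monoid_iff power_int_def cong: prod.cong)
  then show ?thesis by (simp only:) (intro continuous_on_prod continuous_on_power continuous_on_coordinate)
next
  case False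
  then show ?thesis by (simp add: toric_hom_def)
qed

text \<open>Coordinates are functions on all of \<open>int^2\<close> with the product topology,
  although only three values matter; this gives every triangle the same coordinate space.\<close>

lemma openin_toric_topology_tpoint:
  "openin toric_topology W \<longleftrightarrow> W \<subseteq> toric_points \<and> (\<forall>\<sigma>. triangle \<sigma> \<longrightarrow> open {x. tpoint \<sigma> x \<in> W})"
proof
  assume W: "openin toric_topology W"
  have "open {x. tpoint \<sigma> x \<in> W}" if \<sigma>: "triangle \<sigma>" for \<sigma>
  proof -
    have "openin (top_of_set (affine_toric \<sigma>)) {\<phi> \<in> affine_toric \<sigma>. chart \<sigma> \<phi> \<in> W}"
      using W triangle_fan[OF \<sigma>] by (simp add: openin_toric_topology)
    moreover have "continuous_on UNIV (toric_hom \<sigma>)"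
      by (rule continuous_on_coordinatewise_then_product) (rule continuous_on_toric_hom)
    ultimately have "openin (top_of_set UNIV) (UNIV \<inter> toric_hom \<sigma> -` {\<phi> \<in> affine_toric \<sigma>. chart \<sigma> \<phi> \<in> W})"
      using toric_hom_affine by (intro continuous_openin_preimage[of _ _ "affine_toric \<sigma>"]) auto
    moreover have "UNIV \<inter> toric_hom \<sigma> -` {\<phi> \<in> affine_toric \<sigma>. chart \<sigma> \<phi> \<in> W} = {x. tpoint \<sigma> x \<in> W}"
      using toric_hom_affine by (auto simp: tpoint_def)
    ultimately show ?thesis by simp
  qed
  then show "W \<subseteq> toric_points \<and> (\<forall>\<sigma>. triangle \<sigma> \<longrightarrow> open {x. tpoint \<sigma> x \<in> W})"
    using W by (simp add: openin_toric_topology)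
next
  assume W: "W \<subseteq> toric_points \<and> (\<forall>\<sigma>. triangle \<sigma> \<longrightarrow> open {x. tpoint \<sigma> x \<in> W})"
  have "openin (top_of_set (affine_toric \<rho>)) {\<phi> \<in> affine_toric \<rho>. chart \<rho> \<phi> \<in> W}" if \<rho>: "\<rho> \<in> fan" for \<rho>
  proof -
    obtain \<sigma> where \<sigma>: "triangle \<sigma>" "\<rho> \<subseteq> \<sigma>" using \<rho> by (auto simp: fan_iff)
    define f where "f = (\<lambda>\<phi> :: character \<Rightarrow> complex. \<lambda>u. \<phi> (dual_char \<sigma> u))"
    have "continuous_on (affine_toric \<rho>) f"
      unfolding f_def by (rule continuous_on_coordinatewise_then_product) (simp add: continuous_on_coordinate)
    then have "openin (top_of_set (affine_toric \<rho>)) (affine_toric \<rho> \<inter> f -` {x. tpoint \<sigma> x \<in> W})"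
      using W \<sigma> by (intro continuous_openin_preimage_gen) auto
    moreover have "affine_toric \<rho> \<inter> f -` {x. tpoint \<sigma> x \<in> W} = {\<phi> \<in> affine_toric \<rho>. chart \<rho> \<phi> \<in> W}"
      using chart_eq_tpoint[OF \<sigma>] by (auto simp: f_def)
    ultimately show ?thesis by simp
  qed
  then show "openin toric_topology W" using W by (simp add: openin_toric_topology)
qed

lemma topspace_toric_topology: "topspace toric_topology = toric_points"
proof
  show "topspace toric_topology \<subseteq> toric_points" using openin_toric_topology openin_topspace by blast
  have "openin toric_topology toric_points"
    unfolding openin_toric_topology_tpoint by (simp add: tpoint_in triangle_fan)
  then show "toric_points \<subseteq> topspace toric_topology" by (rule openin_subset)
qed

text \<open>For \<open>K\<close> in the fan this is the affine chart of \<open>K\<close>, the union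
  of the torus orbits of its faces.\<close>

lemma openin_min_cone: "openin toric_topology {y \<in> toric_points. min_cone y \<subseteq> K}"
  unfolding openin_toric_topology_tpoint
proof (intro conjI allI impI)
  fix \<sigma> assume \<sigma>: "triangle \<sigma>"
  have "{x. tpoint \<sigma> x \<in> {y \<in> toric_points. min_cone y \<subseteq> K}} = (\<Inter>u\<in>\<sigma> - K. {x. x u \<noteq> 0})"
    using triangle_fan[OF \<sigma>] by (auto simp: min_cone_tpoint tpoint_in)
  moreover have "open (\<Inter>u\<in>\<sigma> - K. {x :: int^2 \<Rightarrow> complex. x u \<noteq> 0})"
    using triangle_finite[OF \<sigma>]
    by (intro open_INT ballI open_Collect_neq continuous_on_coordinate continuous_on_const) auto
  ultimately show "open {x. tpoint \<sigma> x \<in> {y \<in> toric_points. min_cone y \<subseteq> K}}" by simp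
qed auto

lemma power_int_prod: "(\<Prod>i\<in>I. f i :: complex) powi k = (\<Prod>i\<in>I. f i powi k)"
  by (induction I rule: infinite_finite_induct) (auto simp: power_int_mult_distrib)

text \<open>The new coordinates are monomials in the old ones. A vanishing coordinate belongs to a
  common vertex, where duality gives it exponent 1 in its own new coordinate and 0 in the others, so
  no pole arises.\<close>

lemma tpoint_change:
  assumes \<sigma>: "triangle \<sigma>" and \<sigma>': "triangle \<sigma>'" and sub: "{u\<in>\<sigma>'. x u = 0} \<subseteq> \<sigma>"
    and z: "\<And>u. u \<in> \<sigma> \<Longrightarrow> z u = mon \<sigma>' x (dual_char \<sigma> u)"
  shows "tpoint \<sigma>' x = tpoint \<sigma> z"
proof -
  have fin: "finite \<sigma>'" using triangle_finite[OF \<sigma>'] .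
  have zero: "z w = 0 \<longleftrightarrow> w \<in> \<sigma>' \<and> x w = 0" if w: "w \<in> \<sigma>" for w
  proof -
    have "z w = 0 \<longleftrightarrow> (\<exists>u\<in>\<sigma>'. x u = 0 \<and> pr (dual_char \<sigma> w) u \<noteq> 0)"
      unfolding z[OF w] mon_def using fin by (auto simp: power_int_eq_0_iff)
    also have "\<dots> \<longleftrightarrow> (\<exists>u\<in>\<sigma>'. x u = 0 \<and> u = w)"
    proof (intro bex_cong refl conj_cong)
      fix u assume "u \<in> \<sigma>'" "x u = 0"
      then have "u \<in> \<sigma>" using sub by auto
      then show "pr (dual_char \<sigma> w) u \<noteq> 0 \<longleftrightarrow> u = w" using pr_dual_char[OF \<sigma>] by simp
    qed
    finally show ?thesis by auto
  qed
  have "mon \<sigma>' x m = mon \<sigma> z m" if m: "\<forall>u\<in>\<sigma>'. x u = 0 \<longrightarrow> pr m u = 0" for m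
  proof -
    have "mon \<sigma> z m = (\<Prod>w\<in>\<sigma>. \<Prod>u\<in>\<sigma>'. x u powi (pr (dual_char \<sigma> w) u * pr m w))"
      unfolding mon_def[of \<sigma> z] by (intro prod.cong refl) (simp add: z mon_def power_int_prod power_int_mult)
    also have "\<dots> = (\<Prod>u\<in>\<sigma>'. \<Prod>w\<in>\<sigma>. x u powi (pr (dual_char \<sigma> w) u * pr m w))"
      by (rule prod.swap)
    also have "\<dots> = mon \<sigma>' x m"
      unfolding mon_def
    proof (intro prod.cong refl)
      fix u assume u: "u \<in> \<sigma>'"
      show "(\<Prod>w\<in>\<sigma>. x u powi (pr (dual_char \<sigma> w) u * pr m w)) = x u powi pr m u"
      proof (cases "x u = 0")
        case True
        then have "u \<in> \<sigma>" "pr m u = 0" using u sub m by auto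
        then have "pr (dual_char \<sigma> w) u * pr m w = 0" for w using pr_dual_char[OF \<sigma>, of u w] by auto
        then have "(\<Prod>w\<in>\<sigma>. x u powi (pr (dual_char \<sigma> w) u * pr m w)) = 1"
          by (intro prod.neutral ballI) (simp only: power_int_0_right)
        then show ?thesis using \<open>pr m u = 0\<close> by simp
      next
        case False
        have "(\<Prod>w\<in>I. x u powi g w) = x u powi (\<Sum>w\<in>I. g w)" for I and g :: "int^2 \<Rightarrow> int"
          by (induction I rule: infinite_finite_induct) (auto simp: power_int_add False)
        then show ?thesis by (simp add: sum_dual_char[OF \<sigma>])
      qed
    qed
    finally show ?thesis by simp
  qed
  moreover have "{u\<in>\<sigma>'. x u = 0} = {u\<in>\<sigma>. z u = 0}" using zero sub by auto
  ultimately show ?thesis unfolding tpoint_eq_iff[OF triangle_fan[OF \<sigma>'] triangle_fan[OF \<sigma>]] by blast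
qed

text \<open>Seen from a second chart, a point near the image has coordinates in the first one given
  by \<open>tpoint_change\<close>, and these vary continuously as long as the coordinates that are
  nonzero at the base point stay nonzero.\<close>

lemma openin_tpoint_image:
  assumes \<sigma>: "triangle \<sigma>" and N: "open N" shows "openin toric_topology (tpoint \<sigma> ` N)"
  unfolding openin_toric_topology_tpoint
proof (intro conjI allI impI)
  show "tpoint \<sigma> ` N \<subseteq> toric_points" using tpoint_in triangle_fan[OF \<sigma>] by auto
next
  fix \<sigma>' assume \<sigma>': "triangle \<sigma>'"
  have fin: "finite \<sigma>'" using triangle_finite[OF \<sigma>'] .
  have "\<exists>T. open T \<and> x' \<in> T \<and> T \<subseteq> {x. tpoint \<sigma>' x \<in> tpoint \<sigma> ` N}" if x': "tpoint \<sigma>' x' \<in> tpoint \<sigma> ` N" for x'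
  proof -
    obtain x where x: "x \<in> N" "tpoint \<sigma>' x' = tpoint \<sigma> x" using x' unfolding image_iff by blast
    have zs: "{u\<in>\<sigma>'. x' u = 0} = {u\<in>\<sigma>. x u = 0}" and
      ms: "\<And>m. (\<forall>u\<in>\<sigma>'. x' u = 0 \<longrightarrow> pr m u = 0) \<Longrightarrow> mon \<sigma>' x' m = mon \<sigma> x m"
      using x(2) unfolding tpoint_eq_iff[OF triangle_fan[OF \<sigma>'] triangle_fan[OF \<sigma>]] by auto
    define V :: "(int^2 \<Rightarrow> complex) set" where "V = (\<Inter>u\<in>{u\<in>\<sigma>'. x' u \<noteq> 0}. {x. x u \<noteq> 0})"
    have V: "open V" unfolding V_def using fin
      by (intro open_INT ballI open_Collect_neq continuous_on_coordinate continuous_on_const) auto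
    \<comment> \<open>Off \<open>\<sigma>\<close> the values of \<open>x\<close> are kept, so that
      \<open>z x' = x\<close> holds as functions on \<open>int^2\<close> and the open set
      \<open>N\<close> really contains it.\<close>
    define z where "z = (\<lambda>x'' u. if u \<in> \<sigma> then mon \<sigma>' x'' (dual_char \<sigma> u) else x u)"
    have "continuous_on V z"
    proof (rule continuous_on_coordinatewise_then_product)
      fix w
      have "continuous_on V (\<lambda>x''. x'' u powi pr (dual_char \<sigma> w) u)" if u: "u \<in> \<sigma>'" for u
      proof (cases "x' u = 0")
        case True
        then have "u \<in> \<sigma>" using u zs by auto
        then have "pr (dual_char \<sigma> w) u = (if u = w then 1 else 0)" using pr_dual_char[OF \<sigma>] by simp
        then show ?thesis by (simp add: continuous_on_coordinate)
      next
        case False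
        then show ?thesis using u
          by (intro continuous_on_power_int continuous_on_coordinate) (auto simp: V_def)
      qed
      then show "continuous_on V (\<lambda>x''. z x'' w)"
        by (cases "w \<in> \<sigma>") (auto simp: z_def mon_def intro!: continuous_on_prod)
    qed
    then have "open (V \<inter> z -` N)" using V N by (rule continuous_open_preimage)
    moreover have "z x' = x"
    proof
      fix w show "z x' w = x w"
      proof (cases "w \<in> \<sigma>")
        case True
        show ?thesis
        proof (cases "x w = 0")
          case False
          have "\<forall>u\<in>\<sigma>'. x' u = 0 \<longrightarrow> pr (dual_char \<sigma> w) u = 0"
          proof (intro ballI impI)
            fix u assume "u \<in> \<sigma>'" "x' u = 0"
            then have "u \<in> \<sigma>" "x u = 0" using zs by auto
            then show "pr (dual_char \<sigma> w) u = 0" using pr_dual_char[OF \<sigma>] False by auto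
          qed
          then show ?thesis using True ms mon_dual_char[OF \<sigma> True] by (simp add: z_def)
        next
          case w0: True
          then have "w \<in> \<sigma>'" "x' w = 0" using zs True by auto
          then have "mon \<sigma>' x' (dual_char \<sigma> w) = 0"
            unfolding mon_def using fin pr_dual_char[OF \<sigma> True, of w] by (intro prod_zero bexI[of _ w]) auto
          then show ?thesis using w0 True by (simp add: z_def)
        qed
      qed (simp add: z_def)
    qed
    moreover have "x' \<in> V" by (simp add: V_def)
    moreover have "tpoint \<sigma>' x'' = tpoint \<sigma> (z x'')" if "x'' \<in> V" for x''
      by (rule tpoint_change[OF \<sigma> \<sigma>']) (use that zs in \<open>auto simp: V_def z_def\<close>)
    ultimately show ?thesis using x(1) by (intro exI[of _ "V \<inter> z -` N"]) auto
  qed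
  then show "open {x. tpoint \<sigma>' x \<in> tpoint \<sigma> ` N}" by (subst open_subopen) blast
qed

section \<open>The quotient by the action\<close>

definition twist :: "(complex \<Rightarrow> complex^2^2) \<Rightarrow> int^2 \<Rightarrow> complex \<Rightarrow> int^2 \<Rightarrow> complex" where
  "twist D \<nu> t a = exp (2 * of_real pi * \<i> * scalar_product (\<chi> i. of_int (a $ i)) (D t *v (\<chi> i. of_int (\<nu> $ i))))"

definition act_hom :: "(complex \<Rightarrow> complex^2^2) \<Rightarrow> int^2 \<Rightarrow> (character \<Rightarrow> complex) \<Rightarrow> character \<Rightarrow> complex" where
  "act_hom D \<nu> \<phi> m = twist D \<nu> (\<phi> (0, 1)) (fst m) * \<phi> (fst m, snd m + scalar_product (fst m) \<nu>)"

lemma act_affine_eq: "act_affine D \<nu> (\<sigma>, \<phi>) = ((+) \<nu> ` \<sigma>, act_hom D \<nu> \<phi>)"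
  by (auto simp: act_affine_def act_hom_def twist_def fun_eq_iff)

lemma matrix_vector_mult_2: "((A :: 'a::semiring_1^2^2) *v w) $ i = A $ i $ 1 * w $ 1 + A $ i $ 2 * w $ 2"
  by (simp add: matrix_vector_mult_def sum_2)

lemma twist_expand:
  "twist D \<nu> t a = exp (2 * of_real pi * \<i> * (of_int (a $ 1) * (D t $ 1 $ 1 * of_int (\<nu> $ 1) + D t $ 1 $ 2 * of_int (\<nu> $ 2)) +
     of_int (a $ 2) * (D t $ 2 $ 1 * of_int (\<nu> $ 1) + D t $ 2 $ 2 * of_int (\<nu> $ 2))))"
  by (simp add: twist_def scalar_product_2 matrix_vector_mult_2)

lemma twist_add_right: "twist D \<nu> t (a + b) = twist D \<nu> t a * twist D \<nu> t b"
  unfolding twist_expand exp_add[symmetric] by (simp add: algebra_simps)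

lemma twist_add_left: "twist D (\<nu> + \<mu>) t a = twist D \<nu> t a * twist D \<mu> t a"
  unfolding twist_expand exp_add[symmetric] by (simp add: algebra_simps)

lemma twist_0 [simp]: "twist D \<nu> t 0 = 1" "twist D 0 t a = 1"
  by (simp_all add: twist_expand)

lemma pr_translate: "pr (a, c + scalar_product a \<nu>) u = pr (a, c) (\<nu> + u)"
  by (simp add: pr_def scalar_product_2 algebra_simps)

lemma dual_monoid_translate:
  "m \<in> dual_monoid ((+) \<nu> ` \<sigma>) \<longleftrightarrow> (fst m, snd m + scalar_product (fst m) \<nu>) \<in> dual_monoid \<sigma>"
  by (cases m) (simp add: dual_monoid_iff pr_translate)

lemma act_hom_height [simp]: "act_hom D \<nu> \<phi> (0, 1) = \<phi> (0, 1)"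
  by (simp add: act_hom_def scalar_product_2)

lemma act_hom_add: "act_hom D \<nu> (act_hom D \<mu> \<phi>) = act_hom D (\<nu> + \<mu>) \<phi>"
proof
  fix m :: character
  have "scalar_product (fst m) (\<nu> + \<mu>) = scalar_product (fst m) \<nu> + scalar_product (fst m) \<mu>"
    by (simp add: scalar_product_2 algebra_simps)
  then show "act_hom D \<nu> (act_hom D \<mu> \<phi>) m = act_hom D (\<nu> + \<mu>) \<phi> m"
    unfolding act_hom_def[of D \<nu>] act_hom_height by (simp add: act_hom_def twist_add_left add.assoc)
qed

lemma act_hom_zero: "act_hom D 0 \<phi> = \<phi>"
  by (simp add: fun_eq_iff act_hom_def scalar_product_2)

lemma act_hom_affine:
  assumes \<phi>: "\<phi> \<in> affine_toric \<sigma>" shows "act_hom D \<nu> \<phi> \<in> affine_toric ((+) \<nu> ` \<sigma>)"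
proof -
  have sp: "scalar_product (a + b) \<nu> = scalar_product a \<nu> + scalar_product b \<nu>" for a b :: "int^2"
    by (simp add: scalar_product_2 algebra_simps)
  have "act_hom D \<nu> \<phi> (m + n) = act_hom D \<nu> \<phi> m * act_hom D \<nu> \<phi> n"
    if "m \<in> dual_monoid ((+) \<nu> ` \<sigma>)" "n \<in> dual_monoid ((+) \<nu> ` \<sigma>)" for m n
  proof -
    have "\<phi> ((fst m, snd m + scalar_product (fst m) \<nu>) + (fst n, snd n + scalar_product (fst n) \<nu>)) =
      \<phi> (fst m, snd m + scalar_product (fst m) \<nu>) * \<phi> (fst n, snd n + scalar_product (fst n) \<nu>)"
      using that by (intro affine_toricD(2)[OF \<phi>]) (simp_all add: dual_monoid_translate)
    then show ?thesis by (simp add: act_hom_def twist_add_right sp algebra_simps)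
  qed
  moreover have "act_hom D \<nu> \<phi> 0 = 1"
    using affine_toricD(1)[OF \<phi>] by (simp add: act_hom_def scalar_product_2 zero_prod_def)
  moreover have "act_hom D \<nu> \<phi> m = 0" if "m \<notin> dual_monoid ((+) \<nu> ` \<sigma>)" for m
    using affine_toricD(3)[OF \<phi>] that by (simp add: act_hom_def dual_monoid_translate)
  ultimately show ?thesis unfolding affine_toric_def by blast
qed

lemma triangle_translate: assumes "triangle \<sigma>" shows "triangle ((+) \<nu> ` \<sigma>)"
proof -
  have "(+) \<nu> ` upper_triangle v = upper_triangle (\<nu> + v)" "(+) \<nu> ` lower_triangle v = lower_triangle (\<nu> + v)" for v
    by (auto simp: upper_triangle_def lower_triangle_def algebra_simps)
  then show ?thesis using assms unfolding triangle_def by metis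
qed

lemma fan_translate: "\<sigma> \<in> fan \<Longrightarrow> (+) \<nu> ` \<sigma> \<in> fan"
  unfolding fan_iff using triangle_translate by (meson image_mono)

lemma act_hom_glue:
  assumes "((\<sigma>, \<phi>), (\<sigma>', \<phi>')) \<in> glue"
  shows "(((+) \<nu> ` \<sigma>, act_hom D \<nu> \<phi>), ((+) \<nu> ` \<sigma>', act_hom D \<nu> \<phi>')) \<in> glue"
proof -
  obtain \<psi> where s: "\<sigma> \<in> fan" "\<phi> \<in> affine_toric \<sigma>" "\<sigma>' \<in> fan" "\<phi>' \<in> affine_toric \<sigma>'"
    and \<psi>: "\<psi> \<in> affine_toric (\<sigma> \<inter> \<sigma>')" "\<And>m. m \<in> dual_monoid \<sigma> \<Longrightarrow> \<psi> m = \<phi> m" "\<And>m. m \<in> dual_monoid \<sigma>' \<Longrightarrow> \<psi> m = \<phi>' m"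
    using assms unfolding glue_def by blast
  have "(0, 1) \<in> dual_monoid \<rho>" for \<rho> by (simp add: dual_monoid_iff)
  then have t: "\<psi> (0, 1) = \<phi> (0, 1)" "\<psi> (0, 1) = \<phi>' (0, 1)" using \<psi>(2,3) by blast+
  have "act_hom D \<nu> \<psi> \<in> affine_toric ((+) \<nu> ` \<sigma> \<inter> (+) \<nu> ` \<sigma>')"
    using act_hom_affine[OF \<psi>(1), of D \<nu>] by (simp add: image_Int)
  moreover have "act_hom D \<nu> \<psi> m = act_hom D \<nu> \<phi> m" if "m \<in> dual_monoid ((+) \<nu> ` \<sigma>)" for m
    using that \<psi>(2) t by (simp add: dual_monoid_translate act_hom_def)
  moreover have "act_hom D \<nu> \<psi> m = act_hom D \<nu> \<phi>' m" if "m \<in> dual_monoid ((+) \<nu> ` \<sigma>')" for m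
    using that \<psi>(3) t by (simp add: dual_monoid_translate act_hom_def)
  ultimately show ?thesis
    unfolding glue_def mem_Collect_eq case_prod_conv using s fan_translate act_hom_affine by blast
qed

lemma act_chart:
  assumes "\<sigma> \<in> fan" "\<phi> \<in> affine_toric \<sigma>"
  shows "act D \<nu> (chart \<sigma> \<phi>) = chart ((+) \<nu> ` \<sigma>) (act_hom D \<nu> \<phi>)"
proof (intro set_eqI iffI)
  fix q assume "q \<in> act D \<nu> (chart \<sigma> \<phi>)"
  then show "q \<in> chart ((+) \<nu> ` \<sigma>) (act_hom D \<nu> \<phi>)"
    using act_hom_glue by (auto simp: act_def chart_def act_affine_eq)
next
  fix q assume "q \<in> chart ((+) \<nu> ` \<sigma>) (act_hom D \<nu> \<phi>)"
  then obtain \<rho> \<psi> where q: "q = (\<rho>, \<psi>)" and g: "(((+) \<nu> ` \<sigma>, act_hom D \<nu> \<phi>), (\<rho>, \<psi>)) \<in> glue"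
    by (cases q) (auto simp: chart_def)
  have "((\<sigma>, \<phi>), ((+) (- \<nu>) ` \<rho>, act_hom D (- \<nu>) \<psi>)) \<in> glue"
    using act_hom_glue[OF g, of "- \<nu>" D] by (simp add: act_hom_add act_hom_zero image_image)
  then have "act_affine D \<nu> ((+) (- \<nu>) ` \<rho>, act_hom D (- \<nu>) \<psi>) \<in> act D \<nu> (chart \<sigma> \<phi>)"
    unfolding act_def chart_def by blast
  then show "q \<in> act D \<nu> (chart \<sigma> \<phi>)"
    by (simp add: q act_affine_eq act_hom_add act_hom_zero image_image)
qed

lemma act_tpoint:
  assumes \<sigma>: "triangle \<sigma>"
  shows "act D \<nu> (tpoint \<sigma> x) =
    tpoint ((+) \<nu> ` \<sigma>) (\<lambda>u. act_hom D \<nu> (toric_hom \<sigma> x) (dual_char ((+) \<nu> ` \<sigma>) u))"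
  unfolding tpoint_def[of \<sigma>] act_chart[OF triangle_fan[OF \<sigma>] toric_hom_affine]
  by (rule chart_eq_tpoint[OF triangle_translate[OF \<sigma>] order_refl act_hom_affine[OF toric_hom_affine]])

lemma toric_points_chartE:
  assumes "y \<in> toric_points" obtains \<sigma> \<phi> where "\<sigma> \<in> fan" "\<phi> \<in> affine_toric \<sigma>" "y = chart \<sigma> \<phi>"
  using assms by (auto simp: toric_points_def quotient_def chart_def)

lemma act_in: "y \<in> toric_points \<Longrightarrow> act D \<nu> y \<in> toric_points"
  by (erule toric_points_chartE) (simp add: act_chart chart_in_toric_points fan_translate act_hom_affine)

lemma act_add: "y \<in> toric_points \<Longrightarrow> act D \<nu> (act D \<mu> y) = act D (\<nu> + \<mu>) y"
  by (erule toric_points_chartE) (simp add: act_chart fan_translate act_hom_affine act_hom_add image_image add.assoc)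

lemma act_zero: "y \<in> toric_points \<Longrightarrow> act D 0 y = y"
  by (erule toric_points_chartE) (simp add: act_chart act_hom_zero)

lemma t_coord_act: "y \<in> toric_points \<Longrightarrow> t_coord (act D \<nu> y) = t_coord y"
  by (erule toric_points_chartE) (simp add: act_chart t_coord_chart fan_translate act_hom_affine)

lemma min_cone_act:
  assumes "y \<in> toric_points" shows "min_cone (act D \<nu> y) = (+) \<nu> ` min_cone y"
proof -
  obtain \<sigma> \<phi> where s: "\<sigma> \<in> fan" "\<phi> \<in> affine_toric \<sigma>" "y = chart \<sigma> \<phi>" using assms by (rule toric_points_chartE)
  have sub: "(+) \<nu> ` vanishing_rays \<sigma> \<phi> \<subseteq> vanishing_rays ((+) \<nu> ` \<sigma>) (act_hom D \<nu> \<phi>)" for \<sigma> \<nu> \<phi>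
    by (auto simp: vanishing_rays_def act_hom_def dual_monoid_translate pr_translate)
  have "vanishing_rays ((+) \<nu> ` \<sigma>) (act_hom D \<nu> \<phi>) \<subseteq> (+) \<nu> ` vanishing_rays \<sigma> \<phi>"
  proof
    fix w assume "w \<in> vanishing_rays ((+) \<nu> ` \<sigma>) (act_hom D \<nu> \<phi>)"
    then have "- \<nu> + w \<in> vanishing_rays \<sigma> \<phi>"
      using sub[of "- \<nu>" "(+) \<nu> ` \<sigma>" "act_hom D \<nu> \<phi>"] by (auto simp: act_hom_add act_hom_zero image_image)
    then show "w \<in> (+) \<nu> ` vanishing_rays \<sigma> \<phi>" by (intro image_eqI[of _ _ "- \<nu> + w"]) auto
  qed
  then show ?thesis using s sub[of \<nu> \<sigma> \<phi>] by (simp add: act_chart min_cone_chart fan_translate act_hom_affine)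
qed

lemma openin_tube: "openin toric_topology (tube \<epsilon>)"
  unfolding openin_toric_topology_tpoint
proof (intro conjI allI impI)
  fix \<sigma> assume \<sigma>: "triangle \<sigma>"
  have "{x. tpoint \<sigma> x \<in> tube \<epsilon>} = {x. norm (\<Prod>u\<in>\<sigma>. x u) < \<epsilon>}"
    using triangle_fan[OF \<sigma>] by (auto simp: tube_def tpoint_in t_coord_tpoint)
  moreover have "open {x :: int^2 \<Rightarrow> complex. norm (\<Prod>u\<in>\<sigma>. x u) < \<epsilon>}"
    by (intro open_Collect_less continuous_on_norm continuous_on_prod continuous_on_coordinate continuous_on_const)
  ultimately show "open {x. tpoint \<sigma> x \<in> tube \<epsilon>}" by simp
qed (auto simp: tube_def)

text \<open>The image under \<open>\<nu>\<close> is the preimage under \<open>- \<nu>\<close>.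
  Continuity of \<open>D\<close> is known only on the disc, so the preimage is formed inside the
  tube, where the norm of \<open>t\<close> is below \<open>\<epsilon> \<le> r\<close>.\<close>

lemma openin_act_image:
  assumes D: "\<And>i j. continuous_on (ball 0 r) (\<lambda>t. D t $ i $ j)" and \<epsilon>: "\<epsilon> \<le> r"
    and W: "openin toric_topology W" "W \<subseteq> tube \<epsilon>"
  shows "openin toric_topology (act D \<nu> ` W)"
  unfolding openin_toric_topology_tpoint
proof (intro conjI allI impI)
  have Wt: "W \<subseteq> toric_points" using W by (auto simp: tube_def)
  then show "act D \<nu> ` W \<subseteq> toric_points" using act_in by blast
  fix \<sigma> assume \<sigma>: "triangle \<sigma>"
  define g where "g = (\<lambda>x u. act_hom D (- \<nu>) (toric_hom \<sigma> x) (dual_char ((+) (- \<nu>) ` \<sigma>) u))"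
  define T where "T = {x. tpoint \<sigma> x \<in> tube \<epsilon>}"
  have T: "open T" using openin_tube \<sigma> unfolding openin_toric_topology_tpoint T_def by blast
  have hD: "continuous_on T (\<lambda>x. D (toric_hom \<sigma> x (0, 1)) $ i $ j)" for i j
  proof (rule continuous_on_compose2[OF D continuous_on_toric_hom])
    show "(\<lambda>x. toric_hom \<sigma> x (0, 1)) ` T \<subseteq> ball 0 r"
    proof clarify
      fix x assume "x \<in> T"
      then have "norm (t_coord (tpoint \<sigma> x)) < \<epsilon>" by (simp add: T_def tube_def)
      then show "toric_hom \<sigma> x (0, 1) \<in> ball 0 r"
        using \<epsilon> t_coord_chart[OF triangle_fan[OF \<sigma>] toric_hom_affine[of \<sigma> x]] by (simp add: tpoint_def)
    qed
  qed
  have "continuous_on T g"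
    unfolding g_def act_hom_def twist_expand
    by (intro continuous_on_coordinatewise_then_product continuous_on_mult continuous_on_exp continuous_on_add
        continuous_on_const continuous_on_toric_hom hD)
  moreover have "open {x. tpoint ((+) (- \<nu>) ` \<sigma>) x \<in> W}"
    using W triangle_translate[OF \<sigma>] unfolding openin_toric_topology_tpoint by blast
  ultimately have "open (T \<inter> g -` {x. tpoint ((+) (- \<nu>) ` \<sigma>) x \<in> W})" using T by (intro continuous_open_preimage)
  moreover have "tpoint \<sigma> x \<in> act D \<nu> ` W \<longleftrightarrow> x \<in> T \<inter> g -` {x. tpoint ((+) (- \<nu>) ` \<sigma>) x \<in> W}" for x
  proof -
    have gx: "tpoint ((+) (- \<nu>) ` \<sigma>) (g x) = act D (- \<nu>) (tpoint \<sigma> x)" by (simp add: g_def act_tpoint[OF \<sigma>])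
    have tx: "tpoint \<sigma> x \<in> toric_points" using tpoint_in triangle_fan[OF \<sigma>] .
    show ?thesis
    proof
      assume "tpoint \<sigma> x \<in> act D \<nu> ` W"
      then obtain y where y: "y \<in> W" "tpoint \<sigma> x = act D \<nu> y" by auto
      then have "act D (- \<nu>) (tpoint \<sigma> x) = y" using Wt act_add act_zero by (simp add: subset_eq)
      moreover have "tpoint \<sigma> x \<in> tube \<epsilon>" using y W(2) Wt tx by (auto simp: tube_def t_coord_act)
      ultimately show "x \<in> T \<inter> g -` {x. tpoint ((+) (- \<nu>) ` \<sigma>) x \<in> W}" using gx y by (simp add: T_def)
    next
      assume "x \<in> T \<inter> g -` {x. tpoint ((+) (- \<nu>) ` \<sigma>) x \<in> W}"
      then have "act D (- \<nu>) (tpoint \<sigma> x) \<in> W" using gx by simp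
      moreover have "tpoint \<sigma> x = act D \<nu> (act D (- \<nu>) (tpoint \<sigma> x))" using tx by (simp add: act_add act_zero)
      ultimately show "tpoint \<sigma> x \<in> act D \<nu> ` W" by blast
    qed
  qed
  then have "{x. tpoint \<sigma> x \<in> act D \<nu> ` W} = T \<inter> g -` {x. tpoint ((+) (- \<nu>) ` \<sigma>) x \<in> W}" by blast
  ultimately show "open {x. tpoint \<sigma> x \<in> act D \<nu> ` W}" by simp
qed

lemma orbit_self: "y \<in> toric_points \<Longrightarrow> y \<in> orbit M D y"
  unfolding orbit_def using act_zero[of y D] by (intro image_eqI[of _ _ 0]) auto

lemma orbit_eq:
  assumes "y \<in> toric_points" "y' \<in> orbit M D y" shows "orbit M D y' = orbit M D y"
proof -
  obtain v where y': "y' = act D (M *v v) y" using assms by (auto simp: orbit_def)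
  have shift: "act D (M *v w) y' = act D (M *v (w + v)) y" for w
    using assms by (simp add: y' act_add matrix_vector_right_distrib)
  show ?thesis
  proof (intro set_eqI iffI)
    fix z assume "z \<in> orbit M D y'"
    then show "z \<in> orbit M D y" using shift by (auto simp: orbit_def)
  next
    fix z assume "z \<in> orbit M D y"
    then obtain w where "z = act D (M *v w) y" by (auto simp: orbit_def)
    then have "z = act D (M *v (w - v)) y'" using shift[of "w - v"] by simp
    then show "z \<in> orbit M D y'" by (auto simp: orbit_def)
  qed
qed

lemma orbit_tube: "y \<in> tube \<epsilon> \<Longrightarrow> orbit M D y \<subseteq> tube \<epsilon>"
  using act_in t_coord_act by (auto simp: orbit_def tube_def)

lemma tube_toric: "y \<in> tube \<epsilon> \<Longrightarrow> y \<in> toric_points"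
  by (simp add: tube_def)

lemma mem_Union_orbits:
  assumes "W \<subseteq> orbit M D ` tube \<epsilon>" "y \<in> toric_points"
  shows "y \<in> \<Union>W \<longleftrightarrow> orbit M D y \<in> W"
proof
  assume "y \<in> \<Union>W"
  then obtain y' where "y' \<in> tube \<epsilon>" "orbit M D y' \<in> W" "y \<in> orbit M D y'" using assms by auto
  then show "orbit M D y \<in> W" using orbit_eq tube_toric by metis
qed (use orbit_self assms in blast)

text \<open>Among the axioms of a topology only intersection takes work: taking the union of the
  orbits commutes with it because two orbits are equal or disjoint.\<close>

lemma openin_compactification:
  "openin (ctop (compactification M D \<epsilon>)) W \<longleftrightarrow> W \<subseteq> orbit M D ` tube \<epsilon> \<and> openin toric_topology (\<Union>W)"
proof -
  have "istopology (\<lambda>W. W \<subseteq> orbit M D ` tube \<epsilon> \<and> openin toric_topology (\<Union>W))"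
    unfolding istopology_def
  proof (intro conjI allI impI)
    fix S T assume ST: "S \<subseteq> orbit M D ` tube \<epsilon> \<and> openin toric_topology (\<Union>S)" "T \<subseteq> orbit M D ` tube \<epsilon> \<and> openin toric_topology (\<Union>T)"
    then show "S \<inter> T \<subseteq> orbit M D ` tube \<epsilon>" by auto
    have tor: "\<Union>S \<subseteq> toric_points"
      using ST openin_subset[of toric_topology "\<Union>S"] by (simp only: topspace_toric_topology)
    have "\<Union>(S \<inter> T) = \<Union>S \<inter> \<Union>T"
    proof (intro set_eqI iffI)
      fix y assume y: "y \<in> \<Union>S \<inter> \<Union>T"
      then have yt: "y \<in> toric_points" using tor by blast
      then have "orbit M D y \<in> S \<inter> T" using mem_Union_orbits[of S M D \<epsilon> y] mem_Union_orbits[of T M D \<epsilon> y] ST y by simp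
      then show "y \<in> \<Union>(S \<inter> T)" using orbit_self[OF yt] by blast
    qed auto
    then show "openin toric_topology (\<Union>(S \<inter> T))" using ST by (auto intro: openin_Int)
  next
    fix K assume K: "\<forall>k\<in>K. k \<subseteq> orbit M D ` tube \<epsilon> \<and> openin toric_topology (\<Union>k)"
    then show "\<Union>K \<subseteq> orbit M D ` tube \<epsilon>" by auto
    have "\<Union>(\<Union>K) = \<Union>((\<lambda>k. \<Union>k) ` K)" by auto
    moreover have "openin toric_topology (\<Union>((\<lambda>k. \<Union>k) ` K))" by (rule openin_Union) (use K in auto)
    ultimately show "openin toric_topology (\<Union>(\<Union>K))" by simp
  qed
  then show ?thesis by (simp add: compactification_def topology_inverse')
qed

text \<open>Quotients by group actions are open: the saturation of an open set is the union of its
  translates.\<close>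

lemma openin_orbit_image:
  assumes D: "\<And>i j. continuous_on (ball 0 r) (\<lambda>t. D t $ i $ j)" and \<epsilon>: "\<epsilon> \<le> r"
    and W: "openin toric_topology W"
  shows "openin (ctop (compactification M D \<epsilon>)) (orbit M D ` (W \<inter> tube \<epsilon>))"
  unfolding openin_compactification
proof
  have "\<Union>(orbit M D ` (W \<inter> tube \<epsilon>)) = \<Union>(range (\<lambda>v. act D (M *v v) ` (W \<inter> tube \<epsilon>)))"
    by (auto simp: orbit_def)
  moreover have "openin toric_topology (act D (M *v v) ` (W \<inter> tube \<epsilon>))" for v
    by (rule openin_act_image[OF D \<epsilon>]) (auto intro: openin_Int W openin_tube)
  ultimately show "openin toric_topology (\<Union>(orbit M D ` (W \<inter> tube \<epsilon>)))" by (auto intro!: openin_Union)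
qed auto

lemma topspace_compactification: "topspace (ctop (compactification M D \<epsilon>)) = orbit M D ` tube \<epsilon>"
proof -
  have "\<Union>(orbit M D ` tube \<epsilon>) = tube \<epsilon>"
  proof
    show "\<Union>(orbit M D ` tube \<epsilon>) \<subseteq> tube \<epsilon>" using orbit_tube by (simp add: UN_subset_iff)
    show "tube \<epsilon> \<subseteq> \<Union>(orbit M D ` tube \<epsilon>)" using orbit_self[OF tube_toric] by auto
  qed
  then have "openin (ctop (compactification M D \<epsilon>)) (orbit M D ` tube \<epsilon>)"
    by (simp add: openin_compactification openin_tube)
  moreover have "topspace (ctop (compactification M D \<epsilon>)) \<subseteq> orbit M D ` tube \<epsilon>"
    using openin_compactification openin_topspace by blast
  ultimately show ?thesis by (meson openin_subset subset_antisym)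
qed

lemma continuous_tpoint_orbit:
  fixes \<gamma> :: "'a::topological_space \<Rightarrow> int^2 \<Rightarrow> complex"
  assumes \<sigma>: "triangle \<sigma>" and S: "open S" "continuous_on S \<gamma>" and tu: "\<And>z. z \<in> S \<Longrightarrow> tpoint \<sigma> (\<gamma> z) \<in> tube \<epsilon>"
    and W: "openin (ctop (compactification M D \<epsilon>)) W"
  shows "open {z\<in>S. orbit M D (tpoint \<sigma> (\<gamma> z)) \<in> W}"
proof -
  have W': "W \<subseteq> orbit M D ` tube \<epsilon>" "openin toric_topology (\<Union>W)" using W by (auto simp: openin_compactification)
  have "open {x. tpoint \<sigma> x \<in> \<Union>W}"
    using W'(2) \<sigma> unfolding openin_toric_topology_tpoint by (elim conjE allE impE)
  then have "open (S \<inter> \<gamma> -` {x. tpoint \<sigma> x \<in> \<Union>W})" using S by (intro continuous_open_preimage)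
  moreover have "S \<inter> \<gamma> -` {x. tpoint \<sigma> x \<in> \<Union>W} = {z\<in>S. orbit M D (tpoint \<sigma> (\<gamma> z)) \<in> W}"
  proof (intro set_eqI iffI)
    fix z assume z: "z \<in> S \<inter> \<gamma> -` {x. tpoint \<sigma> x \<in> \<Union>W}"
    then show "z \<in> {z\<in>S. orbit M D (tpoint \<sigma> (\<gamma> z)) \<in> W}"
      using mem_Union_orbits[OF W'(1) tube_toric[OF tu[of z]]] by simp
  next
    fix z assume z: "z \<in> {z\<in>S. orbit M D (tpoint \<sigma> (\<gamma> z)) \<in> W}"
    then show "z \<in> S \<inter> \<gamma> -` {x. tpoint \<sigma> x \<in> \<Union>W}"
      using mem_Union_orbits[OF W'(1) tube_toric[OF tu[of z]]] by simp
  qed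
  ultimately show ?thesis by simp
qed

text \<open>The passage from sections to one-variable functions. Near a point of the curve the
  section extends to the compactification, lifts to the toric threefold, and is holomorphic in
  finitely many regular characters; these are polynomials in the coordinates of the curve.\<close>

lemma section_along_curve:
  assumes F: "F \<in> sections (central_fibre M D \<epsilon>) W" and \<sigma>: "triangle \<sigma>" and S: "open S"
    and \<gamma>: "\<And>u. (\<lambda>z. \<gamma> z u) holomorphic_on S"
    and tu: "\<And>z. z \<in> S \<Longrightarrow> tpoint \<sigma> (\<gamma> z) \<in> tube \<epsilon>" and W: "\<And>z. z \<in> S \<Longrightarrow> orbit M D (tpoint \<sigma> (\<gamma> z)) \<in> W"
  shows "(\<lambda>z. F (orbit M D (tpoint \<sigma> (\<gamma> z)))) holomorphic_on S"
proof -
  have cont: "continuous_on S \<gamma>"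
    by (intro continuous_on_coordinatewise_then_product holomorphic_on_imp_continuous_on \<gamma>)
  have "(\<lambda>z. F (orbit M D (tpoint \<sigma> (\<gamma> z)))) field_differentiable at z0" if z0: "z0 \<in> S" for z0
  proof -
    obtain W' F' where W': "openin (ctop (compactification M D \<epsilon>)) W'" "orbit M D (tpoint \<sigma> (\<gamma> z0)) \<in> W'"
      "F' \<in> sections (compactification M D \<epsilon>) W'" "\<forall>q\<in>W' \<inter> W. F q = F' q"
      using F W[OF z0] unfolding central_fibre_def closed_subspace_def by auto
    have sub: "W' \<subseteq> orbit M D ` tube \<epsilon>" using W'(1) by (simp add: openin_compactification)
    have mem: "tpoint \<sigma> (\<gamma> z) \<in> \<Union>W' \<longleftrightarrow> orbit M D (tpoint \<sigma> (\<gamma> z)) \<in> W'" if "z \<in> S" for z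
      using mem_Union_orbits[OF sub tube_toric[OF tu[OF that]]] .
    have "(\<lambda>y. F' (orbit M D y)) \<in> sections toric_threefold (\<Union>W')"
      using W'(3) by (simp add: compactification_def)
    then have "\<exists>n \<mu> G g. (\<forall>i<n. \<mu> i \<in> dual_monoid \<sigma>) \<and> holomorphic_Cn n G g \<and>
           eval_characters n \<mu> (toric_hom \<sigma> (\<gamma> z0)) \<in> G \<and>
           (\<forall>\<psi>\<in>affine_toric \<sigma>. chart \<sigma> \<psi> \<in> \<Union>W' \<longrightarrow> eval_characters n \<mu> \<psi> \<in> G \<longrightarrow>
              F' (orbit M D (chart \<sigma> \<psi>)) = g (eval_characters n \<mu> \<psi>))"
      using triangle_fan[OF \<sigma>] toric_hom_affine mem[OF z0] W'(2) unfolding tpoint_def toric_threefold_def by auto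
    then obtain n \<mu> G g where \<mu>: "\<And>i. i < n \<Longrightarrow> \<mu> i \<in> dual_monoid \<sigma>" and g: "holomorphic_Cn n G g"
      and z0G: "eval_characters n \<mu> (toric_hom \<sigma> (\<gamma> z0)) \<in> G"
      and Fg: "\<And>\<psi>. \<psi> \<in> affine_toric \<sigma> \<Longrightarrow> chart \<sigma> \<psi> \<in> \<Union>W' \<Longrightarrow> eval_characters n \<mu> \<psi> \<in> G \<Longrightarrow>
              F' (orbit M D (chart \<sigma> \<psi>)) = g (eval_characters n \<mu> \<psi>)"
      by (elim exE conjE) blast
    define h where "h = (\<lambda>z. eval_characters n \<mu> (toric_hom \<sigma> (\<gamma> z)))"
    have holh: "(\<lambda>z. h z i) holomorphic_on S" for i
    proof (cases "i < n")
      case True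
      then have "h z i = (\<Prod>u\<in>\<sigma>. \<gamma> z u ^ nat (pr (\<mu> i) u))" for z
        using \<mu>[OF True] by (simp add: h_def eval_characters_def toric_hom_def mon_def dual_monoid_iff power_int_def cong: prod.cong)
      then show ?thesis by (simp only:) (intro holomorphic_intros \<gamma>)
    next
      case False
      then show ?thesis by (simp add: h_def eval_characters_def)
    qed
    have conth: "continuous_on S h"
      by (intro continuous_on_coordinatewise_then_product holomorphic_on_imp_continuous_on holh)
    obtain V where V: "open V" "G = Cn n \<inter> V" using g by (auto simp: holomorphic_Cn_def openin_open)
    have hC: "h z \<in> Cn n" for z by (simp add: h_def eval_characters_def Cn_def)
    define S' where "S' = {z\<in>S. orbit M D (tpoint \<sigma> (\<gamma> z)) \<in> W'} \<inter> (S \<inter> h -` V)"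
    have S': "open S'" unfolding S'_def
      using continuous_tpoint_orbit[OF \<sigma> S cont tu W'(1)] continuous_open_preimage[OF conth S V(1)] by blast
    have "(\<lambda>z. g (h z)) holomorphic_on S'"
      using hC V by (intro holomorphic_Cn_along_curve[OF g S']) (auto simp: S'_def intro: holomorphic_on_subset[OF holh])
    moreover have "F (orbit M D (tpoint \<sigma> (\<gamma> z))) = g (h z)" if "z \<in> S'" for z
      using that W'(4) W Fg[OF toric_hom_affine, of "\<gamma> z"] mem[of z] V hC by (auto simp: S'_def h_def tpoint_def)
    ultimately have "(\<lambda>z. F (orbit M D (tpoint \<sigma> (\<gamma> z)))) holomorphic_on S'" by (simp cong: holomorphic_cong)
    moreover have "z0 \<in> S'" using z0 W'(2) z0G V by (auto simp: S'_def h_def)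
    ultimately show ?thesis using S' holomorphic_on_imp_differentiable_at by blast
  qed
  then show ?thesis using S holomorphic_on_def field_differentiable_at_within by blast
qed

section \<open>Charts of normal complex spaces\<close>

locale complex_chart =
  fixes X :: "'b cspace" and U :: "'b set" and n :: nat and G Z :: "(nat \<Rightarrow> complex) set" and c :: "'b \<Rightarrow> nat \<Rightarrow> complex"
  assumes sheaf: "function_sheaf X" and U: "openin (ctop X) U" and G: "openin (top_of_set (Cn n)) G"
    and bihol: "biholomorphic_map (open_subspace X U) (closed_subspace (open_subspace (affine_cspace n) G) Z) c"
begin

definition Zs where "Zs = Cn n \<inter> G \<inter> Z"

lemma topspace_chart: "topspace (subtopology (ctop X) U) = U"
  using openin_subset[OF U] by auto

lemma homeo: "homeomorphic_map (subtopology (ctop X) U) (top_of_set Zs) c"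
  using bihol by (simp add: biholomorphic_map_def open_subspace_def closed_subspace_def affine_cspace_def
      subtopology_subtopology Zs_def)

lemma inj: "inj_on c U"
  using homeomorphic_imp_injective_map[OF homeo] topspace_chart by simp

lemma image: "c ` U = Zs"
  using homeomorphic_imp_surjective_map[OF homeo] topspace_chart by simp

lemma mem_Zs: "p \<in> U \<Longrightarrow> c p \<in> Zs"
  using image by auto

lemma mem_G: "p \<in> U \<Longrightarrow> c p \<in> G" and mem_Cn: "p \<in> U \<Longrightarrow> c p \<in> Cn n"
  using mem_Zs by (auto simp: Zs_def)

lemma openin_subset_chart: "openin (ctop X) V \<Longrightarrow> V \<subseteq> U \<Longrightarrow> openin (subtopology (ctop X) U) V"
  using U openin_open_subtopology by blast

lemma open_image: "openin (ctop X) V \<Longrightarrow> V \<subseteq> U \<Longrightarrow> openin (top_of_set Zs) (c ` V)"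
  using homeomorphic_map_openness[OF homeo, of V] openin_subset_chart[of V] openin_subset[of "ctop X" V] topspace_chart by simp

lemma openin_preimage:
  assumes "openin (top_of_set (Cn n)) W" shows "openin (ctop X) {p\<in>U. c p \<in> W}"
proof -
  have "openin (top_of_set Zs) (Zs \<inter> W)"
    using assms by (auto simp: openin_open Zs_def)
  then have "openin (subtopology (ctop X) U) {p \<in> U. c p \<in> Zs \<inter> W}"
    using homeomorphic_imp_continuous_map[OF homeo] openin_continuous_map_preimage topspace_chart by force
  moreover have "{p \<in> U. c p \<in> Zs \<inter> W} = {p\<in>U. c p \<in> W}" using mem_Zs by auto
  ultimately show ?thesis by (simp add: openin_open_subtopology[OF U])
qed

lemma section_iff:
  assumes V: "openin (ctop X) V" "V \<subseteq> U"
  shows "h \<in> sections X V \<longleftrightarrow> (\<forall>p\<in>V. \<exists>W F. openin (top_of_set (Cn n)) W \<and> c p \<in> W \<and>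
    holomorphic_Cn n W F \<and> (\<forall>q\<in>V. c q \<in> W \<longrightarrow> h q = F (c q)))"
proof -
  define g where "g = h \<circ> inv_into U c"
  have gc: "g (c p) = h p" if "p \<in> V" for p using that V inj by (auto simp: g_def)
  have "h \<in> sections X V \<longleftrightarrow> g \<circ> c \<in> sections X V"
    using sheaf V(1) gc unfolding function_sheaf_def o_def by (metis (no_types, lifting))
  also have "\<dots> \<longleftrightarrow> g \<in> sections (closed_subspace (open_subspace (affine_cspace n) G) Z) (c ` V)"
  proof -
    have "{p \<in> topspace (ctop (open_subspace X U)). c p \<in> c ` V} = V"
      using V inj openin_subset[OF U] by (auto simp: open_subspace_def inj_on_def)
    moreover have "openin (ctop (closed_subspace (open_subspace (affine_cspace n) G) Z)) (c ` V)"
      using open_image[OF V] by (simp add: open_subspace_def closed_subspace_def affine_cspace_def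
      subtopology_subtopology Zs_def)
    ultimately show ?thesis using bihol unfolding biholomorphic_map_def by (simp add: open_subspace_def)
  qed
  also have "\<dots> \<longleftrightarrow> (\<forall>p\<in>V. \<exists>W F. openin (subtopology (top_of_set (Cn n)) G) W \<and> c p \<in> W \<and>
    holomorphic_Cn n W F \<and> (\<forall>q\<in>W \<inter> c ` V. g q = F q))"
    by (auto simp: closed_subspace_def open_subspace_def affine_cspace_def)
  also have "\<dots> \<longleftrightarrow> (\<forall>p\<in>V. \<exists>W F. openin (top_of_set (Cn n)) W \<and> c p \<in> W \<and>
    holomorphic_Cn n W F \<and> (\<forall>q\<in>V. c q \<in> W \<longrightarrow> h q = F (c q)))" (is "?L = ?R")
  proof
    assume ?L then show ?R
      using gc unfolding openin_open_subtopology[OF G]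
      by (intro ballI) (drule (1) bspec, elim exE conjE, rule exI, rule exI, intro conjI, assumption+, force)
  next
    assume R: ?R
    show ?L
    proof
      fix p assume p: "p \<in> V"
      obtain W F where W: "openin (top_of_set (Cn n)) W" "c p \<in> W" "holomorphic_Cn n W F" "\<forall>q\<in>V. c q \<in> W \<longrightarrow> h q = F (c q)"
        using bspec[OF R p] by blast
      have WG: "openin (top_of_set (Cn n)) (W \<inter> G)" using W G by (simp add: openin_Int)
      moreover have "holomorphic_Cn n (W \<inter> G) F"
        using W(3) WG unfolding holomorphic_Cn_def by (auto intro: continuous_on_subset)
      ultimately show "\<exists>W F. openin (subtopology (top_of_set (Cn n)) G) W \<and> c p \<in> W \<and>
        holomorphic_Cn n W F \<and> (\<forall>q\<in>W \<inter> c ` V. g q = F q)"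
        unfolding openin_open_subtopology[OF G] using W p V mem_G gc
        by (intro exI[of _ "W \<inter> G"] exI[of _ F]) auto
    qed
  qed
  finally show ?thesis .
qed

lemma section_open_preimage:
  assumes V: "openin (ctop X) V" "V \<subseteq> U" and h: "h \<in> sections X V" and S: "open S"
  shows "openin (ctop X) {p\<in>V. h p \<in> S}"
proof (subst openin_subopen, intro ballI)
  fix p assume p: "p \<in> {p\<in>V. h p \<in> S}"
  then obtain W F where W: "openin (top_of_set (Cn n)) W" "c p \<in> W" "holomorphic_Cn n W F" "\<forall>q\<in>V. c q \<in> W \<longrightarrow> h q = F (c q)"
    using h unfolding section_iff[OF V] by blast
  have "openin (top_of_set W) (W \<inter> F -` S)"
    using W(3) S by (intro continuous_openin_preimage_gen) (auto simp: holomorphic_Cn_def)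
  then have "openin (top_of_set (Cn n)) (W \<inter> F -` S)" using W(1) openin_trans by blast
  then have "openin (ctop X) (V \<inter> {p\<in>U. c p \<in> W \<inter> F -` S})" by (rule openin_Int[OF V(1) openin_preimage])
  moreover have "p \<in> V \<inter> {p\<in>U. c p \<in> W \<inter> F -` S}" using p W V by auto
  moreover have "V \<inter> {p\<in>U. c p \<in> W \<inter> F -` S} \<subseteq> {p\<in>V. h p \<in> S}" using W by auto
  ultimately show "\<exists>T. openin (ctop X) T \<and> p \<in> T \<and> T \<subseteq> {p\<in>V. h p \<in> S}" by blast
qed

lemma locally_constant_section:
  assumes V: "openin (ctop X) V" "V \<subseteq> U"
    and h: "\<And>p. p \<in> V \<Longrightarrow> \<exists>V'. openin (ctop X) V' \<and> p \<in> V' \<and> V' \<subseteq> V \<and> (\<forall>q\<in>V'. h q = h p)"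
  shows "h \<in> sections X V"
  unfolding section_iff[OF V]
proof
  fix p assume p: "p \<in> V"
  obtain V' where V': "openin (ctop X) V'" "p \<in> V'" "V' \<subseteq> V" "\<forall>q\<in>V'. h q = h p" using h[OF p] by blast
  have "openin (top_of_set Zs) (c ` V')" using V' V by (intro open_image) auto
  then obtain S where S: "open S" "c ` V' = Zs \<inter> S" by (auto simp: openin_open)
  define W where "W = Cn n \<inter> S"
  have W: "openin (top_of_set (Cn n)) W" using S by (auto simp: W_def)
  have "holomorphic_Cn n W (\<lambda>_. h p)" using W by (simp add: holomorphic_Cn_def)
  moreover have "c p \<in> W" using S(2) V'(2) p V(2) mem_Cn by (auto simp: W_def)
  moreover have "h q = h p" if "q \<in> V" "c q \<in> W" for q
  proof -
    have "c q \<in> c ` V'" unfolding S(2) using that V mem_Zs by (auto simp: W_def)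
    then obtain q' where "q' \<in> V'" "c q = c q'" by blast
    then have "q \<in> V'" using inj_onD[OF inj, of q q'] that V(2) V'(3) by blast
    then show ?thesis by (rule bspec[OF V'(4)])
  qed
  ultimately show "\<exists>W F. openin (top_of_set (Cn n)) W \<and> c p \<in> W \<and>
    holomorphic_Cn n W F \<and> (\<forall>q\<in>V. c q \<in> W \<longrightarrow> h q = F (c q))"
    using W by (intro exI[of _ W] exI[of _ "\<lambda>_. h p"] conjI ballI impI)
qed

lemma graph_section:
  assumes V: "openin (ctop X) V" "V \<subseteq> U" and D: "open D" "g holomorphic_on D" and cD: "\<And>p. p \<in> V \<Longrightarrow> c p i \<in> D"
  shows "(\<lambda>p. c p j - g (c p i)) \<in> sections X V"
  unfolding section_iff[OF V]
proof
  fix p assume p: "p \<in> V"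
  define W where "W = Cn n \<inter> (\<lambda>w. w i) -` D"
  have cc: "continuous_on S (\<lambda>w :: nat \<Rightarrow> complex. w k)" for S k
    by (rule continuous_on_subset[OF continuous_on_product_coordinates]) simp
  have "open ((\<lambda>w :: nat \<Rightarrow> complex. w i) -` D)" using continuous_open_preimage[OF cc[of UNIV] _ D(1)] by simp
  then have W: "openin (top_of_set (Cn n)) W" by (auto simp: W_def)
  have "holomorphic_Cn n W (\<lambda>w. w j - g (w i))"
    unfolding holomorphic_Cn_def
  proof (intro conjI W ballI allI impI)
    show "continuous_on W (\<lambda>w. w j - g (w i))"
      by (intro continuous_on_diff cc continuous_on_compose2[OF holomorphic_on_imp_continuous_on[OF D(2)] cc])
         (auto simp: W_def)
  next
    fix w k assume w: "w \<in> W"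
    have "g field_differentiable at (w i)" using w D holomorphic_on_imp_differentiable_at by (auto simp: W_def)
    then have "(\<lambda>\<zeta>. g ((w(k := \<zeta>)) i)) field_differentiable at (w k)" by (cases "k = i") auto
    moreover have "(\<lambda>\<zeta>. (w(k := \<zeta>)) j) field_differentiable at (w k)"
      by (cases "k = j") (auto simp: field_differentiable_ident)
    ultimately show "(\<lambda>\<zeta>. (w(k := \<zeta>)) j - g ((w(k := \<zeta>)) i)) field_differentiable at (w k)"
      by (rule field_differentiable_diff[rotated])
  qed
  then show "\<exists>W F. openin (top_of_set (Cn n)) W \<and> c p \<in> W \<and>
    holomorphic_Cn n W F \<and> (\<forall>q\<in>V. c q \<in> W \<longrightarrow> c q j - g (c q i) = F (c q))"
    using W p V cD mem_Cn by (intro exI[of _ W] exI[of _ "\<lambda>w. w j - g (w i)"]) (auto simp: W_def)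
qed

lemma coordinate_section:
  assumes "openin (ctop X) V" "V \<subseteq> U" shows "(\<lambda>p. c p j) \<in> sections X V"
  by (rule graph_section[OF assms, where D = UNIV and g = "\<lambda>_. 0" and i = 0 and j = j, simplified])

text \<open>Supplies the analytic sets needed for normality: constant \<open>g\<close> gives a
  point, and a curve parametrized by its coordinate \<open>i\<close> gives a local piece of that
  curve.\<close>

lemma graph_analytic:
  assumes V: "openin (ctop X) V" "V \<subseteq> U" and D: "open D" "\<And>j. g j holomorphic_on D" and cD: "\<And>p. p \<in> V \<Longrightarrow> c p i \<in> D"
  shows "analytic_subset (open_subspace X V) {p\<in>V. \<forall>j<n. c p j = g j (c p i)}" (is "analytic_subset _ ?T")
proof -
  have sec: "(\<lambda>p. c p j - g j (c p i)) \<in> sections X V" for j by (rule graph_section[OF V D cD])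
  have tV: "topspace (subtopology (ctop X) V) = V" using openin_subset[OF V(1)] by auto
  have "openin (ctop X) {p\<in>V. c p j - g j (c p i) \<in> - {0}}" for j
    by (rule section_open_preimage[OF V sec]) (simp add: open_Compl)
  then have "openin (ctop X) (\<Union>j<n. {p\<in>V. c p j - g j (c p i) \<in> - {0}})"
    by (intro openin_Union) blast
  moreover have "(\<Union>j<n. {p\<in>V. c p j - g j (c p i) \<in> - {0}}) = V - ?T" by auto
  ultimately have "closedin (subtopology (ctop X) V) ?T"
    unfolding closedin_def tV openin_open_subtopology[OF V(1)] by auto
  moreover have "\<exists>W F. openin (subtopology (ctop X) V) W \<and> p \<in> W \<and> finite F \<and> F \<subseteq> sections X W \<and>
        ?T \<inter> W = {q \<in> W. \<forall>f\<in>F. f q = 0}" if "p \<in> V" for p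
    using that V(1) sec
    by (intro exI[of _ V] exI[of _ "(\<lambda>j p. c p j - g j (c p i)) ` {..<n}"]) (auto simp: openin_open_subtopology)
  ultimately show ?thesis unfolding analytic_subset_def by (simp add: open_subspace_def tV)
qed

text \<open>The indicator function of the closure of \<open>C\<close> is a section off \<open>T\<close>; normality extends it
  over \<open>T\<close> to a continuous function that takes only the values 0 and 1.\<close>

lemma normal_separation:
  assumes normal: "normal_complex_space X" and cover: "(ctop X) closure_of C \<union> (ctop X) closure_of C' = topspace (ctop X)"
    and V: "openin (ctop X) V" "V \<subseteq> U" and T: "analytic_subset (open_subspace X V) T" and TC: "T \<inter> (C \<union> C') = {}"
    and sub: "(ctop X) closure_of C \<inter> (ctop X) closure_of C' \<inter> V \<subseteq> T"
  shows "(ctop X) closure_of C \<inter> (ctop X) closure_of C' \<inter> V = {}"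
proof (rule ccontr)
  let ?K = "(ctop X) closure_of C" and ?K' = "(ctop X) closure_of C'"
  assume "?K \<inter> ?K' \<inter> V \<noteq> {}"
  then obtain p where p: "p \<in> ?K" "p \<in> ?K'" "p \<in> V" by auto
  have tV: "topspace (subtopology (ctop X) V) = V" using openin_subset[OF V(1)] by auto
  have clT: "closedin (subtopology (ctop X) V) T" using T by (simp add: analytic_subset_def open_subspace_def)
  have TV: "T \<subseteq> V" using closedin_subset[OF clT] tV by simp
  have VT: "openin (ctop X) (V - T)" using clT unfolding closedin_def tV openin_open_subtopology[OF V(1)] by simp
  define h where "h = (\<lambda>q. if q \<in> ?K then 1 else 0 :: complex)"
  have h: "h \<in> sections X (V - T)"
  proof (rule locally_constant_section[OF VT])
    fix q assume q: "q \<in> V - T"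
    show "\<exists>V'. openin (ctop X) V' \<and> q \<in> V' \<and> V' \<subseteq> V - T \<and> (\<forall>q'\<in>V'. h q' = h q)"
    proof (cases "q \<in> ?K")
      case True
      have "openin (ctop X) ((V - T) - ?K')" by (intro openin_diff VT closedin_closure_of)
      moreover have "(V - T) - ?K' \<subseteq> ?K" using cover openin_subset[OF VT] by blast
      ultimately show ?thesis using True q sub by (intro exI[of _ "(V - T) - ?K'"]) (auto simp: h_def)
    next
      case False
      have "openin (ctop X) ((V - T) - ?K)" by (intro openin_diff VT closedin_closure_of)
      then show ?thesis using False q by (intro exI[of _ "(V - T) - ?K"]) (auto simp: h_def)
    qed
  qed (use V in auto)
  have meet: "\<exists>q\<in>E. q \<in> S" if "x \<in> (ctop X) closure_of E" "openin (ctop X) S" "x \<in> S" for x E S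
    using that by (auto simp: in_closure_of)
  \<comment> \<open>An open set inside \<open>T\<close> would meet \<open>C \<union> C'\<close>,
    which is dense by \<open>cover\<close> and avoided by \<open>T\<close>.\<close>
  have "subtopology (ctop X) V interior_of T = {}"
  proof (rule ccontr)
    assume "subtopology (ctop X) V interior_of T \<noteq> {}"
    then obtain S q where S: "openin (ctop X) S" "S \<subseteq> T" "q \<in> S"
      by (auto simp: interior_of_def openin_open_subtopology[OF V(1)])
    then have "q \<in> ?K \<or> q \<in> ?K'" using cover openin_subset[OF S(1)] by auto
    then show False using meet S TC by blast
  qed
  then have thin: "thin_subset (open_subspace X V) T"
    using T by (simp add: thin_subset_def) (simp add: open_subspace_def)
  have bd: "\<exists>W B. openin (ctop X) W \<and> q \<in> W \<and> (\<forall>q'\<in>W \<inter> (V - T). norm (h q') \<le> B)" if "q \<in> V" for q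
    using V(1) that by (intro exI[of _ V] exI[of _ 1]) (auto simp: h_def)
  obtain F where F: "F \<in> sections X V" "\<forall>q\<in>V - T. F q = h q"
  proof -
    have "\<forall>q\<in>V. \<exists>W B. openin (ctop X) W \<and> q \<in> W \<and> (\<forall>q'\<in>W \<inter> (V - T). norm (h q') \<le> B)" using bd by blast
    moreover have "\<forall>U A f. openin (ctop X) U \<longrightarrow> thin_subset (open_subspace X U) A \<longrightarrow>
        f \<in> sections X (U - A) \<longrightarrow>
        (\<forall>p\<in>U. \<exists>W C. openin (ctop X) W \<and> p \<in> W \<and> (\<forall>q\<in>W \<inter> (U - A). norm (f q) \<le> C)) \<longrightarrow>
        (\<exists>F\<in>sections X U. \<forall>q\<in>U - A. F q = f q)"
      using normal by (simp add: normal_complex_space_def)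
    ultimately have "\<exists>F\<in>sections X V. \<forall>q\<in>V - T. F q = h q" using V(1) thin h by simp
    then show ?thesis using that by blast
  qed
  \<comment> \<open>Off \<open>T\<close> the extension \<open>F\<close> equals 1 on \<open>C\<close>
    and 0 on \<open>C'\<close>. Both sets accumulate at \<open>p\<close>, so continuity rules out
    every value of \<open>F p\<close>; it is enough to distinguish whether the value is 0.\<close>
  show False
  proof (cases "F p = 0")
    case True
    then have "p \<in> {q\<in>V. F q \<in> - {1}}" using p by auto
    moreover have "openin (ctop X) {q\<in>V. F q \<in> - {1}}" by (rule section_open_preimage[OF V F(1)]) auto
    ultimately obtain q where q: "q \<in> C" "q \<in> V" "F q \<noteq> 1" using meet[OF p(1)] by blast
    then have "q \<in> topspace (ctop X)" using openin_subset[OF V(1)] by auto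
    then have "q \<in> ?K" using q(1) closure_of_subset_Int[of "ctop X" C] by auto
    moreover have "q \<in> V - T" using q TC by blast
    then have "F q = h q" using F by blast
    ultimately show False using q by (simp add: h_def)
  next
    case False
    then have "p \<in> {q\<in>V. F q \<in> - {0}}" using p by auto
    moreover have "openin (ctop X) {q\<in>V. F q \<in> - {0}}" by (rule section_open_preimage[OF V F(1)]) auto
    ultimately obtain q where q: "q \<in> C'" "q \<in> V" "F q \<noteq> 0" using meet[OF p(2)] by blast
    then have "q \<in> topspace (ctop X)" using openin_subset[OF V(1)] by auto
    then have "q \<in> ?K'" using q(1) closure_of_subset_Int[of "ctop X" C'] by auto
    moreover have "q \<in> V - T" using q TC by blast
    then have "F q = h q" using F by blast
    ultimately show False using q sub TC by (auto simp: h_def split: if_splits)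
  qed
qed

end

lemma reduced_complex_space_chart:
  assumes "reduced_complex_space X" "p \<in> topspace (ctop X)"
  obtains U n G Z c where "complex_chart X U n G Z c" "p \<in> U"
proof -
  have "\<exists>U n G Z c. openin (ctop X) U \<and> p \<in> U \<and> openin (top_of_set (Cn n)) G \<and>
        analytic_subset (open_subspace (affine_cspace n) G) Z \<and>
        biholomorphic_map (open_subspace X U)
          (closed_subspace (open_subspace (affine_cspace n) G) Z) c"
    using assms by (simp add: reduced_complex_space_def)
  moreover have "function_sheaf X" using assms by (simp add: reduced_complex_space_def)
  ultimately show ?thesis using that unfolding complex_chart_def by (elim exE conjE) blast
qed

section \<open>The strata of a normalization of the central fibre\<close>

lemma toric_hom_cong: "(\<And>u. u \<in> \<sigma> \<Longrightarrow> x u = x' u) \<Longrightarrow> toric_hom \<sigma> x = toric_hom \<sigma> x'"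
  by (auto simp: toric_hom_def mon_def fun_eq_iff intro!: prod.cong)

lemma tpoint_cong: "(\<And>u. u \<in> \<sigma> \<Longrightarrow> x u = x' u) \<Longrightarrow> tpoint \<sigma> x = tpoint \<sigma> x'"
  using toric_hom_cong[of \<sigma> x x'] by (simp add: tpoint_def)

text \<open>The notion \<open>is_normalization\<close> with its thin set \<open>A\<close> made a
  parameter, and with finiteness of \<open>f\<close> split into closedness and finite
  fibres.\<close>

locale normalized_fibre =
  fixes M :: "int^2^2" and D :: "complex \<Rightarrow> complex^2^2" and r \<epsilon> :: real
    and X :: "'b cspace" and f :: "'b \<Rightarrow> toric_point set" and A :: "toric_point set set"
  assumes D: "\<And>i j. (\<lambda>t. D t $ i $ j) holomorphic_on ball 0 r" and eps: "0 < \<epsilon>" "\<epsilon> \<le> r"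
    and normal: "normal_complex_space X"
    and f_cont: "continuous_map (ctop X) (ctop (central_fibre M D \<epsilon>)) f"
    and f_closed: "closed_map (ctop X) (ctop (central_fibre M D \<epsilon>)) f"
    and f_finite: "\<And>q. q \<in> topspace (ctop (central_fibre M D \<epsilon>)) \<Longrightarrow> finite {p \<in> topspace (ctop X). f p = q}"
    and f_surj: "f ` topspace (ctop X) = topspace (ctop (central_fibre M D \<epsilon>))"
    and thin: "thin_subset (central_fibre M D \<epsilon>) A"
    and nowhere_dense: "ctop X interior_of {p \<in> topspace (ctop X). f p \<in> A} = {}"
    and bihol: "biholomorphic_map (open_subspace X (topspace (ctop X) - {p \<in> topspace (ctop X). f p \<in> A}))
      (open_subspace (central_fibre M D \<epsilon>) (topspace (ctop (central_fibre M D \<epsilon>)) - A)) f"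
begin

abbreviation "X0 \<equiv> central_fibre M D \<epsilon>"
abbreviation "ob \<equiv> orbit M D"
abbreviation "XS \<equiv> topspace (ctop X)"

definition Y0 where "Y0 = {y \<in> tube \<epsilon>. t_coord y = 0}"

lemma Dcont: "continuous_on (ball 0 r) (\<lambda>t. D t $ i $ j)"
  using D holomorphic_on_imp_continuous_on by blast

lemma Y0_toric: "y \<in> Y0 \<Longrightarrow> y \<in> toric_points"
  by (simp add: Y0_def tube_def)

lemma Y0_tube: "y \<in> Y0 \<Longrightarrow> y \<in> tube \<epsilon>"
  by (simp add: Y0_def)

lemma Y0_iff: "y \<in> Y0 \<longleftrightarrow> y \<in> toric_points \<and> t_coord y = 0"
  using eps by (auto simp: Y0_def tube_def)

lemma tpoint_Y0: "triangle \<sigma> \<Longrightarrow> tpoint \<sigma> x \<in> Y0 \<longleftrightarrow> (\<exists>u\<in>\<sigma>. x u = 0)"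
  by (simp add: Y0_iff tpoint_in triangle_fan t_coord_tpoint triangle_finite)

lemma ctop_X0: "ctop X0 = subtopology (ctop (compactification M D \<epsilon>)) (ob ` Y0)"
  by (simp add: central_fibre_def closed_subspace_def Y0_def)

lemma topspace_X0: "topspace (ctop X0) = ob ` Y0"
  by (auto simp: ctop_X0 topspace_compactification Y0_def)

lemma orbit_eqE:
  assumes "ob y = ob y'" "y' \<in> toric_points" obtains v where "y' = act D (M *v v) y"
proof -
  have "y' \<in> ob y" using orbit_self[OF assms(2), of M D] assms(1) by simp
  then show ?thesis using that by (auto simp: orbit_def)
qed

lemma Y0_act: "y \<in> Y0 \<Longrightarrow> act D \<nu> y \<in> Y0"
  by (simp add: Y0_iff act_in t_coord_act)

lemma orbit_act: "y \<in> toric_points \<Longrightarrow> ob (act D (M *v v) y) = ob y"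
  by (rule orbit_eq) (auto simp: orbit_def)

lemma open_curve:
  fixes \<gamma> :: "'a::topological_space \<Rightarrow> int^2 \<Rightarrow> complex"
  assumes "triangle \<sigma>" "open S" "continuous_on S \<gamma>" and Y: "\<And>z. z \<in> S \<Longrightarrow> tpoint \<sigma> (\<gamma> z) \<in> Y0"
    and W: "openin (ctop X0) W"
  shows "open {z\<in>S. ob (tpoint \<sigma> (\<gamma> z)) \<in> W}"
proof -
  obtain W' where W': "openin (ctop (compactification M D \<epsilon>)) W'" "W = W' \<inter> ob ` Y0"
    using W by (auto simp: ctop_X0 openin_subtopology)
  have "open {z\<in>S. ob (tpoint \<sigma> (\<gamma> z)) \<in> W'}"
    by (rule continuous_tpoint_orbit[OF assms(1-3) Y0_tube[OF Y] W'(1)])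
  moreover have "{z\<in>S. ob (tpoint \<sigma> (\<gamma> z)) \<in> W} = {z\<in>S. ob (tpoint \<sigma> (\<gamma> z)) \<in> W'}"
    using Y W'(2) by auto
  ultimately show ?thesis by simp
qed

lemma openin_X0_image:
  assumes W: "openin toric_topology W" shows "openin (ctop X0) (ob ` (W \<inter> Y0))"
proof -
  have "openin (ctop X0) (ob ` (W \<inter> tube \<epsilon>) \<inter> ob ` Y0)"
    unfolding ctop_X0 openin_subtopology using openin_orbit_image[OF Dcont eps(2) W] by blast
  moreover have "ob ` (W \<inter> tube \<epsilon>) \<inter> ob ` Y0 = ob ` (W \<inter> Y0)"
  proof
    show "ob ` (W \<inter> tube \<epsilon>) \<inter> ob ` Y0 \<subseteq> ob ` (W \<inter> Y0)"
    proof
      fix q assume "q \<in> ob ` (W \<inter> tube \<epsilon>) \<inter> ob ` Y0"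
      then obtain y y' where y: "y \<in> W" "y \<in> tube \<epsilon>" "y' \<in> Y0" "q = ob y" "ob y = ob y'" by blast
      obtain v where "y = act D (M *v v) y'"
        using orbit_eqE[of y' y] y(2,5) tube_toric by metis
      then have "y \<in> Y0" using Y0_act y(3) by simp
      then show "q \<in> ob ` (W \<inter> Y0)" using y by blast
    qed
    show "ob ` (W \<inter> Y0) \<subseteq> ob ` (W \<inter> tube \<epsilon>) \<inter> ob ` Y0" using Y0_tube by blast
  qed
  ultimately show ?thesis by simp
qed

definition cl :: "int^2 \<Rightarrow> (int^2) set" where "cl u = (+) u ` range ((*v) M)"

definition classes where "classes = lcosets UNIV (range ((*v) M))"

lemma classes_eq: "classes = range cl"
  by (simp add: classes_def lcosets_def cl_def)

lemma cl_self: "u \<in> cl u"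
  unfolding cl_def by (rule image_eqI[of _ _ 0]) (auto intro: image_eqI[of _ _ 0])

lemma mem_cl: "w \<in> cl u \<longleftrightarrow> (\<exists>v. w = u + M *v v)"
  by (auto simp: cl_def)

lemma cl_eq: assumes "w \<in> cl u" shows "cl w = cl u"
proof -
  obtain v where v: "w = u + M *v v" using assms by (auto simp: mem_cl)
  have 1: "w + M *v x = u + M *v (v + x)" for x by (simp add: v matrix_vector_right_distrib add.assoc)
  have 2: "u + M *v x = w + M *v (x - v)" for x by (simp add: 1)
  show ?thesis
  proof (intro set_eqI iffI)
    fix z assume "z \<in> cl w" then show "z \<in> cl u" unfolding mem_cl using 1 by metis
  next
    fix z assume "z \<in> cl u" then show "z \<in> cl w" unfolding mem_cl using 2 by metis
  qed
qed

lemma class_translate: "k \<in> classes \<Longrightarrow> u \<in> k \<Longrightarrow> u + M *v v \<in> k"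
  using cl_eq mem_cl by (metis classes_eq rangeE)

lemma classes_disjoint: "k \<in> classes \<Longrightarrow> k' \<in> classes \<Longrightarrow> u \<in> k \<Longrightarrow> u \<in> k' \<Longrightarrow> k = k'"
  using cl_eq by (metis classes_eq rangeE)

text \<open>A ray of the fan is an irreducible component of the zero set of \<open>t\<close>; the points on no other
  component are those whose cone is the ray.\<close>

definition reg :: "(int^2) set \<Rightarrow> toric_point set set" where
  "reg k = ob ` {y\<in>Y0. \<exists>u\<in>k. min_cone y = {u}}"

lemma mem_reg:
  assumes k: "k \<in> classes" and y: "y \<in> Y0" shows "ob y \<in> reg k \<longleftrightarrow> (\<exists>u\<in>k. min_cone y = {u})"
proof
  assume "ob y \<in> reg k"
  then obtain y' u where y': "y' \<in> Y0" "u \<in> k" "min_cone y' = {u}" "ob y' = ob y" by (auto simp: reg_def)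
  obtain v where "y = act D (M *v v) y'" using orbit_eqE[OF y'(4) Y0_toric[OF y]] .
  then have "min_cone y = {u + M *v v}" using y' Y0_toric by (simp add: min_cone_act add.commute)
  then show "\<exists>u\<in>k. min_cone y = {u}" using class_translate[OF k y'(2)] by blast
qed (use y in \<open>auto simp: reg_def\<close>)

text \<open>Ordered triangles, because the vertices play different roles: \<open>v\<close> is the
  component under study, \<open>w\<close> its neighbour across a double curve, and \<open>u\<close>
  the vertex that joins them at the triple point.\<close>

definition tri3 :: "int^2 \<Rightarrow> int^2 \<Rightarrow> int^2 \<Rightarrow> bool" where
  "tri3 v w u \<longleftrightarrow> triangle {v, w, u} \<and> v \<noteq> w \<and> v \<noteq> u \<and> w \<noteq> u"

definition emb :: "int^2 \<Rightarrow> int^2 \<Rightarrow> complex \<times> complex \<Rightarrow> int^2 \<Rightarrow> complex" where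
  "emb w u b z = (if z = w then snd b else if z = u then fst b else 0)"

text \<open>The plane \<open>x\<^sub>v = 0\<close> in the chart of a triangle, with coordinates \<open>b = (x\<^sub>u, x\<^sub>w)\<close>; the double curve
  of the components \<open>v\<close> and \<open>w\<close> is \<open>snd b = 0\<close>.\<close>

definition pt :: "int^2 \<Rightarrow> int^2 \<Rightarrow> int^2 \<Rightarrow> complex \<times> complex \<Rightarrow> toric_point" where
  "pt v w u b = tpoint {v, w, u} (emb w u b)"

lemma pt_Y0: "tri3 v w u \<Longrightarrow> pt v w u b \<in> Y0"
  by (auto simp: pt_def tri3_def tpoint_Y0 emb_def)

lemma pt_X0: "tri3 v w u \<Longrightarrow> ob (pt v w u b) \<in> topspace (ctop X0)"
  using pt_Y0 by (simp add: topspace_X0)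

lemma min_cone_pt: "tri3 v w u \<Longrightarrow> min_cone (pt v w u b) =
    {v} \<union> (if snd b = 0 then {w} else {}) \<union> (if fst b = 0 then {u} else {})"
  by (auto simp: pt_def tri3_def min_cone_tpoint triangle_fan emb_def)

lemma tpoint_pt:
  assumes "tri3 v w u" "x v = 0" shows "tpoint {v, w, u} x = pt v w u (x u, x w)"
  unfolding pt_def by (rule tpoint_cong) (use assms in \<open>auto simp: emb_def tri3_def\<close>)

lemma pt_exists:
  assumes t: "tri3 v w u" and y: "y \<in> toric_points" "v \<in> min_cone y" "min_cone y \<subseteq> {v, w, u}"
  obtains b where "y = pt v w u b"
proof -
  obtain \<sigma>' x' where s: "triangle \<sigma>'" "y = tpoint \<sigma>' x'" using y(1) by (rule toric_pointsE)
  have \<sigma>: "triangle {v, w, u}" using t by (simp add: tri3_def)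
  define z where "z = (\<lambda>u'. mon \<sigma>' x' (dual_char {v, w, u} u'))"
  have "y = tpoint {v, w, u} z"
    unfolding s(2) by (rule tpoint_change[OF \<sigma> s(1)]) (use y s in \<open>auto simp: min_cone_tpoint triangle_fan z_def\<close>)
  moreover from this have "z v = 0" using y(2) \<sigma> by (simp add: min_cone_tpoint triangle_fan)
  ultimately show ?thesis using that tpoint_pt[OF t] by blast
qed

lemma tri3_exists: "\<exists>w u. tri3 v w u"
proof (intro exI)
  have "triangle {v, v + axis 1 1, v + axis 2 1}" by (auto simp: triangle_def upper_triangle_def)
  then show "tri3 v (v + axis 1 1) (v + axis 2 1)" by (auto simp: tri3_def vec_eq_iff forall_2)
qed

lemma emb_holomorphic:
  assumes "g1 holomorphic_on S" "g2 holomorphic_on S"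
  shows "(\<lambda>z. emb w u (g1 z, g2 z) z') holomorphic_on S"
  using assms by (cases "z' = w"; cases "z' = u") (simp_all add: emb_def)

lemma emb_continuous: "continuous_on S (emb w u)"
proof (rule continuous_on_coordinatewise_then_product)
  show "continuous_on S (\<lambda>b. emb w u b i)" for i
    by (cases "i = w"; cases "i = u") (simp_all add: emb_def continuous_intros)
qed

lemma open_pt:
  assumes "tri3 v w u" "openin (ctop X0) W" shows "open {b. ob (pt v w u b) \<in> W}"
  using open_curve[of "{v, w, u}" UNIV "emb w u" W] assms pt_Y0 emb_continuous by (auto simp: pt_def tri3_def)

lemma A_closed: "closedin (ctop X0) A" and A_analytic: "analytic_subset X0 A" and A_interior: "ctop X0 interior_of A = {}"
  using thin by (auto simp: thin_subset_def analytic_subset_def)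

lemma openin_A_compl: "openin (ctop X0) (topspace (ctop X0) - A)"
  using A_closed by (simp add: closedin_def)

text \<open>Pulls \<open>A\<close> back to a curve in the closure of one stratum, so that the
  identity theorem in one variable controls an otherwise arbitrary thin set.\<close>

lemma pt_analytic:
  assumes t: "tri3 v w u" and S: "open S" and g: "g1 holomorphic_on S" "g2 holomorphic_on S"
  shows "locally_analytic_set S {z\<in>S. ob (pt v w u (g1 z, g2 z)) \<in> A}"
proof -
  have \<sigma>: "triangle {v, w, u}" using t by (simp add: tri3_def)
  have Y: "tpoint {v, w, u} (emb w u (g1 z, g2 z)) \<in> Y0" for z using pt_Y0[OF t] by (simp add: pt_def)
  have cont: "continuous_on S (\<lambda>z. emb w u (g1 z, g2 z))"
    by (intro continuous_on_coordinatewise_then_product holomorphic_on_imp_continuous_on emb_holomorphic g)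
  have op: "open {z\<in>S. ob (pt v w u (g1 z, g2 z)) \<in> W}" if "openin (ctop X0) W" for W
    unfolding pt_def by (rule open_curve[OF \<sigma> S cont Y that])
  show ?thesis
    unfolding locally_analytic_set_def
  proof (intro conjI ballI)
    have "S - {z\<in>S. ob (pt v w u (g1 z, g2 z)) \<in> A} = {z\<in>S. ob (pt v w u (g1 z, g2 z)) \<in> topspace (ctop X0) - A}"
      using pt_X0[OF t] by auto
    then show "openin (top_of_set S) (S - {z\<in>S. ob (pt v w u (g1 z, g2 z)) \<in> A})"
      using op[OF openin_A_compl] by (simp add: openin_open_eq[OF S])
  next
    fix z assume z: "z \<in> S"
    have "\<exists>W F. openin (ctop X0) W \<and> ob (pt v w u (g1 z, g2 z)) \<in> W \<and> finite F \<and> F \<subseteq> sections X0 W \<and>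
        A \<inter> W = {q \<in> W. \<forall>f\<in>F. f q = 0}"
      using A_analytic pt_X0[OF t] by (simp add: analytic_subset_def)
    then obtain W F where W: "openin (ctop X0) W" "ob (pt v w u (g1 z, g2 z)) \<in> W" "F \<subseteq> sections X0 W"
        "A \<inter> W = {q \<in> W. \<forall>f\<in>F. f q = 0}" by (elim exE conjE)
    define S' where "S' = {z\<in>S. ob (pt v w u (g1 z, g2 z)) \<in> W}"
    define F' where "F' = (\<lambda>h z. h (ob (pt v w u (g1 z, g2 z)))) ` F"
    have "open S'" unfolding S'_def by (rule op[OF W(1)])
    moreover have "h holomorphic_on S'" if hF': "h \<in> F'" for h
    proof -
      obtain h' where h': "h' \<in> F" "h = (\<lambda>z. h' (ob (pt v w u (g1 z, g2 z))))" using hF' by (auto simp: F'_def)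
      show ?thesis
        unfolding h'(2) pt_def
      proof (rule section_along_curve[OF _ \<sigma> \<open>open S'\<close>])
        show "h' \<in> sections X0 W" using W(3) h' by auto
        have "S' \<subseteq> S" by (auto simp: S'_def)
        then show "(\<lambda>z. emb w u (g1 z, g2 z) z') holomorphic_on S'" for z'
          using emb_holomorphic[OF g] holomorphic_on_subset by blast
        show "tpoint {v, w, u} (emb w u (g1 z, g2 z)) \<in> tube \<epsilon>" for z using Y Y0_tube by blast
        show "ob (tpoint {v, w, u} (emb w u (g1 z, g2 z))) \<in> W" if "z \<in> S'" for z
          using that by (simp add: S'_def pt_def)
      qed
    qed
    moreover have "{z\<in>S. ob (pt v w u (g1 z, g2 z)) \<in> A} \<inter> S' = {x\<in>S'. \<forall>h\<in>F'. h x = 0}"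
    proof -
      have "ob (pt v w u (g1 z, g2 z)) \<in> A \<longleftrightarrow> (\<forall>h\<in>F. h (ob (pt v w u (g1 z, g2 z))) = 0)" if "z \<in> S'" for z
        using W(4) that unfolding S'_def by blast
      then show ?thesis unfolding F'_def S'_def by auto
    qed
    ultimately show "\<exists>W F. open W \<and> z \<in> W \<and> W \<subseteq> S \<and> (\<forall>f\<in>F. f holomorphic_on W) \<and>
        {z\<in>S. ob (pt v w u (g1 z, g2 z)) \<in> A} \<inter> W = {x\<in>W. \<forall>f\<in>F. f x = 0}"
      using z W(2) by (intro exI[of _ S'] exI[of _ F']) (auto simp: S'_def)
  qed auto
qed

text \<open>A single chart already contains the whole torus orbit of the ray \<open>v\<close>, so
  this is the entire open stratum off \<open>A\<close>, not just a local piece.\<close>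

definition Q :: "int^2 \<Rightarrow> int^2 \<Rightarrow> int^2 \<Rightarrow> (complex \<times> complex) set" where
  "Q v w u = {b. fst b \<noteq> 0 \<and> snd b \<noteq> 0 \<and> ob (pt v w u b) \<notin> A}"

text \<open>Two points are joined along the complex line through them, in which the complement of \<open>Q\<close>
  is discrete.\<close>

lemma connected_Q:
  assumes t: "tri3 v w u" and H: "convex H" "open H" shows "connected (H \<inter> Q v w u)"
  unfolding connected_iff_connected_component
proof (intro ballI)
  fix a b assume a: "a \<in> H \<inter> Q v w u" and b: "b \<in> H \<inter> Q v w u"
  define g1 g2 where "g1 = (\<lambda>z. fst a + z * (fst b - fst a))" and "g2 = (\<lambda>z. snd a + z * (snd b - snd a))"
  define L where "L = (\<lambda>z. (g1 z, g2 z))"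
  have contL: "continuous_on T L" for T unfolding L_def g1_def g2_def by (intro continuous_intros)
  have L01: "L 0 = a" "L 1 = b" by (auto simp: L_def g1_def g2_def)
  define S0 where "S0 = L -` H"
  have "convex S0"
    unfolding convex_alt
  proof (intro ballI allI impI)
    fix x y and t :: real assume "x \<in> S0" "y \<in> S0" "0 \<le> t \<and> t \<le> 1"
    then have "(1 - t) *\<^sub>R L x + t *\<^sub>R L y \<in> H" using H(1) by (auto simp: S0_def convex_alt)
    moreover have "(1 - t) *\<^sub>R L x + t *\<^sub>R L y = L ((1 - t) *\<^sub>R x + t *\<^sub>R y)"
      by (simp add: L_def g1_def g2_def algebra_simps scaleR_conv_of_real)
    ultimately show "(1 - t) *\<^sub>R x + t *\<^sub>R y \<in> S0" by (simp add: S0_def)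
  qed
  then have conS0: "connected S0" by (rule convex_connected)
  have opS0: "open S0" using continuous_open_preimage[OF contL[of UNIV] open_UNIV H(2)] by (simp add: S0_def)
  have fin: "finite {z. \<alpha> + z * (\<beta> - \<alpha>) = 0}" if "\<alpha> \<noteq> 0" for \<alpha> \<beta> :: complex
  proof (rule finite_subset)
    show "{z. \<alpha> + z * (\<beta> - \<alpha>) = 0} \<subseteq> {- \<alpha> / (\<beta> - \<alpha>)}"
    proof
      fix z assume "z \<in> {z. \<alpha> + z * (\<beta> - \<alpha>) = 0}"
      then have z: "z * (\<beta> - \<alpha>) = - \<alpha>" by (simp add: eq_neg_iff_add_eq_0 add.commute)
      then have "\<beta> - \<alpha> \<noteq> 0" using that by auto
      then show "z \<in> {- \<alpha> / (\<beta> - \<alpha>)}" using z by (metis nonzero_eq_divide_eq singletonI)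
    qed
  qed simp
  \<comment> \<open>Parameters at which the line leaves the torus. They are finitely many since both
    coordinates are nonzero at \<open>a\<close>, the point with parameter 0.\<close>
  define B where "B = {z. g1 z = 0} \<union> {z. g2 z = 0}"
  have finB: "finite B" using a fin[of "fst a" "fst b"] fin[of "snd a" "snd b"] by (auto simp: B_def g1_def g2_def Q_def)
  define S where "S = S0 - B"
  have S: "open S" "connected S"
    unfolding S_def using open_Diff[OF opS0 finite_imp_closed[OF finB]]
      connected_open_diff_countable[OF _ opS0 conS0 countable_finite[OF finB]] by simp_all
  define Z where "Z = {z\<in>S. ob (pt v w u (g1 z, g2 z)) \<in> A}"
  have "locally_analytic_set S Z"
  proof -
    have "g1 holomorphic_on S" "g2 holomorphic_on S"
      unfolding g1_def g2_def by (intro holomorphic_intros)+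
    then show ?thesis unfolding Z_def by (rule pt_analytic[OF t S(1)])
  qed
  then have "connected (S - Z)" using connected_diff_locally_analytic_set S by blast
  then have "connected (L ` (S - Z))" by (rule connected_continuous_image[OF contL])
  moreover have "L ` (S - Z) \<subseteq> H \<inter> Q v w u" by (auto simp: S_def S0_def Z_def Q_def L_def B_def)
  moreover have "0 \<in> S - Z" "1 \<in> S - Z"
    using a b L01 by (auto simp: S_def S0_def Z_def Q_def L_def B_def)
  then have "a \<in> L ` (S - Z)" "b \<in> L ` (S - Z)" using L01 by blast+
  ultimately show "connected_component (H \<inter> Q v w u) a b" unfolding connected_component_def by blast
qed

text \<open>Where \<open>x\<^sub>u\<close> and \<open>x\<^sub>w\<close> are nonzero the central
  fibre is the plane \<open>x\<^sub>v = 0\<close> alone, so an open piece of this plane is open in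
  the fibre and cannot lie in \<open>A\<close>, whose interior is empty.\<close>

lemma Q_dense:
  assumes t: "tri3 v w u" and H: "open H" "H \<noteq> {}" shows "H \<inter> Q v w u \<noteq> {}"
proof
  assume empty: "H \<inter> Q v w u = {}"
  have \<sigma>: "triangle {v, w, u}" using t by (simp add: tri3_def)
  define H' where "H' = {b\<in>H. fst b \<noteq> 0 \<and> snd b \<noteq> 0}"
  have "H' = H \<inter> {b. fst b \<noteq> 0} \<inter> {b. snd b \<noteq> 0}" by (auto simp: H'_def)
  then have opH': "open H'" using H(1) by (auto intro!: open_Int open_Collect_neq continuous_intros)
  obtain b where b: "b \<in> H" using H by auto
  obtain e where e: "e > 0" "ball b e \<subseteq> H" using H(1) b open_contains_ball by blast
  \<comment> \<open>Vanishing coordinates are moved to \<open>e / 3\<close>; the two changes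
    together stay below \<open>e\<close>.\<close>
  define b' where "b' = (if fst b = 0 then of_real (e/3) else fst b, if snd b = 0 then of_real (e/3) else snd b)"
  have "dist b' b = norm (fst b' - fst b, snd b' - snd b)" by (simp add: dist_norm minus_prod_def)
  also have "\<dots> \<le> norm (fst b' - fst b) + norm (snd b' - snd b)" by (rule norm_Pair_le)
  also have "\<dots> < e" using e(1) by (auto simp: b'_def norm_divide)
  finally have b': "b' \<in> H'" using e by (auto simp: H'_def b'_def dist_commute subset_eq)
  define N where "N = {x :: int^2 \<Rightarrow> complex. (x u, x w) \<in> H'}"
  have "continuous_on UNIV (\<lambda>x :: int^2 \<Rightarrow> complex. (x u, x w))"
    by (intro continuous_on_Pair continuous_on_coordinate)
  then have "open N" using continuous_open_preimage[of UNIV "\<lambda>x :: int^2 \<Rightarrow> complex. (x u, x w)" H'] opH'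
    by (simp add: N_def vimage_def)
  then have op: "openin (ctop X0) (ob ` (tpoint {v, w, u} ` N \<inter> Y0))"
    by (intro openin_X0_image openin_tpoint_image \<sigma>)
  have "ob ` (tpoint {v, w, u} ` N \<inter> Y0) \<subseteq> A"
  proof
    fix q assume "q \<in> ob ` (tpoint {v, w, u} ` N \<inter> Y0)"
    then obtain x where x: "x \<in> N" "tpoint {v, w, u} x \<in> Y0" "q = ob (tpoint {v, w, u} x)" by auto
    then have "x v = 0" using tpoint_Y0[OF \<sigma>] by (auto simp: N_def H'_def)
    then have "q = ob (pt v w u (x u, x w))" using x tpoint_pt[OF t] by simp
    then show "q \<in> A" using empty x(1) by (auto simp: N_def H'_def Q_def)
  qed
  then have "ob ` (tpoint {v, w, u} ` N \<inter> Y0) \<subseteq> ctop X0 interior_of A" by (rule interior_of_maximal[OF _ op])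
  moreover have "emb w u b' \<in> N" using b' t by (auto simp: N_def emb_def tri3_def)
  then have "ob (pt v w u b') \<in> ob ` (tpoint {v, w, u} ` N \<inter> Y0)" using pt_Y0[OF t] by (auto simp: pt_def)
  ultimately show False using A_interior by auto
qed

section \<open>The inverse of the normalization off the thin set, and the strata lifted by
  it\<close>

definition Xr where "Xr = {p\<in>XS. f p \<notin> A}"

lemma Xr_eq: "XS - {p \<in> XS. f p \<in> A} = Xr"
  by (auto simp: Xr_def)

lemma f_X0: "p \<in> XS \<Longrightarrow> f p \<in> topspace (ctop X0)"
  using f_surj by auto

lemma openin_f_preimage: "openin (ctop X0) W \<Longrightarrow> openin (ctop X) {p\<in>XS. f p \<in> W}"
  using f_cont openin_continuous_map_preimage by blast

lemma openin_Xr: "openin (ctop X) Xr"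
proof -
  have "Xr = {p\<in>XS. f p \<in> topspace (ctop X0) - A}" using f_X0 by (auto simp: Xr_def)
  then show ?thesis using openin_f_preimage[OF openin_A_compl] by simp
qed

lemma homeo_Xr: "homeomorphic_map (subtopology (ctop X) Xr) (subtopology (ctop X0) (topspace (ctop X0) - A)) f"
  using bihol by (simp add: biholomorphic_map_def open_subspace_def Xr_eq)

lemma inj_Xr: "inj_on f Xr"
  using homeomorphic_imp_injective_map[OF homeo_Xr] by (simp add: Xr_def Int_def)

lemma image_Xr: "f ` Xr = topspace (ctop X0) - A"
proof -
  have "topspace (subtopology (ctop X) Xr) = Xr" by (auto simp: Xr_def)
  then show ?thesis using homeomorphic_imp_surjective_map[OF homeo_Xr] by (simp add: Int_absorb1 Diff_subset)
qed

lemma f_open: assumes V: "openin (ctop X) V" "V \<subseteq> Xr" shows "openin (ctop X0) (f ` V)"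
proof -
  have "openin (subtopology (ctop X) Xr) V" using V openin_open_subtopology[OF openin_Xr] by blast
  then have "openin (subtopology (ctop X0) (topspace (ctop X0) - A)) (f ` V)"
    using homeomorphic_imp_open_map[OF homeo_Xr] by (simp add: open_map_def)
  then show ?thesis using openin_open_subtopology[OF openin_A_compl] by blast
qed

definition sinv where "sinv = inv_into Xr f"

lemma sinv_f: "p \<in> Xr \<Longrightarrow> sinv (f p) = p"
  by (simp add: sinv_def inj_Xr)

lemma f_sinv: assumes "q \<in> topspace (ctop X0)" "q \<notin> A" shows "sinv q \<in> Xr" "f (sinv q) = q"
  using assms image_Xr by (metis DiffI f_inv_into_f inv_into_into sinv_def)+

lemma reduced: "reduced_complex_space X"
  using normal by (simp add: normal_complex_space_def)

lemma Hausdorff: "Hausdorff_space (ctop X)" and sheaf: "function_sheaf X"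
  using reduced by (simp_all add: reduced_complex_space_def)

text \<open>Turns chart coordinates of the unknown space \<open>X\<close> into sections of the
  central fibre, where they can be restricted to explicit curves.\<close>

lemma section_transfer:
  assumes V: "openin (ctop X) V" "V \<subseteq> Xr" and h: "h \<in> sections X V"
  shows "h \<circ> sinv \<in> sections X0 (f ` V)"
proof -
  have agree: "h p = (h \<circ> sinv \<circ> f) p" if "p \<in> V" for p using that V sinv_f by auto
  have "h \<circ> sinv \<circ> f \<in> sections X V"
    using sheaf V(1) h agree unfolding function_sheaf_def by blast
  moreover have "{p \<in> topspace (subtopology (ctop X) Xr). f p \<in> f ` V} = V"
    using V inj_Xr openin_subset[OF V(1)] by (auto simp: inj_on_def)
  moreover have "openin (subtopology (ctop X0) (topspace (ctop X0) - A)) (f ` V)"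
    unfolding openin_open_subtopology[OF openin_A_compl] using f_open[OF V] image_mono[OF V(2), of f] image_Xr by simp
  moreover have "\<forall>W g. openin (subtopology (ctop X0) (topspace (ctop X0) - A)) W \<longrightarrow>
        (g \<in> sections X0 W \<longleftrightarrow> g \<circ> f \<in> sections X {p \<in> topspace (subtopology (ctop X) Xr). f p \<in> W})"
    using bihol unfolding biholomorphic_map_def by (simp add: open_subspace_def Xr_eq)
  ultimately show ?thesis by (simp add: o_assoc)
qed

definition s where "s v w u b = sinv (ob (pt v w u b))"

lemma s_Xr: "tri3 v w u \<Longrightarrow> b \<in> Q v w u \<Longrightarrow> s v w u b \<in> Xr"
  and f_s: "tri3 v w u \<Longrightarrow> b \<in> Q v w u \<Longrightarrow> f (s v w u b) = ob (pt v w u b)"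
  using f_sinv pt_X0 by (auto simp: s_def Q_def)

lemma s_continuous:
  assumes t: "tri3 v w u" shows "continuous_map (top_of_set (Q v w u)) (ctop X) (s v w u)"
  unfolding continuous_map
proof (intro conjI allI impI)
  show "s v w u ` topspace (top_of_set (Q v w u)) \<subseteq> XS" using s_Xr[OF t] by (auto simp: Xr_def)
  fix V assume V: "openin (ctop X) V"
  have "openin (ctop X0) (f ` (V \<inter> Xr))" using V openin_Xr by (intro f_open) auto
  then have "open {b. ob (pt v w u b) \<in> f ` (V \<inter> Xr)}" by (rule open_pt[OF t])
  moreover have "{b \<in> Q v w u. s v w u b \<in> V} = Q v w u \<inter> {b. ob (pt v w u b) \<in> f ` (V \<inter> Xr)}"
  proof (intro set_eqI iffI)
    fix b assume "b \<in> {b \<in> Q v w u. s v w u b \<in> V}"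
    then show "b \<in> Q v w u \<inter> {b. ob (pt v w u b) \<in> f ` (V \<inter> Xr)}"
      using s_Xr[OF t] f_s[OF t] by (metis (mono_tags, lifting) IntI image_eqI mem_Collect_eq)
  next
    fix b assume b: "b \<in> Q v w u \<inter> {b. ob (pt v w u b) \<in> f ` (V \<inter> Xr)}"
    then obtain p where "p \<in> V" "p \<in> Xr" "ob (pt v w u b) = f p" by auto
    then show "b \<in> {b \<in> Q v w u. s v w u b \<in> V}" using b by (simp add: s_def sinv_f)
  qed
  ultimately show "openin (top_of_set (Q v w u)) {x \<in> topspace (top_of_set (Q v w u)). s v w u x \<in> V}"
    by (auto simp: openin_open)
qed

definition C where "C k = {p\<in>XS. f p \<in> reg k \<and> f p \<notin> A}"

text \<open>Translation by the cusp lattice carries the vertex of any point over the stratum to the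
  chosen representative \<open>v\<close>, so one connected parameter set covers the whole
  class.\<close>

lemma C_eq_image:
  assumes k: "k \<in> classes" "v \<in> k" and t: "tri3 v w u" shows "C k = s v w u ` Q v w u"
proof (intro set_eqI iffI)
  fix p assume p: "p \<in> C k"
  then obtain y where y: "y \<in> Y0" "f p = ob y" using f_X0 by (auto simp: C_def topspace_X0)
  then obtain v' where v': "v' \<in> k" "min_cone y = {v'}" using p mem_reg[OF k(1)] by (auto simp: C_def)
  have "v \<in> cl v'" using k v' cl_self classes_disjoint by (metis classes_eq rangeI)
  then obtain a where a: "v = v' + M *v a" by (auto simp: mem_cl)
  define y1 where "y1 = act D (M *v a) y"
  have y1: "y1 \<in> Y0" "ob y1 = f p" "min_cone y1 = {v}"
    using y v' Y0_act Y0_toric orbit_act by (auto simp: y1_def min_cone_act a add.commute)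
  obtain b where b: "y1 = pt v w u b" using pt_exists[OF t Y0_toric[OF y1(1)]] y1 by auto
  have "fst b \<noteq> 0" "snd b \<noteq> 0" using y1(3) min_cone_pt[OF t] t by (auto simp: b tri3_def split: if_splits)
  moreover have "p \<in> Xr" using p by (simp add: C_def Xr_def)
  ultimately have "b \<in> Q v w u" "s v w u b = p"
    using y1(2) sinv_f by (auto simp: Q_def b s_def Xr_def)
  then show "p \<in> s v w u ` Q v w u" by blast
next
  fix p assume "p \<in> s v w u ` Q v w u"
  then obtain b where b: "b \<in> Q v w u" "p = s v w u b" by auto
  have "ob (pt v w u b) \<in> reg k"
    unfolding mem_reg[OF k(1) pt_Y0[OF t]] using b k t by (intro bexI[of _ v]) (auto simp: min_cone_pt Q_def)
  then show "p \<in> C k" using b s_Xr[OF t] f_s[OF t] by (auto simp: C_def Xr_def)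
qed

lemma C_connected: assumes k: "k \<in> classes" shows "connectedin (ctop X) (C k)"
proof -
  obtain v where v: "v \<in> k" using k cl_self by (auto simp: classes_eq)
  obtain w u where t: "tri3 v w u" using tri3_exists by blast
  have "connected (Q v w u)" using connected_Q[OF t convex_UNIV open_UNIV] by simp
  then have "connectedin (top_of_set (Q v w u)) (Q v w u)" by (simp add: connectedin_subtopology)
  then show ?thesis using connectedin_continuous_map_image[OF s_continuous[OF t]] C_eq_image[OF k v t] by metis
qed

lemma C_nonempty: assumes k: "k \<in> classes" shows "C k \<noteq> {}"
proof -
  obtain v where v: "v \<in> k" using k cl_self by (auto simp: classes_eq)
  obtain w u where t: "tri3 v w u" using tri3_exists by blast
  show ?thesis using C_eq_image[OF k v t] Q_dense[OF t open_UNIV] by auto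
qed

lemma reg_dense:
  assumes W: "openin (ctop X0) W" "W \<noteq> {}" shows "\<exists>k\<in>classes. W \<inter> reg k \<noteq> {}"
proof -
  obtain q where "q \<in> W" using W(2) by auto
  moreover from this have "q \<in> ob ` Y0" using openin_subset[OF W(1)] topspace_X0 by auto
  ultimately obtain y where y: "y \<in> Y0" "ob y \<in> W" by auto
  obtain \<sigma> x where s: "triangle \<sigma>" "y = tpoint \<sigma> x" using Y0_toric[OF y(1)] by (rule toric_pointsE)
  obtain u0 where u0: "u0 \<in> \<sigma>" "x u0 = 0" using y(1) s tpoint_Y0 by blast
  \<comment> \<open>One vanishing coordinate \<open>u0\<close> is kept, which keeps the curve in the
    central fibre; the others move to \<open>z\<close>, which reaches the open stratum of
    \<open>u0\<close>.\<close>
  define \<gamma> where "\<gamma> = (\<lambda>z u. if u \<noteq> u0 \<and> x u = 0 then z else x u)"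
  have Y: "tpoint \<sigma> (\<gamma> z) \<in> Y0" for z using tpoint_Y0[OF s(1)] u0 by (auto simp: \<gamma>_def)
  have cont: "continuous_on UNIV \<gamma>"
  proof (rule continuous_on_coordinatewise_then_product)
    show "continuous_on UNIV (\<lambda>z. \<gamma> z i)" for i
      by (cases "i = u0"; cases "x i = 0") (simp_all add: \<gamma>_def)
  qed
  have "open {z\<in>UNIV. ob (tpoint \<sigma> (\<gamma> z)) \<in> W}" by (rule open_curve[OF s(1) open_UNIV cont Y W(1)])
  moreover have "\<gamma> 0 = x" by (auto simp: \<gamma>_def)
  then have "0 \<in> {z\<in>UNIV. ob (tpoint \<sigma> (\<gamma> z)) \<in> W}" using y s by simp
  ultimately obtain e where e: "e > 0" "ball 0 e \<subseteq> {z\<in>UNIV. ob (tpoint \<sigma> (\<gamma> z)) \<in> W}"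
    using open_contains_ball by blast
  define z where "z = complex_of_real (e/2)"
  have z: "z \<noteq> 0" "ob (tpoint \<sigma> (\<gamma> z)) \<in> W" using e by (auto simp: z_def subset_eq)
  have "min_cone (tpoint \<sigma> (\<gamma> z)) = {u0}"
    using u0 z s by (auto simp: min_cone_tpoint triangle_fan \<gamma>_def)
  then have "ob (tpoint \<sigma> (\<gamma> z)) \<in> reg (cl u0)"
    using mem_reg[of "cl u0"] Y cl_self by (auto simp: classes_eq)
  then show ?thesis using z by (auto simp: classes_eq)
qed

lemma C_dense: assumes V: "openin (ctop X) V" "V \<noteq> {}" shows "\<exists>k\<in>classes. V \<inter> C k \<noteq> {}"
proof -
  have "V \<inter> Xr \<noteq> {}"
  proof
    assume e: "V \<inter> Xr = {}"
    have "V \<subseteq> {p \<in> XS. f p \<in> A}" using e openin_subset[OF V(1)] by (auto simp: Xr_def)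
    then show False using interior_of_maximal[OF _ V(1)] nowhere_dense V(2) by blast
  qed
  moreover have "openin (ctop X0) (f ` (V \<inter> Xr))" using V openin_Xr by (intro f_open) auto
  ultimately obtain k where k: "k \<in> classes" "f ` (V \<inter> Xr) \<inter> reg k \<noteq> {}"
    using reg_dense[of "f ` (V \<inter> Xr)"] by auto
  then have "V \<inter> C k \<noteq> {}" by (auto simp: C_def Xr_def)
  then show ?thesis using k by blast
qed

end

section \<open>Extension of the inverse to the double curves\<close>

lemma Hausdorff_finite_disjoint_neighbourhoods:
  assumes H: "Hausdorff_space T" and P: "finite P" "P \<subseteq> topspace T"
    and V: "\<And>p. p \<in> P \<Longrightarrow> openin T (V p) \<and> p \<in> V p"
  obtains U where "\<And>p. p \<in> P \<Longrightarrow> openin T (U p) \<and> p \<in> U p \<and> U p \<subseteq> V p"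
    "\<And>p q. p \<in> P \<Longrightarrow> q \<in> P \<Longrightarrow> p \<noteq> q \<Longrightarrow> U p \<inter> U q = {}"
proof -
  have "\<exists>A B. openin T A \<and> openin T B \<and> p \<in> A \<and> q \<in> B \<and> A \<inter> B = {}" if "p \<in> P" "q \<in> P" "p \<noteq> q" for p q
    using H that P(2) unfolding Hausdorff_space_def disjnt_def by blast
  then obtain A B where AB: "\<And>p q. p \<in> P \<Longrightarrow> q \<in> P \<Longrightarrow> p \<noteq> q \<Longrightarrow>
      openin T (A p q) \<and> openin T (B p q) \<and> p \<in> A p q \<and> q \<in> B p q \<and> A p q \<inter> B p q = {}" by metis
  \<comment> \<open>The separating sets chosen for \<open>(p, q)\<close> need not match those for
    \<open>(q, p)\<close>, so both choices are intersected.\<close>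
  define U where "U = (\<lambda>p. V p \<inter> (topspace T \<inter> (\<Inter>q\<in>P - {p}. A p q \<inter> B q p)))"
  have "openin T (U p) \<and> p \<in> U p \<and> U p \<subseteq> V p" if p: "p \<in> P" for p
  proof -
    have "openin T (topspace T \<inter> (\<Inter>q\<in>P - {p}. A p q \<inter> B q p))"
    proof (rule openin_Int_Inter)
      show "finite ((\<lambda>q. A p q \<inter> B q p) ` (P - {p}))" using P by simp
    qed (use AB p in auto)
    then have "openin T (U p)" unfolding U_def by (rule openin_Int[OF conjunct1[OF V[OF p]]])
    moreover have "p \<in> U p" using V[OF p] AB p P by (auto simp: U_def)
    moreover have "U p \<subseteq> V p" by (auto simp: U_def)
    ultimately show ?thesis by blast
  qed
  moreover have "U p \<inter> U q = {}" if "p \<in> P" "q \<in> P" "p \<noteq> q" for p q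
    using AB[OF that] that by (auto simp: U_def)
  ultimately show ?thesis by (rule that)
qed

context normalized_fibre
begin

definition fib where "fib q = {p\<in>XS. f p = q}"

text \<open>The part of \<open>X\<close> outside neighbourhoods of the fibre is closed, and so is
  its image, which misses \<open>q\<close>. Points over the complement of that image lie in the
  neighbourhoods.\<close>

lemma fibre_cover:
  assumes q: "q \<in> topspace (ctop X0)" and V: "\<forall>p\<in>fib q. openin (ctop X) (V p) \<and> p \<in> V p"
  shows "\<exists>U W. (\<forall>p\<in>fib q. openin (ctop X) (U p) \<and> p \<in> U p \<and> U p \<subseteq> V p) \<and>
    (\<forall>p\<in>fib q. \<forall>p'\<in>fib q. p \<noteq> p' \<longrightarrow> U p \<inter> U p' = {}) \<and>
    openin (ctop X0) W \<and> q \<in> W \<and> (\<forall>p\<in>XS. f p \<in> W \<longrightarrow> (\<exists>p'\<in>fib q. p \<in> U p'))"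
proof -
  obtain U where U: "\<And>p. p \<in> fib q \<Longrightarrow> openin (ctop X) (U p) \<and> p \<in> U p \<and> U p \<subseteq> V p"
    "\<And>p p'. p \<in> fib q \<Longrightarrow> p' \<in> fib q \<Longrightarrow> p \<noteq> p' \<Longrightarrow> U p \<inter> U p' = {}"
    using Hausdorff_finite_disjoint_neighbourhoods[OF Hausdorff, of "fib q" V] f_finite[OF q] V
    by (auto simp: fib_def)
  define W where "W = topspace (ctop X0) - f ` (XS - \<Union>(U ` fib q))"
  have "openin (ctop X) (\<Union>(U ` fib q))" using U(1) by (intro openin_Union) auto
  then have "closedin (ctop X) (XS - \<Union>(U ` fib q))" by blast
  then have "closedin (ctop X0) (f ` (XS - \<Union>(U ` fib q)))" using f_closed by (simp add: closed_map_def)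
  then have "openin (ctop X0) W" unfolding W_def by blast
  moreover have "q \<in> W" using q U(1) by (auto simp: W_def fib_def)
  moreover have "\<exists>p'\<in>fib q. p \<in> U p'" if "p \<in> XS" "f p \<in> W" for p using that by (auto simp: W_def)
  ultimately show ?thesis using U by (intro exI[of _ U] exI[of _ W]) blast
qed

text \<open>The image of a connected set under \<open>s\<close> cannot be divided among disjoint
  open sets; density of \<open>Q\<close> provides one point to start from.\<close>

lemma s_selects:
  assumes t: "tri3 v w u" and H: "convex H" "open H" "H \<noteq> {}"
    and U: "\<And>p. p \<in> P \<Longrightarrow> openin (ctop X) (U p)" "\<And>p p'. p \<in> P \<Longrightarrow> p' \<in> P \<Longrightarrow> p \<noteq> p' \<Longrightarrow> U p \<inter> U p' = {}"
    and cover: "\<And>b. b \<in> H \<inter> Q v w u \<Longrightarrow> \<exists>p\<in>P. s v w u b \<in> U p"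
  shows "\<exists>p\<in>P. \<forall>b\<in>H \<inter> Q v w u. s v w u b \<in> U p"
proof -
  obtain b0 where b0: "b0 \<in> H \<inter> Q v w u" using Q_dense[OF t H(2,3)] by blast
  obtain p where p: "p \<in> P" "s v w u b0 \<in> U p" using cover[OF b0] by blast
  define S where "S = s v w u ` (H \<inter> Q v w u)"
  have "connectedin (top_of_set (Q v w u)) (H \<inter> Q v w u)"
    using connected_Q[OF t H(1,2)] by (simp add: connectedin_subtopology)
  then have "connectedin (ctop X) S" unfolding S_def
    by (rule connectedin_continuous_map_image[OF s_continuous[OF t]])
  moreover have "openin (ctop X) (\<Union>(U ` (P - {p})))" using U(1) by (intro openin_Union) auto
  moreover have "S \<subseteq> U p \<union> \<Union>(U ` (P - {p}))" using cover by (auto simp: S_def)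
  moreover have "U p \<inter> \<Union>(U ` (P - {p})) \<inter> S = {}" using U(2) p(1) by blast
  moreover have "U p \<inter> S \<noteq> {}" using b0 p(2) by (auto simp: S_def)
  ultimately have "\<Union>(U ` (P - {p})) \<inter> S = {}" using U(1)[OF p(1)] connectedinD by metis
  then have "s v w u b \<in> U p" if "b \<in> H \<inter> Q v w u" for b
    using cover[OF that] that by (auto simp: S_def)
  then show ?thesis using p(1) by blast
qed

text \<open>The inverse \<open>s\<close> is only defined off \<open>A\<close>. The sets \<open>ball b e \<inter> Q v w u\<close> are connected, so close to
  \<open>b\<close> the values of \<open>s\<close> stay near a single one of the finitely many points over \<open>b\<close>.\<close>

lemma Phi_exists:
  assumes t: "tri3 v w u"
  shows "\<exists>p\<in>fib (ob (pt v w u b)). \<forall>V. openin (ctop X) V \<longrightarrow> p \<in> V \<longrightarrow>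
    (\<exists>e>0. \<forall>b'\<in>ball b e \<inter> Q v w u. s v w u b' \<in> V)"
proof (rule ccontr)
  let ?q = "ob (pt v w u b)"
  assume "\<not> ?thesis"
  \<comment> \<open>Every point of the finite fibre would have a neighbourhood defeating it.
    Shrinking them all at once to disjoint sets lets \<open>s_selects\<close> pick one that succeeds
    on a small ball.\<close>
  then have "\<forall>p\<in>fib ?q. \<exists>V. openin (ctop X) V \<and> p \<in> V \<and> \<not> (\<exists>e>0. \<forall>b'\<in>ball b e \<inter> Q v w u. s v w u b' \<in> V)"
    by blast
  then obtain V where V: "\<And>p. p \<in> fib ?q \<Longrightarrow> openin (ctop X) (V p) \<and> p \<in> V p"
    "\<And>p. p \<in> fib ?q \<Longrightarrow> \<not> (\<exists>e>0. \<forall>b'\<in>ball b e \<inter> Q v w u. s v w u b' \<in> V p)" by metis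
  have "\<forall>p\<in>fib ?q. openin (ctop X) (V p) \<and> p \<in> V p" using V(1) by blast
  from fibre_cover[OF pt_X0[OF t] this]
  obtain U W where UW: "\<forall>p\<in>fib ?q. openin (ctop X) (U p) \<and> p \<in> U p \<and> U p \<subseteq> V p"
    "\<forall>p\<in>fib ?q. \<forall>p'\<in>fib ?q. p \<noteq> p' \<longrightarrow> U p \<inter> U p' = {}"
    "openin (ctop X0) W" "?q \<in> W" "\<forall>p\<in>XS. f p \<in> W \<longrightarrow> (\<exists>p'\<in>fib ?q. p \<in> U p')"
    by (elim exE conjE)
  note U = bspec[OF UW(1)] UW(2)[rule_format] and W = UW(3,4) UW(5)[rule_format]
  obtain e where e: "e > 0" "ball b e \<subseteq> {b. ob (pt v w u b) \<in> W}"
    using open_pt[OF t W(1)] W(2) open_contains_ball by blast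
  have "\<exists>p\<in>fib ?q. s v w u b' \<in> U p" if b': "b' \<in> ball b e \<inter> Q v w u" for b'
    using W(3)[of "s v w u b'"] s_Xr[OF t] f_s[OF t] e(2) b' by (auto simp: Xr_def)
  then have "\<exists>p\<in>fib ?q. \<forall>b'\<in>ball b e \<inter> Q v w u. s v w u b' \<in> U p"
    using e(1) U by (intro s_selects[OF t convex_ball open_ball]) auto
  then obtain p where "p \<in> fib ?q" "\<forall>b'\<in>ball b e \<inter> Q v w u. s v w u b' \<in> U p" by blast
  then show False using V(2) U(1) e(1) by (meson subsetD)
qed

text \<open>The limit of \<open>s\<close> along \<open>Q v w u\<close>: it extends the inverse over
  the whole plane, across \<open>A\<close> and across the coordinate axes.\<close>

definition Phi where "Phi v w u b = (SOME p. p \<in> fib (ob (pt v w u b)) \<and> (\<forall>V. openin (ctop X) V \<longrightarrow> p \<in> V \<longrightarrow>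
    (\<exists>e>0. \<forall>b'\<in>ball b e \<inter> Q v w u. s v w u b' \<in> V)))"

lemma Phi:
  assumes t: "tri3 v w u"
  shows "Phi v w u b \<in> XS" "f (Phi v w u b) = ob (pt v w u b)"
    "\<And>V. openin (ctop X) V \<Longrightarrow> Phi v w u b \<in> V \<Longrightarrow> \<exists>e>0. \<forall>b'\<in>ball b e \<inter> Q v w u. s v w u b' \<in> V"
proof -
  have "Phi v w u b \<in> fib (ob (pt v w u b)) \<and> (\<forall>V. openin (ctop X) V \<longrightarrow> Phi v w u b \<in> V \<longrightarrow>
    (\<exists>e>0. \<forall>b'\<in>ball b e \<inter> Q v w u. s v w u b' \<in> V))"
    unfolding Phi_def by (rule someI_ex) (use Phi_exists[OF t] in blast)
  then show "Phi v w u b \<in> XS" "f (Phi v w u b) = ob (pt v w u b)"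
    "\<And>V. openin (ctop X) V \<Longrightarrow> Phi v w u b \<in> V \<Longrightarrow> \<exists>e>0. \<forall>b'\<in>ball b e \<inter> Q v w u. s v w u b' \<in> V"
    by (auto simp: fib_def)
qed

lemma Phi_Q: assumes t: "tri3 v w u" and b: "b \<in> Q v w u" shows "Phi v w u b = s v w u b"
proof -
  have "Phi v w u b \<in> Xr" using Phi(1,2)[OF t] b by (auto simp: Xr_def Q_def)
  then show ?thesis using sinv_f Phi(2)[OF t] by (metis s_def)
qed

text \<open>A nearby value lies in one of the disjoint neighbourhoods of the fibre over
  \<open>b\<close>. Density of \<open>Q\<close> gives a point close to \<open>b'\<close> and to
  \<open>b\<close> at which \<open>s\<close> lies both there and in the neighbourhood of
  \<open>Phi v w u b\<close>, so the two coincide.\<close>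

lemma Phi_continuous:
  assumes t: "tri3 v w u" and V: "openin (ctop X) V" shows "open {b. Phi v w u b \<in> V}"
  unfolding open_contains_ball
proof
  fix b assume "b \<in> {b. Phi v w u b \<in> V}"
  then have b: "Phi v w u b \<in> V" by simp
  let ?q = "ob (pt v w u b)" and ?p = "Phi v w u b"
  have p0: "?p \<in> fib ?q" using Phi[OF t] by (simp add: fib_def)
  \<comment> \<open>Only the value at \<open>b\<close> itself has to be confined to
    \<open>V\<close>; the other points of the fibre get the whole space.\<close>
  define V' where "V' = (\<lambda>p. if p = ?p then V else XS)"
  have V': "openin (ctop X) (V' p) \<and> p \<in> V' p" if "p \<in> fib ?q" for p
    using that V b by (auto simp: V'_def fib_def)
  have "\<forall>p\<in>fib ?q. openin (ctop X) (V' p) \<and> p \<in> V' p" using V' by blast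
  from fibre_cover[OF pt_X0[OF t] this]
  obtain U W where UW: "\<forall>p\<in>fib ?q. openin (ctop X) (U p) \<and> p \<in> U p \<and> U p \<subseteq> V' p"
    "\<forall>p\<in>fib ?q. \<forall>p'\<in>fib ?q. p \<noteq> p' \<longrightarrow> U p \<inter> U p' = {}"
    "openin (ctop X0) W" "?q \<in> W" "\<forall>p\<in>XS. f p \<in> W \<longrightarrow> (\<exists>p'\<in>fib ?q. p \<in> U p')"
    by (elim exE conjE)
  note U = bspec[OF UW(1)] UW(2)[rule_format] and W = UW(3,4) UW(5)[rule_format]
  obtain e1 where e1: "e1 > 0" "ball b e1 \<subseteq> {b. ob (pt v w u b) \<in> W}"
    using open_pt[OF t W(1)] W(2) open_contains_ball by blast
  have "openin (ctop X) (U ?p)" "?p \<in> U ?p" using U(1)[OF p0] by auto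
  from Phi(3)[OF t this] obtain e2 where e2: "e2 > 0" "\<And>b'. b' \<in> ball b e2 \<inter> Q v w u \<Longrightarrow> s v w u b' \<in> U ?p" by blast
  define e where "e = min e1 e2"
  have "Phi v w u b' \<in> V" if b': "b' \<in> ball b e" for b'
  proof -
    have "f (Phi v w u b') \<in> W" using b' e1(2) Phi(2)[OF t] by (auto simp: e_def)
    then obtain p where p: "p \<in> fib ?q" "Phi v w u b' \<in> U p" using W(3) Phi(1)[OF t] by blast
    have "openin (ctop X) (U p)" using U(1) p(1) by blast
    from Phi(3)[OF t this p(2)] obtain e' where e': "e' > 0" "\<And>b''. b'' \<in> ball b' e' \<inter> Q v w u \<Longrightarrow> s v w u b'' \<in> U p" by blast
    have "b' \<in> ball b' e' \<inter> ball b e" using b' e'(1) by simp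
    then have "ball b' e' \<inter> ball b e \<noteq> {}" by blast
    then have "(ball b' e' \<inter> ball b e) \<inter> Q v w u \<noteq> {}" by (rule Q_dense[OF t open_Int[OF open_ball open_ball]])
    then obtain b'' where "b'' \<in> ball b' e'" "b'' \<in> ball b e" "b'' \<in> Q v w u" by blast
    then have "s v w u b'' \<in> U p \<inter> U ?p" using e'(2) e2(2) by (auto simp: e_def)
    then have "p = ?p" using U(2)[OF p(1) p0] by blast
    then show ?thesis using p U(1)[OF p0] by (auto simp: V'_def)
  qed
  then show "\<exists>e>0. ball b e \<subseteq> {b. Phi v w u b \<in> V}" using e1 e2 by (intro exI[of _ e]) (auto simp: e_def)
qed

text \<open>The double curve may lie in \<open>A\<close>; the function is the uniform limit of its values on the
  parallel lines \<open>snd b = \<eta>\<close>, which are holomorphic by removability of singularities.\<close>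

lemma Phi_line_holomorphic:
  assumes t: "tri3 v w u" and ch: "complex_chart X U n G Z c" and \<delta>: "\<delta> > 0"
    and sub: "\<And>\<zeta> \<eta>. dist \<zeta> \<zeta>1 \<le> \<delta> \<Longrightarrow> norm \<eta> \<le> \<delta> \<Longrightarrow> Phi v w u (\<zeta>, \<eta>) \<in> U"
  shows "(\<lambda>\<zeta>. c (Phi v w u (\<zeta>, 0)) j) holomorphic_on ball \<zeta>1 \<delta>"
proof -
  interpret complex_chart X U n G Z c by (rule ch)
  define F where "F = (\<lambda>b. c (Phi v w u b) j)"
  define box where "box = cball \<zeta>1 \<delta> \<times> cball (0::complex) \<delta>"
  have boxU: "Phi v w u b \<in> U" if "b \<in> box" for b using sub[of "fst b" "snd b"] that by (auto simp: box_def dist_commute)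
  have contF: "continuous_on box F"
    unfolding continuous_on_open_invariant
  proof (intro allI impI)
    fix S :: "complex set" assume "open S"
    then have "openin (ctop X) {p\<in>U. c p j \<in> S}"
      by (rule section_open_preimage[OF U order_refl coordinate_section[OF U order_refl]])
    then have "open {b. Phi v w u b \<in> {p\<in>U. c p j \<in> S}}" by (rule Phi_continuous[OF t])
    then show "\<exists>T. open T \<and> T \<inter> box = F -` S \<inter> box" using boxU
      by (intro exI[of _ "{b. Phi v w u b \<in> {p\<in>U. c p j \<in> S}}"]) (auto simp: F_def)
  qed
  have line: "(\<lambda>\<zeta>. F (\<zeta>, \<eta>)) holomorphic_on ball \<zeta>1 \<delta>"
    if \<eta>: "\<eta> \<noteq> 0" "norm \<eta> \<le> \<delta>" and \<zeta>': "\<zeta>' \<in> ball \<zeta>1 \<delta>" "ob (pt v w u (\<zeta>', \<eta>)) \<notin> A" for \<eta> \<zeta>'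
  proof -
    define Z' where "Z' = {\<zeta>\<in>ball \<zeta>1 \<delta>. ob (pt v w u (\<zeta>, \<eta>)) \<in> A}"
    have "locally_analytic_set (ball \<zeta>1 \<delta>) Z'" unfolding Z'_def
      by (rule pt_analytic[OF t open_ball holomorphic_on_ident holomorphic_on_const])
    from locally_analytic_set_cases[OF open_ball convex_connected[OF convex_ball] this]
    have "Z' = ball \<zeta>1 \<delta> \<or> Z' sparse_in ball \<zeta>1 \<delta>" .
    moreover have "\<zeta>' \<notin> Z'" using \<zeta>'(2) by (simp add: Z'_def)
    ultimately have Z': "Z' sparse_in ball \<zeta>1 \<delta>" using \<zeta>'(1) by blast
    have inbox: "(\<zeta>, \<eta>) \<in> box" if "\<zeta> \<in> ball \<zeta>1 \<delta>" for \<zeta> using that \<eta> by (auto simp: box_def)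
    show ?thesis
    proof (rule holomorphic_off_sparse[OF open_ball _ _ Z'])
      show "continuous_on (ball \<zeta>1 \<delta>) (\<lambda>\<zeta>. F (\<zeta>, \<eta>))"
        by (rule continuous_on_compose2[OF contF]) (auto intro!: continuous_intros inbox)
      define h where "h = (\<lambda>p. c p j)"
      have V: "openin (ctop X) (U \<inter> Xr)" using U openin_Xr by (rule openin_Int)
      have h: "h \<in> sections X (U \<inter> Xr)" unfolding h_def by (rule coordinate_section[OF V]) auto
      have sec: "h \<circ> sinv \<in> sections X0 (f ` (U \<inter> Xr))" by (rule section_transfer[OF V _ h]) auto
      have S: "open (ball \<zeta>1 \<delta> - Z')" by (rule open_diff_sparse_pts[OF open_ball Z'])
      have Xr: "Phi v w u (\<zeta>, \<eta>) \<in> U \<inter> Xr" if "\<zeta> \<in> ball \<zeta>1 \<delta> - Z'" for \<zeta>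
        using that boxU[OF inbox] Phi(1,2)[OF t] by (auto simp: Xr_def Z'_def)
      have "(\<lambda>\<zeta>. (h \<circ> sinv) (ob (tpoint {v, w, u} (emb w u (\<zeta>, \<eta>))))) holomorphic_on ball \<zeta>1 \<delta> - Z'"
      proof (rule section_along_curve[OF sec _ S])
        show "triangle {v, w, u}" using t by (simp add: tri3_def)
        show "(\<lambda>\<zeta>. emb w u (\<zeta>, \<eta>) z') holomorphic_on ball \<zeta>1 \<delta> - Z'" for z'
          by (rule emb_holomorphic[OF holomorphic_on_ident holomorphic_on_const])
        show "tpoint {v, w, u} (emb w u (\<zeta>, \<eta>)) \<in> tube \<epsilon>" for \<zeta>
          using pt_Y0[OF t] Y0_tube by (simp add: pt_def)
        show "ob (tpoint {v, w, u} (emb w u (\<zeta>, \<eta>))) \<in> f ` (U \<inter> Xr)" if "\<zeta> \<in> ball \<zeta>1 \<delta> - Z'" for \<zeta>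
          using Xr[OF that] Phi(2)[OF t, of "(\<zeta>, \<eta>)"] by (metis image_eqI pt_def)
      qed
      moreover have "(h \<circ> sinv) (ob (tpoint {v, w, u} (emb w u (\<zeta>, \<eta>)))) = F (\<zeta>, \<eta>)" if "\<zeta> \<in> ball \<zeta>1 \<delta> - Z'" for \<zeta>
        using Xr[OF that] Phi(2)[OF t, of "(\<zeta>, \<eta>)"] sinv_f by (metis F_def IntE comp_apply h_def pt_def)
      ultimately show "(\<lambda>\<zeta>. F (\<zeta>, \<eta>)) holomorphic_on ball \<zeta>1 \<delta> - Z'" by (rule holomorphic_transform)
    qed
  qed
  \<comment> \<open>Particular parallel lines may lie wholly in \<open>A\<close>. Density of
    \<open>Q\<close> yields heights tending to 0 whose lines contain a point off \<open>A\<close>,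
    as the fact \<open>line\<close> requires.\<close>
  have "\<exists>b. b \<in> (ball \<zeta>1 \<delta> \<times> ball (0::complex) (\<delta> / real (Suc m))) \<inter> Q v w u" for m
  proof -
    have "(\<zeta>1, 0) \<in> ball \<zeta>1 \<delta> \<times> ball (0::complex) (\<delta> / real (Suc m))" using \<delta> by simp
    then show ?thesis
      using Q_dense[OF t open_Times[OF open_ball open_ball], of \<zeta>1 \<delta> 0 "\<delta> / real (Suc m)"] by blast
  qed
  then obtain bs where bs: "\<And>m. bs m \<in> (ball \<zeta>1 \<delta> \<times> ball (0::complex) (\<delta> / real (Suc m))) \<inter> Q v w u" by metis
  define \<eta> where "\<eta> = (\<lambda>m. snd (bs m))"
  have \<eta>: "\<eta> m \<noteq> 0" "norm (\<eta> m) < \<delta> / real (Suc m)" for m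
    using bs[of m] by (auto simp: \<eta>_def Q_def mem_Times_iff)
  have le: "\<delta> / real (Suc m) \<le> \<delta>" for m using \<delta> by (simp add: divide_le_eq)
  have \<eta>le: "norm (\<eta> m) \<le> \<delta>" for m using \<eta>(2)[of m] le[of m] by simp
  have hol: "(\<lambda>\<zeta>. F (\<zeta>, \<eta> m)) holomorphic_on ball \<zeta>1 \<delta>" for m
    by (rule line[OF \<eta>(1) \<eta>le, of "fst (bs m)"]) (use bs[of m] in \<open>auto simp: \<eta>_def Q_def mem_Times_iff\<close>)
  have "compact box" unfolding box_def by (intro compact_Times) auto
  then have uc: "uniformly_continuous_on box F" using contF compact_uniformly_continuous by blast
  have unif: "uniform_limit (ball \<zeta>1 \<delta>) (\<lambda>m \<zeta>. F (\<zeta>, \<eta> m)) (\<lambda>\<zeta>. F (\<zeta>, 0)) sequentially"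
    unfolding uniform_limit_iff
  proof (intro allI impI)
    fix e :: real assume "e > 0"
    then obtain d where d: "d > 0" "\<And>b b'. b \<in> box \<Longrightarrow> b' \<in> box \<Longrightarrow> dist b' b < d \<Longrightarrow> dist (F b') (F b) < e"
      using uc unfolding uniformly_continuous_on_def by metis
    have "(\<lambda>m. \<delta> / real (Suc m)) \<longlonglongrightarrow> 0" by (rule lim_const_over_n[THEN LIMSEQ_Suc])
    then have "\<forall>\<^sub>F m in sequentially. \<delta> / real (Suc m) < d" using d(1) by (rule order_tendstoD)
    then show "\<forall>\<^sub>F m in sequentially. \<forall>\<zeta>\<in>ball \<zeta>1 \<delta>. dist (F (\<zeta>, \<eta> m)) (F (\<zeta>, 0)) < e"
    proof eventually_elim
      case (elim m)
      have "dist (\<zeta>, \<eta> m) (\<zeta>, 0) < d" for \<zeta> :: complex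
        using \<eta>(2)[of m] elim by (simp add: dist_Pair_Pair)
      then show ?case using d(2) \<eta>le \<delta> by (auto simp: box_def)
    qed
  qed
  have "(\<lambda>\<zeta>. F (\<zeta>, 0)) holomorphic_on ball \<zeta>1 \<delta>"
  proof (rule holomorphic_uniform_sequence[OF open_ball hol])
    fix x assume "x \<in> ball \<zeta>1 \<delta>"
    then obtain d where "d > 0" "cball x d \<subseteq> ball \<zeta>1 \<delta>"
      using open_ball unfolding open_contains_cball by metis
    then show "\<exists>d. 0 < d \<and> cball x d \<subseteq> ball \<zeta>1 \<delta> \<and> uniform_limit (cball x d) (\<lambda>m \<zeta>. F (\<zeta>, \<eta> m)) (\<lambda>\<zeta>. F (\<zeta>, 0)) sequentially"
      using uniform_limit_on_subset[OF unif] by blast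
  qed
  then show ?thesis by (simp add: F_def)
qed

end

section \<open>The closures of the strata are disjoint\<close>

lemma triangle_third:
  assumes "triangle \<sigma>" "v \<in> \<sigma>" "w \<in> \<sigma>" "v \<noteq> w"
  obtains u where "\<sigma> = {v, w, u}" "u \<noteq> v" "u \<noteq> w"
proof -
  have "card (\<sigma> - {v, w}) = 1"
    using triangle_card[OF assms(1)] triangle_finite[OF assms(1)] assms by (simp add: card_Diff_subset)
  then obtain u where "\<sigma> - {v, w} = {u}" by (rule card_1_singletonE)
  then show ?thesis using that[of u] assms by blast
qed

context normalized_fibre
begin

definition Cc where "Cc k = \<Union>(C ` (classes - {k}))"

definition R where "R k = (ctop X closure_of C k) \<inter> (ctop X closure_of Cc k)"

lemma R_XS: "p \<in> R k \<Longrightarrow> p \<in> XS"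
  using closure_of_subset_topspace[of "ctop X"] by (auto simp: R_def)

lemma R_meets:
  assumes "p \<in> R k" "openin (ctop X) V" "p \<in> V"
  shows "V \<inter> C k \<noteq> {}" "\<exists>k'\<in>classes. k' \<noteq> k \<and> V \<inter> C k' \<noteq> {}"
proof -
  have meet: "\<exists>y. y \<in> E \<and> y \<in> V" if "p \<in> ctop X closure_of E" for E
    using that assms(2,3) by (simp add: in_closure_of)
  show "V \<inter> C k \<noteq> {}" using meet[of "C k"] assms(1) by (auto simp: R_def)
  show "\<exists>k'\<in>classes. k' \<noteq> k \<and> V \<inter> C k' \<noteq> {}"
    using meet[of "Cc k"] assms(1) by (auto simp: R_def Cc_def)
qed

lemma closure_cover:
  assumes "k \<in> classes" shows "(ctop X closure_of C k) \<union> (ctop X closure_of Cc k) = XS"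
proof -
  have "XS \<subseteq> ctop X closure_of (\<Union>(C ` classes))"
  proof
    fix p assume p: "p \<in> XS"
    have "\<exists>y. y \<in> \<Union>(C ` classes) \<and> y \<in> V" if "p \<in> V" "openin (ctop X) V" for V
      using C_dense[OF that(2)] that(1) by blast
    then show "p \<in> ctop X closure_of (\<Union>(C ` classes))" using p by (simp add: in_closure_of)
  qed
  moreover have "\<Union>(C ` classes) = C k \<union> Cc k" using assms by (auto simp: Cc_def)
  ultimately show ?thesis
    using closure_of_subset_topspace[of "ctop X"] by (metis closure_of_Un subset_antisym)
qed

text \<open>The chart of \<open>min_cone y\<close> is a neighbourhood that meets only the open
  strata of vertices of that cone. Strata of \<open>k\<close> and of another class both accumulate
  at \<open>p\<close>, so vertices of both kinds occur.\<close>

lemma R_vertices: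
  assumes k: "k \<in> classes" and p: "p \<in> R k" and y: "y \<in> Y0" "f p = ob y"
  shows "\<exists>v\<in>min_cone y. v \<in> k" "\<exists>w\<in>min_cone y. w \<notin> k"
proof -
  define W where "W = ob ` ({z \<in> toric_points. min_cone z \<subseteq> min_cone y} \<inter> Y0)"
  define V where "V = {p'\<in>XS. f p' \<in> W}"
  have V: "openin (ctop X) V" unfolding V_def W_def
    by (intro openin_f_preimage openin_X0_image openin_min_cone)
  have pV: "p \<in> V" using y Y0_toric R_XS[OF p] by (auto simp: V_def W_def)
  have *: "\<exists>v\<in>min_cone y. v \<in> k'" if k': "k' \<in> classes" and ne: "V \<inter> C k' \<noteq> {}" for k'
  proof -
    obtain p' where p': "p' \<in> V" "p' \<in> C k'" using ne by blast
    then obtain z where z: "z \<in> Y0" "min_cone z \<subseteq> min_cone y" "f p' = ob z" by (auto simp: V_def W_def)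
    then have "\<exists>u\<in>k'. min_cone z = {u}" using p'(2) mem_reg[OF k' z(1)] by (simp add: C_def)
    then show ?thesis using z(2) by auto
  qed
  show "\<exists>v\<in>min_cone y. v \<in> k" using * k R_meets(1)[OF p V pV] by blast
  obtain k' where k': "k' \<in> classes" "k' \<noteq> k" "V \<inter> C k' \<noteq> {}" using R_meets(2)[OF p V pV] by blast
  then show "\<exists>w\<in>min_cone y. w \<notin> k" using *[OF k'(1,3)] classes_disjoint[OF k'(1) k] by blast
qed

lemma R_not_reg:
  assumes k: "k \<in> classes" and p: "p \<in> R k" and k': "k' \<in> classes" shows "f p \<notin> reg k'"
proof
  assume reg: "f p \<in> reg k'"
  obtain y where y: "y \<in> Y0" "f p = ob y" using f_X0[OF R_XS[OF p]] by (auto simp: topspace_X0)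
  then obtain u where "min_cone y = {u}" using reg mem_reg[OF k' y(1)] by auto
  then show False using R_vertices[OF k p y] by auto
qed

lemma R_not_C: "k \<in> classes \<Longrightarrow> p \<in> R k \<Longrightarrow> p \<notin> C k \<union> Cc k"
  using R_not_reg by (auto simp: C_def Cc_def)

text \<open>A point is analytic and lies in no stratum, so if it were all of \<open>R k\<close>
  nearby, \<open>normal_separation\<close> would exclude it too.\<close>

lemma R_not_isolated:
  assumes k: "k \<in> classes" and p: "p \<in> R k" and V: "openin (ctop X) V" "p \<in> V"
  obtains p' where "p' \<in> R k" "p' \<in> V" "p' \<noteq> p"
proof -
  obtain U n G Z c where ch: "complex_chart X U n G Z c" and pU: "p \<in> U"
    using reduced_complex_space_chart[OF reduced R_XS[OF p]] by blast
  interpret complex_chart X U n G Z c by (rule ch)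
  define V' where "V' = V \<inter> U"
  have V': "openin (ctop X) V'" "V' \<subseteq> U" "p \<in> V'" using V pU U by (auto simp: V'_def)
  \<comment> \<open>The point \<open>p\<close> as a graph with constant functions; the index
    \<open>i = 0\<close> below is then a dummy.\<close>
  define T where "T = {q\<in>V'. \<forall>j<n. c q j = c p j}"
  have "T \<subseteq> {p}"
  proof
    fix q assume q: "q \<in> T"
    have "c q = c p"
    proof
      fix j show "c q j = c p j"
        using q V' mem_Cn[of q] mem_Cn[OF pU] by (cases "j < n") (auto simp: T_def Cn_def)
    qed
    then show "q \<in> {p}" using inj q V' pU by (auto simp: T_def inj_on_def)
  qed
  moreover have an: "analytic_subset (open_subspace X V') T"
    unfolding T_def by (rule graph_analytic[OF V'(1,2) open_UNIV, where g = "\<lambda>j _. c p j" and i = 0]) auto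
  ultimately have "T \<inter> (C k \<union> Cc k) = {}" using R_not_C[OF k p] by blast
  from normal_separation[OF normal closure_cover[OF k] V'(1,2) an this]
  have "\<not> R k \<inter> V' \<subseteq> T" using p V'(3) unfolding R_def by blast
  moreover have "p \<in> T" using V'(3) by (simp add: T_def)
  ultimately show ?thesis using that by (auto simp: V'_def)
qed

lemma R_point:
  assumes k: "k \<in> classes" and p: "p \<in> R k" and y: "y \<in> Y0" "f p = ob y"
  obtains v w u b where "tri3 v w u" "v \<in> k" "w \<notin> k" "y = pt v w u b" "snd b = 0"
proof -
  obtain \<sigma> x where s: "triangle \<sigma>" "y = tpoint \<sigma> x" using Y0_toric[OF y(1)] by (rule toric_pointsE)
  obtain v w where vw: "v \<in> \<sigma>" "x v = 0" "v \<in> k" "w \<in> \<sigma>" "x w = 0" "w \<notin> k"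
    using R_vertices[OF k p y] s by (auto simp: min_cone_tpoint triangle_fan)
  then obtain u where u: "\<sigma> = {v, w, u}" "u \<noteq> v" "u \<noteq> w" using triangle_third[OF s(1)] by metis
  have t: "tri3 v w u" using s u vw by (auto simp: tri3_def)
  then have "y = pt v w u (x u, x w)" using tpoint_pt vw s u by simp
  then show ?thesis using that t vw by simp
qed

text \<open>If the given point lies over a triple point, another point of \<open>R k\<close> is
  taken so close that it cannot lie over a triple point again.\<close>

lemma R_edge:
  assumes k: "k \<in> classes" and ne: "R k \<noteq> {}"
  obtains p v w u \<zeta> where "p \<in> R k" "tri3 v w u" "v \<in> k" "w \<notin> k" "\<zeta> \<noteq> 0" "f p = ob (pt v w u (\<zeta>, 0))"
proof -
  obtain p where p: "p \<in> R k" using ne by blast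
  obtain y where y: "y \<in> Y0" "f p = ob y" using f_X0[OF R_XS[OF p]] by (auto simp: topspace_X0)
  obtain v w u b where b: "tri3 v w u" "v \<in> k" "w \<notin> k" "y = pt v w u b" "snd b = 0" using R_point[OF k p y] .
  show ?thesis
  proof (cases "fst b = 0")
    case False
    then show ?thesis using that[OF p b(1-3), of "fst b"] y b by (metis prod.collapse)
  next
    case True
    have \<sigma>: "triangle {v, w, u}" using b by (simp add: tri3_def)
    define W where "W = ob ` ({z \<in> toric_points. min_cone z \<subseteq> {v, w, u}} \<inter> Y0)"
    \<comment> \<open>Besides shrinking to the chart of the triangle, the finitely many other points
      over \<open>f p\<close> are removed.\<close>
    define V where "V = {p'\<in>XS. f p' \<in> W} - (fib (f p) - {p})"
    have "finite (fib (f p))" using f_finite[OF f_X0[OF R_XS[OF p]]] by (simp add: fib_def)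
    then have "closedin (ctop X) (fib (f p) - {p})"
      using Hausdorff_imp_t1_space[OF Hausdorff] unfolding t1_space_closedin_finite by (auto simp: fib_def)
    moreover have "openin (ctop X) {p'\<in>XS. f p' \<in> W}" unfolding W_def
      by (intro openin_f_preimage openin_X0_image openin_min_cone)
    ultimately have V: "openin (ctop X) V" unfolding V_def by (rule openin_diff[rotated])
    have "min_cone y \<subseteq> {v, w, u}" using min_cone_pt[OF b(1)] by (auto simp: b(4))
    then have "p \<in> V" using y Y0_toric R_XS[OF p] by (auto simp: V_def W_def)
    from R_not_isolated[OF k p V this] obtain p' where p': "p' \<in> R k" "p' \<in> V" "p' \<noteq> p" .
    obtain y' where y': "y' \<in> Y0" "min_cone y' \<subseteq> {v, w, u}" "f p' = ob y'" using p'(2) by (auto simp: V_def W_def)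
    obtain v1 w1 u1 b1 where b1: "tri3 v1 w1 u1" "v1 \<in> k" "w1 \<notin> k" "y' = pt v1 w1 u1 b1" "snd b1 = 0"
      using R_point[OF k p'(1) y'(1,3)] .
    show ?thesis
    proof (cases "fst b1 = 0")
      case False
      then show ?thesis using that[OF p'(1) b1(1-3), of "fst b1"] y' b1 by (metis prod.collapse)
    next
      case T1: True
      \<comment> \<open>A second triple point in this chart has the same cone by counting vertices.
        The chart contains only one such point, so \<open>p'\<close> would lie over
        \<open>f p\<close>, which \<open>V\<close> excludes.\<close>
      have m1: "min_cone y' = {v1, w1, u1}" using min_cone_pt[OF b1(1)] T1 b1(4,5) by auto
      have "card {v1, w1, u1} = card {v, w, u}" using triangle_card \<sigma> b1(1) by (simp only: tri3_def)
      then have eq: "min_cone y' = {v, w, u}" using y'(2) m1 by (metis card_subset_eq finite.emptyI finite.insertI)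
      obtain b2 where b2: "y' = pt v w u b2" using pt_exists[OF b(1) Y0_toric[OF y'(1)]] eq by auto
      have "fst b2 = 0" "snd b2 = 0" using eq min_cone_pt[OF b(1), of b2] b(1) by (auto simp: b2 tri3_def split: if_splits)
      then have "y' = y" using True b(4,5) b2 by (metis prod.collapse)
      then have "p' \<in> fib (f p)" using y y' R_XS[OF p'(1)] by (simp add: fib_def)
      then show ?thesis using p' by (simp add: V_def)
    qed
  qed
qed

text \<open>Where \<open>x\<^sub>u\<close> is nonzero the chart sees only the components
  \<open>v\<close> and \<open>w\<close>. If \<open>w\<close> is not in \<open>k\<close>, points of
  stratum \<open>k\<close> must have \<open>x\<^sub>v = 0\<close>, and points under
  \<open>R k\<close> lie on both components.\<close>

lemma edge_neighbourhood:
  assumes t: "tri3 v w u" and B: "open B" "\<And>b. b \<in> B \<Longrightarrow> fst b \<noteq> 0"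
  defines "W \<equiv> ob ` (tpoint {v, w, u} ` {x. (x u, x w) \<in> B} \<inter> Y0)"
  shows "openin (ctop X0) W" "b \<in> B \<Longrightarrow> ob (pt v w u b) \<in> W"
    "k \<in> classes \<Longrightarrow> w \<notin> k \<Longrightarrow> q \<in> W \<Longrightarrow> q \<in> reg k \<Longrightarrow> \<exists>b\<in>B. snd b \<noteq> 0 \<and> q = ob (pt v w u b)"
    "k \<in> classes \<Longrightarrow> p \<in> R k \<Longrightarrow> f p \<in> W \<Longrightarrow> \<exists>\<zeta>. (\<zeta>, 0) \<in> B \<and> f p = ob (pt v w u (\<zeta>, 0))"
proof -
  have \<sigma>: "triangle {v, w, u}" using t by (simp add: tri3_def)
  have "continuous_on UNIV (\<lambda>x :: int^2 \<Rightarrow> complex. (x u, x w))"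
    by (intro continuous_on_Pair continuous_on_coordinate)
  then have "open {x :: int^2 \<Rightarrow> complex. (x u, x w) \<in> B}"
    using continuous_open_preimage[of UNIV "\<lambda>x :: int^2 \<Rightarrow> complex. (x u, x w)" B] B(1) by (simp add: vimage_def)
  then show "openin (ctop X0) W" unfolding W_def by (intro openin_X0_image openin_tpoint_image \<sigma>)
  show "ob (pt v w u b) \<in> W" if "b \<in> B"
  proof -
    have "emb w u b \<in> {x. (x u, x w) \<in> B}" using that t by (auto simp: emb_def tri3_def)
    then show ?thesis using pt_Y0[OF t, of b] unfolding W_def pt_def by blast
  qed
  show "\<exists>b\<in>B. snd b \<noteq> 0 \<and> q = ob (pt v w u b)" if k: "k \<in> classes" "w \<notin> k" and q: "q \<in> W" "q \<in> reg k"
  proof -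
    obtain x where x: "(x u, x w) \<in> B" "tpoint {v, w, u} x \<in> Y0" "q = ob (tpoint {v, w, u} x)"
      using q(1) by (auto simp: W_def)
    obtain u' where u': "u' \<in> k" "min_cone (tpoint {v, w, u} x) = {u'}" using q(2) mem_reg[OF k(1) x(2)] x(3) by auto
    have mc: "min_cone (tpoint {v, w, u} x) = {z\<in>{v, w, u}. x z = 0}" by (simp add: min_cone_tpoint triangle_fan \<sigma>)
    have "x u \<noteq> 0" using B(2)[OF x(1)] by simp
    moreover have "x w \<noteq> 0"
    proof
      assume "x w = 0"
      then have "w \<in> min_cone (tpoint {v, w, u} x)" using mc by simp
      then show False using u' k(2) by simp
    qed
    moreover have "u' \<in> {z\<in>{v, w, u}. x z = 0}" unfolding mc[symmetric] u'(2) by simp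
    ultimately have "x v = 0" by fastforce
    then have "q = ob (pt v w u (x u, x w))" using tpoint_pt[OF t] x(3) by simp
    then show ?thesis using x(1) \<open>x w \<noteq> 0\<close> by (intro bexI[of _ "(x u, x w)"]) auto
  qed
  show "\<exists>\<zeta>. (\<zeta>, 0) \<in> B \<and> f p = ob (pt v w u (\<zeta>, 0))" if k: "k \<in> classes" and p: "p \<in> R k" "f p \<in> W"
  proof -
    obtain x where x: "(x u, x w) \<in> B" "tpoint {v, w, u} x \<in> Y0" "f p = ob (tpoint {v, w, u} x)"
      using p(2) by (auto simp: W_def)
    have mc: "min_cone (tpoint {v, w, u} x) = {z\<in>{v, w, u}. x z = 0}" by (simp add: min_cone_tpoint triangle_fan \<sigma>)
    have "x u \<noteq> 0" using B(2)[OF x(1)] by simp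
    moreover obtain v1 w1 where "v1 \<in> {z\<in>{v, w, u}. x z = 0}" "v1 \<in> k" "w1 \<in> {z\<in>{v, w, u}. x z = 0}" "w1 \<notin> k"
      using R_vertices[OF k p(1) x(2,3)] unfolding mc by blast
    ultimately have "x v = 0" "x w = 0" by fastforce+
    then show ?thesis using tpoint_pt[OF t, of x] x by (intro exI[of _ "x u"]) auto
  qed
qed

text \<open>Since \<open>w\<close> is not in \<open>k\<close>, the stratum \<open>k\<close> reaches
  the double curve from the side of \<open>v\<close> only. Points of \<open>C k\<close> near
  \<open>p\<close> are thus values of \<open>Phi\<close> near \<open>(\<zeta>, 0)\<close>, and
  Hausdorff separation forces equality.\<close>

lemma R_Phi:
  assumes k: "k \<in> classes" and t: "tri3 v w u" and w: "w \<notin> k"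
    and p: "p \<in> R k" "f p = ob (pt v w u (\<zeta>, 0))" and \<zeta>: "\<zeta> \<noteq> 0"
  shows "p = Phi v w u (\<zeta>, 0)"
proof (rule ccontr)
  assume "p \<noteq> Phi v w u (\<zeta>, 0)"
  then obtain V1 V2 where V: "openin (ctop X) V1" "openin (ctop X) V2" "p \<in> V1" "Phi v w u (\<zeta>, 0) \<in> V2" "V1 \<inter> V2 = {}"
    using Hausdorff R_XS[OF p(1)] Phi(1)[OF t] unfolding Hausdorff_space_def disjnt_def by metis
  define B where "B = {b. Phi v w u b \<in> V2} \<inter> {b. fst b \<noteq> 0}"
  have B: "open B" unfolding B_def
    by (intro open_Int Phi_continuous[OF t V(2)] open_Collect_neq continuous_intros)
  have fB: "fst b \<noteq> 0" if "b \<in> B" for b using that by (simp add: B_def)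
  note nb = edge_neighbourhood[OF t B fB]
  have bB: "(\<zeta>, 0) \<in> B" using V \<zeta> by (simp add: B_def)
  have op: "openin (ctop X) (V1 \<inter> {p'\<in>XS. f p' \<in> ob ` (tpoint {v, w, u} ` {x. (x u, x w) \<in> B} \<inter> Y0)})"
    by (rule openin_Int[OF V(1) openin_f_preimage[OF nb(1)]])
  have "p \<in> V1 \<inter> {p'\<in>XS. f p' \<in> ob ` (tpoint {v, w, u} ` {x. (x u, x w) \<in> B} \<inter> Y0)}"
    using V(3) R_XS[OF p(1)] nb(2)[OF _ bB] p(2) by simp
  from R_meets(1)[OF p(1) op this] obtain p' where p': "p' \<in> V1" "p' \<in> XS" "f p' \<in> ob ` (tpoint {v, w, u} ` {x. (x u, x w) \<in> B} \<inter> Y0)" "p' \<in> C k"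
    by blast
  then have "f p' \<in> reg k" by (simp add: C_def)
  then obtain b where b: "b \<in> B" "snd b \<noteq> 0" "f p' = ob (pt v w u b)" using nb(3)[OF _ k w p'(3)] by blast
  then have "b \<in> Q v w u" using p'(4) by (auto simp: Q_def B_def C_def)
  moreover have "p' \<in> Xr" using p' by (simp add: C_def Xr_def)
  then have "s v w u b = p'" using b(3) sinv_f by (metis s_def)
  ultimately have "Phi v w u b = p'" using Phi_Q[OF t] by simp
  then show False using b(1) p'(1) V(5) by (auto simp: B_def)
qed

lemma R_local:
  assumes k: "k \<in> classes" and t: "tri3 v w u" and w: "w \<notin> k"
    and p: "p \<in> R k" "f p = ob (pt v w u (\<zeta>, 0))" and \<zeta>: "\<zeta> \<noteq> 0" and \<delta>: "\<delta> > 0"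
  obtains V where "openin (ctop X) V" "p \<in> V"
    "\<And>p'. p' \<in> R k \<Longrightarrow> p' \<in> V \<Longrightarrow> \<exists>\<zeta>'. \<zeta>' \<in> ball \<zeta> \<delta> \<and> \<zeta>' \<noteq> 0 \<and> f p' = ob (pt v w u (\<zeta>', 0)) \<and> p' = Phi v w u (\<zeta>', 0)"
proof -
  define B where "B = (ball \<zeta> \<delta> - {0}) \<times> (UNIV :: complex set)"
  have B: "open B" unfolding B_def by (intro open_Times open_Diff) auto
  have fB: "fst b \<noteq> 0" if "b \<in> B" for b using that by (auto simp: B_def)
  note nb = edge_neighbourhood[OF t B fB]
  have bB: "(\<zeta>, 0) \<in> B" using \<zeta> \<delta> by (simp add: B_def)
  define V where "V = {p'\<in>XS. f p' \<in> ob ` (tpoint {v, w, u} ` {x. (x u, x w) \<in> B} \<inter> Y0)}"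
  have "openin (ctop X) V" unfolding V_def by (rule openin_f_preimage[OF nb(1)])
  moreover have "p \<in> V" using R_XS[OF p(1)] nb(2)[OF _ bB] p(2) by (simp add: V_def)
  moreover have "\<exists>\<zeta>'. \<zeta>' \<in> ball \<zeta> \<delta> \<and> \<zeta>' \<noteq> 0 \<and> f p' = ob (pt v w u (\<zeta>', 0)) \<and> p' = Phi v w u (\<zeta>', 0)"
    if p': "p' \<in> R k" "p' \<in> V" for p'
  proof -
    have "f p' \<in> ob ` (tpoint {v, w, u} ` {x. (x u, x w) \<in> B} \<inter> Y0)" using p'(2) by (simp add: V_def)
    from nb(4)[OF _ k p'(1) this] obtain \<zeta>' where "(\<zeta>', 0) \<in> B" "f p' = ob (pt v w u (\<zeta>', 0))" by blast
    moreover from this have "p' = Phi v w u (\<zeta>', 0)" by (intro R_Phi[OF k t w p'(1)]) (auto simp: B_def)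
    ultimately show ?thesis by (intro exI[of _ \<zeta>']) (auto simp: B_def)
  qed
  ultimately show ?thesis using that by blast
qed

lemma R_empty: assumes k: "k \<in> classes" shows "R k = {}"
proof (rule ccontr)
  assume "R k \<noteq> {}"
  then obtain p v w u \<zeta>0 where p: "p \<in> R k" and t: "tri3 v w u" and w: "w \<notin> k" and \<zeta>0: "\<zeta>0 \<noteq> 0"
    and fp: "f p = ob (pt v w u (\<zeta>0, 0))" using R_edge[OF k] by metis
  have pPhi: "p = Phi v w u (\<zeta>0, 0)" by (rule R_Phi[OF k t w p fp \<zeta>0])
  obtain U n G Z c where ch: "complex_chart X U n G Z c" and pU: "p \<in> U"
    using reduced_complex_space_chart[OF reduced R_XS[OF p]] by blast
  interpret complex_chart X U n G Z c by (rule ch)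
  have "open {b. Phi v w u b \<in> U}" by (rule Phi_continuous[OF t U])
  moreover have "(\<zeta>0, 0) \<in> {b. Phi v w u b \<in> U}" using pU pPhi by simp
  ultimately obtain e where e: "e > 0" "ball (\<zeta>0, 0) e \<subseteq> {b. Phi v w u b \<in> U}"
    using open_contains_ball by blast
  define \<delta> where "\<delta> = e / 3"
  have \<delta>: "\<delta> > 0" using e by (simp add: \<delta>_def)
  have box: "Phi v w u (\<zeta>, \<eta>) \<in> U" if "dist \<zeta> \<zeta>0 \<le> \<delta>" "norm \<eta> \<le> \<delta>" for \<zeta> \<eta>
  proof -
    have "dist (\<zeta>, \<eta>) (\<zeta>0, 0) = norm (\<zeta> - \<zeta>0, \<eta>)" by (simp add: dist_norm minus_prod_def)
    also have "\<dots> \<le> norm (\<zeta> - \<zeta>0) + norm \<eta>" by (rule norm_Pair_le)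
    also have "\<dots> < e" using that e(1) by (simp add: \<delta>_def dist_norm)
    finally have "(\<zeta>, \<eta>) \<in> ball (\<zeta>0, 0) e" by (simp add: dist_commute)
    then show ?thesis using subsetD[OF e(2)] by simp
  qed
  define h where "h = (\<lambda>j \<zeta>. c (Phi v w u (\<zeta>, 0)) j)"
  have hol: "h j holomorphic_on ball \<zeta>0 \<delta>" for j
    unfolding h_def by (rule Phi_line_holomorphic[OF t ch \<delta> box])
  have lineU: "Phi v w u (\<zeta>, 0) \<in> U" if "\<zeta> \<in> ball \<zeta>0 \<delta>" for \<zeta>
    using box[of \<zeta> 0] that \<delta> by (simp add: dist_commute)
  have Phi_eqI: "q = q'" if "q \<in> U" "q' \<in> U" "\<And>j. j < n \<Longrightarrow> c q j = c q' j" for q q'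
  proof -
    have "c q = c q'"
    proof
      fix j show "c q j = c q' j"
        using that mem_Cn[of q] mem_Cn[of q'] by (cases "j < n") (auto simp: Cn_def)
    qed
    then show ?thesis using inj_onD[OF inj _ that(1,2)] by simp
  qed
  \<comment> \<open>If all coordinates of the curve were constant, \<open>R k\<close> would reduce
    to \<open>p\<close> near \<open>p\<close>.\<close>
  have "\<exists>i<n. \<exists>z\<in>ball \<zeta>0 \<delta>. deriv (h i) z \<noteq> 0"
  proof (rule ccontr)
    assume no: "\<not> ?thesis"
    have const: "h j \<zeta> = h j \<zeta>0" if "j < n" "\<zeta> \<in> ball \<zeta>0 \<delta>" for j \<zeta>
    proof -
      have "(h j has_field_derivative 0) (at x within ball \<zeta>0 \<delta>)" if "x \<in> ball \<zeta>0 \<delta>" for x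
        using holomorphic_derivI[OF hol[of j] open_ball that] no \<open>j < n\<close> that
        by (auto intro: has_field_derivative_at_within)
      then have "\<exists>a. \<forall>x\<in>ball \<zeta>0 \<delta>. h j x = a" by (rule has_field_derivative_zero_constant[OF convex_ball])
      then show ?thesis using that \<delta> by (metis centre_in_ball)
    qed
    obtain V where V: "openin (ctop X) V" "p \<in> V"
      "\<And>p'. p' \<in> R k \<Longrightarrow> p' \<in> V \<Longrightarrow> \<exists>\<zeta>'. \<zeta>' \<in> ball \<zeta>0 \<delta> \<and> \<zeta>' \<noteq> 0 \<and> f p' = ob (pt v w u (\<zeta>', 0)) \<and> p' = Phi v w u (\<zeta>', 0)"
      using R_local[OF k t w p fp \<zeta>0 \<delta>] by blast
    obtain p' where p': "p' \<in> R k" "p' \<in> V" "p' \<noteq> p" using R_not_isolated[OF k p V(1,2)] .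
    obtain \<zeta>' where \<zeta>': "\<zeta>' \<in> ball \<zeta>0 \<delta>" "p' = Phi v w u (\<zeta>', 0)" using V(3)[OF p'(1,2)] by blast
    have "p' = p"
      using const[OF _ \<zeta>'(1)] lineU[OF \<zeta>'(1)] pU by (intro Phi_eqI) (auto simp: \<zeta>'(2) pPhi h_def)
    then show False using p' by simp
  qed
  then obtain i z1 where i: "i < n" and z1: "z1 \<in> ball \<zeta>0 \<delta>" "deriv (h i) z1 \<noteq> 0" by blast
  have hold: "deriv (h i) holomorphic_on ball \<zeta>0 \<delta>" by (rule holomorphic_deriv[OF hol open_ball])
  \<comment> \<open>The point \<open>p\<close> may be critical for \<open>h i\<close>, but zeros of
    the derivative are isolated. A point of \<open>R k\<close> near \<open>p\<close> and different
    from it is therefore not critical.\<close>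
  have "\<exists>d>0. \<forall>z\<in>ball \<zeta>0 d - {\<zeta>0}. z \<in> ball \<zeta>0 \<delta> \<and> deriv (h i) z \<noteq> 0"
  proof (rule ccontr)
    assume no: "\<not> ?thesis"
    have "\<zeta>0 islimpt {z\<in>ball \<zeta>0 \<delta>. deriv (h i) z = 0}"
      unfolding islimpt_approachable
    proof (intro allI impI)
      fix d :: real assume "d > 0"
      then have "min d \<delta> > 0" using \<delta> by simp
      then obtain z where "z \<in> ball \<zeta>0 (min d \<delta>) - {\<zeta>0}" "\<not> (z \<in> ball \<zeta>0 \<delta> \<and> deriv (h i) z \<noteq> 0)" using no by blast
      then show "\<exists>x'\<in>{z\<in>ball \<zeta>0 \<delta>. deriv (h i) z = 0}. x' \<noteq> \<zeta>0 \<and> dist x' \<zeta>0 < d"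
        by (intro bexI[of _ z]) (auto simp: dist_commute)
    qed
    then have "deriv (h i) z1 = 0"
      by (intro analytic_continuation[OF hold open_ball convex_connected[OF convex_ball] _ _ _ _ z1(1),
            of "{z\<in>ball \<zeta>0 \<delta>. deriv (h i) z = 0}" \<zeta>0]) (use \<delta> in auto)
    then show False using z1 by simp
  qed
  then obtain d where d: "d > 0" "\<And>z. z \<in> ball \<zeta>0 d - {\<zeta>0} \<Longrightarrow> z \<in> ball \<zeta>0 \<delta> \<and> deriv (h i) z \<noteq> 0" by blast
  obtain V where V: "openin (ctop X) V" "p \<in> V"
    "\<And>p'. p' \<in> R k \<Longrightarrow> p' \<in> V \<Longrightarrow> \<exists>\<zeta>'. \<zeta>' \<in> ball \<zeta>0 d \<and> \<zeta>' \<noteq> 0 \<and> f p' = ob (pt v w u (\<zeta>', 0)) \<and> p' = Phi v w u (\<zeta>', 0)"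
    using R_local[OF k t w p fp \<zeta>0 d(1)] by blast
  obtain p' where p': "p' \<in> R k" "p' \<in> V" "p' \<noteq> p" using R_not_isolated[OF k p V(1,2)] .
  obtain \<zeta>' where \<zeta>': "\<zeta>' \<in> ball \<zeta>0 d" "\<zeta>' \<noteq> 0" "f p' = ob (pt v w u (\<zeta>', 0))" "p' = Phi v w u (\<zeta>', 0)"
    using V(3)[OF p'(1,2)] by blast
  have "\<zeta>' \<noteq> \<zeta>0" using \<zeta>' p' pPhi by auto
  then have \<zeta>'in: "\<zeta>' \<in> ball \<zeta>0 \<delta>" "deriv (h i) \<zeta>' \<noteq> 0" using d(2) \<zeta>'(1) by auto
  obtain \<rho> where \<rho>: "\<rho> > 0" "ball \<zeta>' \<rho> \<subseteq> ball \<zeta>0 \<delta>" "inj_on (h i) (ball \<zeta>' \<rho>)"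
    using has_complex_derivative_locally_injective[OF hol \<zeta>'in(1) open_ball \<zeta>'in(2)] by blast
  define D1 where "D1 = h i ` ball \<zeta>' \<rho>"
  have holr: "h j holomorphic_on ball \<zeta>' \<rho>" for j using hol \<rho>(2) holomorphic_on_subset by blast
  have D1: "open D1" unfolding D1_def by (rule open_mapping_thm3[OF holr open_ball \<rho>(3)])
  obtain g where g: "g holomorphic_on D1" "\<And>z. z \<in> ball \<zeta>' \<rho> \<Longrightarrow> deriv (h i) z * deriv g (h i z) = 1"
    "\<And>z. z \<in> ball \<zeta>' \<rho> \<Longrightarrow> g (h i z) = z"
    using holomorphic_has_inverse[OF holr[of i] open_ball \<rho>(3)] unfolding D1_def by (metis (no_types, lifting))
  have gD1: "g ` D1 \<subseteq> ball \<zeta>' \<rho>" using g(3) by (auto simp: D1_def)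
  have holhg: "(\<lambda>z. h j (g z)) holomorphic_on D1" for j
    using holomorphic_on_compose_gen[OF g(1) holr gD1] by (simp add: o_def)
  obtain V1 where V1: "openin (ctop X) V1" "p' \<in> V1"
    "\<And>p''. p'' \<in> R k \<Longrightarrow> p'' \<in> V1 \<Longrightarrow> \<exists>\<zeta>. \<zeta> \<in> ball \<zeta>' \<rho> \<and> \<zeta> \<noteq> 0 \<and> f p'' = ob (pt v w u (\<zeta>, 0)) \<and> p'' = Phi v w u (\<zeta>, 0)"
    using R_local[OF k t w p'(1) \<zeta>'(3,2) \<rho>(1)] by blast
  define V2 where "V2 = V1 \<inter> {q\<in>U. c q i \<in> D1}"
  have "openin (ctop X) {q\<in>U. c q i \<in> D1}"
    by (rule section_open_preimage[OF U order_refl coordinate_section[OF U order_refl] D1])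
  then have V2: "openin (ctop X) V2" unfolding V2_def by (rule openin_Int[OF V1(1)])
  have V2U: "V2 \<subseteq> U" and V2D: "\<And>q. q \<in> V2 \<Longrightarrow> c q i \<in> D1" by (auto simp: V2_def)
  have p'V2: "p' \<in> V2" using V1(2) lineU[OF \<zeta>'in(1)] \<rho>(1) \<zeta>'(4) by (auto simp: V2_def D1_def h_def)
  \<comment> \<open>The curve as a graph over its coordinate \<open>i\<close>, where the local
    inverse \<open>g\<close> of \<open>h i\<close> recovers the parameter.\<close>
  define T where "T = {q\<in>V2. \<forall>j<n. c q j = h j (g (c q i))}"
  have an: "analytic_subset (open_subspace X V2) T"
    unfolding T_def by (rule graph_analytic[OF V2 V2U D1 holhg V2D])
  have TC: "T \<inter> (C k \<union> Cc k) = {}"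
  proof -
    have "q \<notin> C k \<union> Cc k" if q: "q \<in> T" for q
    proof -
      have qV: "q \<in> V2" using q by (simp add: T_def)
      have gq: "g (c q i) \<in> ball \<zeta>' \<rho>" using V2D[OF qV] gD1 by blast
      have "q = Phi v w u (g (c q i), 0)"
        using q V2U lineU gq \<rho>(2) by (intro Phi_eqI) (auto simp: T_def h_def)
      then have fq: "f q = ob (pt v w u (g (c q i), 0))" using Phi(2)[OF t] by metis
      have "\<not> (\<exists>a. min_cone (pt v w u (g (c q i), 0)) = {a})"
        using t by (auto simp: min_cone_pt[OF t] tri3_def)
      then have "f q \<notin> reg k'" if "k' \<in> classes" for k'
        using mem_reg[OF that pt_Y0[OF t]] fq by auto
      then show ?thesis using k by (auto simp: C_def Cc_def)
    qed
    then show ?thesis by blast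
  qed
  have "R k \<inter> V2 \<subseteq> T"
  proof
    fix q assume q: "q \<in> R k \<inter> V2"
    then obtain \<zeta> where \<zeta>: "\<zeta> \<in> ball \<zeta>' \<rho>" "q = Phi v w u (\<zeta>, 0)" using V1(3) by (auto simp: V2_def)
    then have "c q i = h i \<zeta>" by (simp add: h_def)
    then have "g (c q i) = \<zeta>" using g(3) \<zeta>(1) by simp
    then show "q \<in> T" using q \<zeta>(2) by (simp add: T_def h_def)
  qed
  then have "R k \<inter> V2 = {}"
    using normal_separation[OF normal closure_cover[OF k] V2 V2U an TC] unfolding R_def by blast
  then show False using p'(1) p'V2 by blast
qed

text \<open>By \<open>R_empty\<close> each closure is the complement of the closure of all other
  strata, hence open. Connected nonempty clopen sets that cover the space are its
  components.\<close>

theorem components_of_normalization: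
  assumes fin: "finite classes"
  shows "finite (connected_components_of (ctop X))" "card (connected_components_of (ctop X)) = card classes"
proof -
  define K where "K = (\<lambda>k. ctop X closure_of C k)"
  have Csub: "C k \<subseteq> K k" for k unfolding K_def by (rule closure_of_subset) (auto simp: C_def)
  have disj: "K k \<inter> K k' = {}" if "k \<in> classes" "k' \<in> classes" "k \<noteq> k'" for k k'
  proof -
    have "C k' \<subseteq> Cc k" using that by (auto simp: Cc_def)
    then have "K k' \<subseteq> ctop X closure_of Cc k" unfolding K_def by (rule closure_of_mono)
    then show ?thesis using R_empty[OF that(1)] by (auto simp: R_def K_def)
  qed
  have clopen: "closedin (ctop X) (K k)" "openin (ctop X) (K k)" if k: "k \<in> classes" for k
  proof -
    show "closedin (ctop X) (K k)" by (simp add: K_def)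
    have "K k = XS - ctop X closure_of Cc k"
      using closure_cover[OF k] R_empty[OF k] by (auto simp: K_def R_def)
    then show "openin (ctop X) (K k)" by (simp add: openin_diff)
  qed
  have cover: "XS = \<Union>(K ` classes)"
  proof -
    have "ctop X closure_of (\<Union>(C ` classes)) = \<Union>(K ` classes)"
      using closure_of_Union[of "C ` classes" "ctop X"] fin by (simp add: K_def image_image)
    moreover have "ctop X closure_of (\<Union>(C ` classes)) = XS"
    proof -
      have "k0 \<in> classes" if "k0 = cl 0" for k0 using that by (simp add: classes_eq)
      then have k0: "cl 0 \<in> classes" by simp
      then have "\<Union>(C ` classes) = C (cl 0) \<union> Cc (cl 0)" by (auto simp: Cc_def)
      then show ?thesis using closure_cover[OF k0] by (simp add: closure_of_Un)
    qed
    ultimately show ?thesis by simp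
  qed
  have comp: "connected_component_of_set (ctop X) x = K k" if k: "k \<in> classes" and x: "x \<in> K k" for k x
  proof
    have con: "connectedin (ctop X) (K k)" unfolding K_def by (rule connectedin_closure_of[OF C_connected[OF k]])
    show "K k \<subseteq> connected_component_of_set (ctop X) x" by (rule connected_component_of_maximal[OF con x])
    have "connected_component_of_set (ctop X) x \<subseteq> K k \<or> disjnt (connected_component_of_set (ctop X) x) (K k)"
      by (rule connectedin_clopen_cases[OF connectedin_connected_component_of clopen[OF k]])
    moreover have "x \<in> connected_component_of_set (ctop X) x"
      using connected_component_of_refl[of "ctop X" x] x closedin_subset[OF clopen(1)[OF k]] by auto
    ultimately show "connected_component_of_set (ctop X) x \<subseteq> K k" using x by (auto simp: disjnt_def)
  qed
  have ne: "K k \<noteq> {}" if "k \<in> classes" for k using C_nonempty[OF that] Csub by blast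
  have eq: "connected_components_of (ctop X) = K ` classes"
  proof (intro set_eqI iffI)
    fix S assume "S \<in> connected_components_of (ctop X)"
    then obtain x where "x \<in> XS" "S = connected_component_of_set (ctop X) x" by (auto simp: connected_components_of_def)
    then show "S \<in> K ` classes" using cover comp by auto
  next
    fix S assume "S \<in> K ` classes"
    then obtain k where k: "k \<in> classes" "S = K k" by auto
    obtain x where x: "x \<in> K k" using ne[OF k(1)] by auto
    then have "x \<in> XS" using cover k by auto
    then show "S \<in> connected_components_of (ctop X)" using comp[OF k(1) x] k unfolding connected_components_of_def by auto
  qed
  have "inj_on K classes"
    using disj ne by (intro inj_onI) (metis Int_absorb)
  then show "finite (connected_components_of (ctop X))" "card (connected_components_of (ctop X)) = card classes"
    using eq fin by (simp_all add: card_image)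
qed

end

theorem card_components_of_normalized_central_fibre:
  assumes D: "\<And>i j. (\<lambda>t. D t $ i $ j) holomorphic_on ball 0 r" and eps: "0 < \<epsilon>" "\<epsilon> \<le> r"
    and nm: "is_normalization X f (central_fibre M D \<epsilon>)" and fin: "finite (lcosets UNIV (range ((*v) M)))"
  shows "finite (connected_components_of (ctop X)) \<and>
    card (connected_components_of (ctop X)) = lattice_index UNIV (range ((*v) M))"
proof -
  from nm obtain A where A: "thin_subset (central_fibre M D \<epsilon>) A"
    "ctop X interior_of {p \<in> topspace (ctop X). f p \<in> A} = {}"
    "biholomorphic_map (open_subspace X (topspace (ctop X) - {p \<in> topspace (ctop X). f p \<in> A}))
      (open_subspace (central_fibre M D \<epsilon>) (topspace (ctop (central_fibre M D \<epsilon>)) - A)) f"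
    unfolding is_normalization_def by blast
  have "normalized_fibre M D r \<epsilon> X f A"
    by unfold_locales (use D eps nm A in \<open>auto simp: is_normalization_def holomorphic_map_def finite_map_def proper_map_def\<close>)
  then interpret normalized_fibre M D r \<epsilon> X f A .
  show ?thesis using components_of_normalization fin by (simp add: classes_def lattice_index_def)
qed

section \<open>Lifts and their central obstruction\<close>

lemma mat2_sel [simp]: "mat2 p q r s $ 1 $ 1 = p" "mat2 p q r s $ 1 $ 2 = q" "mat2 p q r s $ 2 $ 1 = r" "mat2 p q r s $ 2 $ 2 = s"
  by (simp_all add: mat2_def vec2_def)

lemma vec2_sel [simp]: "vec2 x y $ 1 = x" "vec2 x y $ 2 = y"
  by (simp_all add: vec2_def)

lemma vec2_collapse: "vec2 (d $ 1) (d $ 2) = d"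
  by (simp add: vec_eq_iff forall_2)

lemma vec2_eq_iff [simp]: "vec2 x y = vec2 x' y' \<longleftrightarrow> x = x' \<and> y = y'"
  by (simp add: vec_eq_iff forall_2)

lemma mat2_eq_iff [simp]: "mat2 p q r s = mat2 p' q' r' s' \<longleftrightarrow> p = p' \<and> q = q' \<and> r = r' \<and> s = s'"
  by (auto simp: vec_eq_iff forall_2)

lemma mat_1_mat2: "(mat 1 :: int^2^2) = mat2 1 0 0 1"
  by (simp add: vec_eq_iff forall_2 mat_def)

lemma zero_vec2: "(0 :: int^2) = vec2 0 0"
  by (simp add: vec_eq_iff forall_2)

lemma mat2_mult [simp]: "(mat2 p q r s :: int^2^2) ** mat2 p' q' r' s' =
    mat2 (p * p' + q * r') (p * q' + q * s') (r * p' + s * r') (r * q' + s * s')"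
  by (simp add: vec_eq_iff forall_2 matrix_matrix_mult_def sum_2)

lemma mat2_vec2 [simp]: "(mat2 p q r s :: int^2^2) *v vec2 x y = vec2 (p * x + q * y) (r * x + s * y)"
  by (simp add: vec_eq_iff forall_2 matrix_vector_mult_def sum_2)

lemma vec2_add [simp]: "vec2 x y + vec2 x' y' = vec2 (x + x' :: int) (y + y')"
  by (simp add: vec_eq_iff forall_2)

lemma mat2_uminus: "- mat2 p q r s = mat2 (- p :: int) (- q) (- r) (- s)"
  by (simp add: vec_eq_iff forall_2)

lemma omega_vec2: "omega s (vec2 x y) (vec2 x' y') = s * (x * y' - y * x')"
  by (simp add: omega_def Jmat_def scalar_product_def sum_2 algebra_simps)

lemma mpow_0: "mpow A 0 = mat 1" and mpow_Suc: "mpow A (Suc n) = A ** mpow A n"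
  by (simp_all add: mpow_def)

lemmas mpow_numeral = mpow_0 mpow_Suc numeral_eq_Suc

lemma vector_4: "(vector [a, b, c, d] :: 'a::zero^4) $ 1 = a" "(vector [a, b, c, d] :: 'a^4) $ 2 = b"
    "(vector [a, b, c, d] :: 'a^4) $ 3 = c" "(vector [a, b, c, d] :: 'a^4) $ 4 = d"
  unfolding vector_def by simp_all

lemma Tmat_sel:
  "Tmat s B d z = vector [vector [1, s * (d$1 * B$2$1 - d$2 * B$1$1), s * (d$1 * B$2$2 - d$2 * B$1$2), z],
     vector [0, B$1$1, B$1$2, d$1], vector [0, B$2$1, B$2$2, d$2], vector [0, 0, 0, 1]]"
  by (simp add: Tmat_def Let_def Jmat_def vector_matrix_mult_def matrix_matrix_mult_def sum_2 algebra_simps)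

lemma Tmat_eq_iff [simp]: "Tmat s B d z = Tmat s B' d' z' \<longleftrightarrow> B = B' \<and> d = d' \<and> z = z'"
  by (auto simp: Tmat_sel vec_eq_iff forall_2 forall_4 vector_4)

lemma Tmat_one: "mat 1 = Tmat s (mat 1) 0 0"
  by (simp add: Tmat_sel vec_eq_iff forall_4 vector_4 mat_def)

text \<open>Determinant one says that the first block preserves the symplectic form; only then is
  the first row of the product again determined by its translation part.\<close>

lemma Tmat_mult:
  assumes "p * s' - q * r = (1 :: int)"
  shows "Tmat s (mat2 p q r s') (vec2 x y) z ** Tmat s (mat2 a b c d) (vec2 x' y') z' =
    Tmat s (mat2 p q r s' ** mat2 a b c d) (vec2 x y + mat2 p q r s' *v vec2 x' y')
      (z + z' + s * (x * (r * x' + s' * y') - y * (p * x' + q * y')))"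
proof -
  have key: "(x + (p * x' + q * y')) * (r * a + s' * c) - (y + (r * x' + s' * y')) * (p * a + q * c) =
      (p * s' - q * r) * (x' * c - y' * a) + (x * r - y * p) * a + (x * s' - y * q) * c" for a c
    by (simp add: algebra_simps)
  show ?thesis
    by (simp add: Tmat_sel vec_eq_iff forall_4 vector_4 matrix_matrix_mult_def sum_4 sum_2 key assms)
      (simp add: algebra_simps)
qed

lemma mat_order_eqI:
  assumes "0 < m" "mpow A m = mat 1" "\<And>n. 0 < n \<Longrightarrow> n < m \<Longrightarrow> mpow A n \<noteq> mat 1"
  shows "mat_order A = m"
  unfolding mat_order_def using assms by (intro Least_equality) (auto simp: not_less[symmetric])

lemma m1_eq: "m1 \<rho> = (case \<rho> of TypeA \<Rightarrow> 3 | TypeB \<Rightarrow> 4 | TypeC \<Rightarrow> 3)"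
  unfolding m1_def
  by (cases \<rho>) (auto intro!: mat_order_eqI simp: less_Suc_eq mat_1_mat2 mpow_numeral)

lemma m2_eq: "m2 \<rho> = (case \<rho> of TypeA \<Rightarrow> 4 | TypeB \<Rightarrow> 6 | TypeC \<Rightarrow> 6)"
  unfolding m2_def
  by (cases \<rho>) (auto intro!: mat_order_eqI simp: less_Suc_eq mat_1_mat2 mpow_numeral)

lemma nu_eq: "nu \<rho> = (case \<rho> of TypeA \<Rightarrow> 6 | TypeB \<Rightarrow> 2 | TypeC \<Rightarrow> 3)"
  by (cases \<rho>) (simp_all add: nu_def det_2 mat_1_mat2)

text \<open>Closed form of \<open>kappa\<close> at the first generator. The displayed central
  coordinate is \<open>- kappa1 / m1\<close>, and likewise for the second generator with
  \<open>kappa2\<close>.\<close>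

fun kappa1 :: "lift_type \<Rightarrow> int \<Rightarrow> int \<Rightarrow> int \<Rightarrow> int" where
  "kappa1 TypeA s x y = - s * (x^2 - x*y + y^2)"
| "kappa1 TypeB s x y = - 2 * s * (x^2 + y^2)"
| "kappa1 TypeC s x y = - s * (x^2 - x*y + y^2)"

fun kappa2 :: "lift_type \<Rightarrow> int \<Rightarrow> int \<Rightarrow> int \<Rightarrow> int" where
  "kappa2 TypeA s a b = 2 * s * (a^2 + b^2)"
| "kappa2 TypeB s a b = 6 * s * (a^2 + a*b + b^2)"
| "kappa2 TypeC s a b = 6 * s * (a^2 + a*b + b^2)"

lemma sum_lessThan_numeral: "(\<Sum>i<(3::nat). g i) = g 0 + g 1 + g 2" "(\<Sum>i<(4::nat). g i) = g 0 + g 1 + g 2 + g 3"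
  "(\<Sum>i<(6::nat). g i) = g 0 + g 1 + g 2 + g 3 + g 4 + g 5"
  "(\<Sum>i<(2::nat). g i) = g 0 + g 1" "(\<Sum>i<(5::nat). g i) = g 0 + g 1 + g 2 + g 3 + g 4"
  for g :: "nat \<Rightarrow> int"
  by (simp_all add: numeral_eq_Suc)

lemma kappa_1: "kappa s (m1 \<rho>) (B1 \<rho>) (vec2 x y) = kappa1 \<rho> s x y"
  by (cases \<rho>) (simp_all add: m1_eq kappa_def sum_lessThan_numeral mpow_numeral mat_1_mat2 omega_vec2 power2_eq_square algebra_simps)

lemma kappa_2: "kappa s (m2 \<rho>) (B2 \<rho>) (vec2 x y) = kappa2 \<rho> s x y"
  by (cases \<rho>) (simp_all add: m2_eq kappa_def sum_lessThan_numeral mpow_numeral mat_1_mat2 omega_vec2 power2_eq_square algebra_simps)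

lemma Tmat_one': "mat 1 = Tmat s (mat2 1 0 0 1) (vec2 0 0) 0"
  using Tmat_one[of s] by (simp add: mat_1_mat2 zero_vec2)

lemma Tmat_power_1: "mpow (Tmat s (B1 \<rho>) (vec2 x y) z) (m1 \<rho>) = Tmat s (mat 1) 0 (int (m1 \<rho>) * z + kappa1 \<rho> s x y)"
  by (cases \<rho>) (simp_all add: m1_eq mpow_numeral Tmat_one'[of s] Tmat_mult mat_1_mat2 zero_vec2 power2_eq_square algebra_simps)

lemma Tmat_power_2: "mpow (Tmat s (B2 \<rho>) (vec2 x y) z) (m2 \<rho>) = Tmat s (mat 1) 0 (int (m2 \<rho>) * z + kappa2 \<rho> s x y)"
  by (cases \<rho>) (simp_all add: m2_eq mpow_numeral Tmat_one'[of s] Tmat_mult mat_1_mat2 zero_vec2 power2_eq_square algebra_simps)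

lemma relation_1: "mpow (Tmat s (B1 \<rho>) (vec2 x y) z) (m1 \<rho>) = mat 1 \<longleftrightarrow> int (m1 \<rho>) * z + kappa1 \<rho> s x y = 0"
  by (simp add: Tmat_power_1 Tmat_one[of s])

lemma relation_2: "mpow (Tmat s (B2 \<rho>) (vec2 x y) z) (m2 \<rho>) = mat 1 \<longleftrightarrow> int (m2 \<rho>) * z + kappa2 \<rho> s x y = 0"
  by (simp add: Tmat_power_2 Tmat_one[of s])

lemma z1_coord_iff: "of_int z = z1_coord s \<rho> x y \<longleftrightarrow> int (m1 \<rho>) * z + kappa1 \<rho> s x y = 0"
proof -
  have "of_int (int (m1 \<rho>)) * (of_int z - z1_coord s \<rho> x y) = (of_int (int (m1 \<rho>) * z + kappa1 \<rho> s x y) :: rat)"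
    by (cases \<rho>) (simp_all add: m1_eq algebra_simps)
  moreover have "of_int (int (m1 \<rho>)) \<noteq> (0 :: rat)" by (cases \<rho>) (simp_all add: m1_eq)
  ultimately show ?thesis by (metis eq_iff_diff_eq_0 mult_eq_0_iff of_int_eq_0_iff)
qed

lemma z2_coord_iff: "of_int z = z2_coord s \<rho> x y \<longleftrightarrow> int (m2 \<rho>) * z + kappa2 \<rho> s x y = 0"
proof -
  have "of_int (int (m2 \<rho>)) * (of_int z - z2_coord s \<rho> x y) = (of_int (int (m2 \<rho>) * z + kappa2 \<rho> s x y) :: rat)"
    by (cases \<rho>) (simp_all add: m2_eq algebra_simps)
  moreover have "of_int (int (m2 \<rho>)) \<noteq> (0 :: rat)" by (cases \<rho>) (simp_all add: m2_eq)
  ultimately show ?thesis by (metis eq_iff_diff_eq_0 mult_eq_0_iff of_int_eq_0_iff)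
qed

lemma lift_exists_iff: "(\<exists>z1 z2. is_lift s \<rho> (vec2 x y) (vec2 a b) z1 z2) \<longleftrightarrow>
    z1_coord s \<rho> x y \<in> \<int> \<and> z2_coord s \<rho> a b \<in> \<int>"
  unfolding is_lift_def relation_1 relation_2 z1_coord_iff[symmetric] z2_coord_iff[symmetric]
  by (metis Ints_cases Ints_of_int)

section \<open>The monodromy and the square-zero locus\<close>

definition hpar :: "lift_type \<Rightarrow> int" where
  "hpar \<rho> = (case \<rho> of TypeA \<Rightarrow> 1 | TypeB \<Rightarrow> 1 | TypeC \<Rightarrow> 2)"

text \<open>First coordinate of \<open>d1 + B1 d2\<close>, whose second coordinate is
  \<open>y - a\<close> in all types; \<open>zpar\<close> is the cocycle term
  \<open>omega s d1 (B1 d2)\<close> of the product.\<close>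

fun xpar :: "lift_type \<Rightarrow> int \<Rightarrow> int \<Rightarrow> int \<Rightarrow> int" where
  "xpar TypeA x a b = x - a + b" | "xpar TypeB x a b = x + b" | "xpar TypeC x a b = x - a + b"

fun zpar :: "lift_type \<Rightarrow> int \<Rightarrow> int \<Rightarrow> int \<Rightarrow> int \<Rightarrow> int \<Rightarrow> int" where
  "zpar TypeA s x y a b = s * (- x * a - y * (b - a))"
| "zpar TypeB s x y a b = s * (- x * a - y * b)"
| "zpar TypeC s x y a b = s * (- x * a - y * (b - a))"

lemma monodromy_eq: "monodromy s \<rho> (vec2 x y) (vec2 a b) z1 z2 =
    Tmat s (mat2 1 (hpar \<rho>) 0 1) (vec2 (xpar \<rho> x a b) (y - a)) (z1 + z2 + zpar \<rho> s x y a b)"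
  by (cases \<rho>) (simp_all add: monodromy_def Tmat_mult hpar_def algebra_simps)

definition nilp :: "int \<Rightarrow> int \<Rightarrow> int \<Rightarrow> int \<Rightarrow> int \<Rightarrow> int^4^4" where
  "nilp s h d e z = vector [vector [0, - s * e, s * (d - e * h), z], vector [0, 0, h, d], vector [0, 0, 0, e], 0]"

lemma Tmat_minus_one: "Tmat s (mat2 1 h 0 1) (vec2 d e) z - mat 1 = nilp s h d e z"
  by (simp add: Tmat_sel nilp_def vec_eq_iff forall_4 vector_4 mat_def algebra_simps)

lemma nilp_square: assumes "h \<noteq> 0" shows "mpow (nilp s h d e z) 2 = 0 \<longleftrightarrow> e = 0"
  using assms
  by (auto simp: mpow_numeral nilp_def vec_eq_iff forall_4 vector_4 matrix_matrix_mult_def sum_4 mat_def)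

lemma square_zero_iff:
  "mpow (monodromy s \<rho> (vec2 x y) (vec2 a b) z1 z2 - mat 1) 2 = 0 \<longleftrightarrow> a = y"
proof -
  have "hpar \<rho> \<noteq> 0" by (cases \<rho>) (simp_all add: hpar_def)
  then show ?thesis by (auto simp: monodromy_eq Tmat_minus_one nilp_square)
qed

section \<open>Conjugation by Heisenberg translations and the Levi involution\<close>

lemma heis_levi_iff: "g \<in> heis_levi s \<longleftrightarrow>
    (\<exists>e p q z. (e = 1 \<or> e = -1) \<and> g = Tmat s (mat2 e 0 0 e) (vec2 p q) z)"
proof
  assume "g \<in> heis_levi s"
  then show "\<exists>e p q z. (e = 1 \<or> e = -1) \<and> g = Tmat s (mat2 e 0 0 e) (vec2 p q) z"
  proof (induction rule: heis_levi.induct)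
    case (heis u z)
    show ?case by (rule exI[of _ 1], rule exI[of _ "u$1"], rule exI[of _ "u$2"], rule exI[of _ z])
      (simp add: vec2_collapse mat_1_mat2)
  next
    case levi
    show ?case by (rule exI[of _ "-1"], rule exI[of _ 0], rule exI[of _ 0], rule exI[of _ 0])
      (simp add: zero_vec2 mat_1_mat2 mat2_uminus)
  next
    case (mult g h)
    then obtain e p q z e' p' q' z' where "e = 1 \<or> e = -1" "g = Tmat s (mat2 e 0 0 e) (vec2 p q) z"
      "e' = 1 \<or> e' = -1" "h = Tmat s (mat2 e' 0 0 e') (vec2 p' q') z'" by blast
    moreover from this have "e * e = 1" "e * e' = 1 \<or> e * e' = -1" by auto
    ultimately show ?case
      by (intro exI[of _ "e * e'"] exI[of _ "p + e * p'"] exI[of _ "q + e * q'"]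
          exI[of _ "z + z' + s * (p * (e * q') - q * (e * p'))"]) (simp add: Tmat_mult)
  qed
next
  assume "\<exists>e p q z. (e = 1 \<or> e = -1) \<and> g = Tmat s (mat2 e 0 0 e) (vec2 p q) z"
  then obtain e p q z where e: "e = 1 \<or> e = -1" and g: "g = Tmat s (mat2 e 0 0 e) (vec2 p q) z" by blast
  have h: "Tmat s (mat 1) (vec2 p q) z \<in> heis_levi s" by (rule heis_levi.heis)
  from e show "g \<in> heis_levi s"
  proof
    assume "e = 1" then show ?thesis using h g by (simp add: mat_1_mat2)
  next
    assume "e = -1"
    then have "g = Tmat s (mat 1) (vec2 p q) z ** Tmat s (- mat 1) 0 0"
      by (simp add: g mat_1_mat2 mat2_uminus zero_vec2 Tmat_mult)
    then show ?thesis using heis_levi.mult[OF h heis_levi.levi] by simp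
  qed
qed

text \<open>Conjugation by \<open>T(e I, c, \<zeta>)\<close> with \<open>c = (p, q)\<close> and \<open>e = \<plusminus>1\<close> takes \<open>d\<^sub>i\<close> to
  \<open>(I - B\<^sub>i) c + e d\<^sub>i\<close>. In all types the second coordinate of \<open>(I - B\<^sub>1) c\<close> and the first of
  \<open>(I - B\<^sub>2) c\<close> are \<open>p + q\<close>, which is why only the other two coordinates need names.\<close>

fun shift1 :: "lift_type \<Rightarrow> int \<Rightarrow> int \<Rightarrow> int" where
  "shift1 TypeA p q = 2 * p - q" | "shift1 TypeB p q = p - q" | "shift1 TypeC p q = 2 * p - q"

fun shift2 :: "lift_type \<Rightarrow> int \<Rightarrow> int \<Rightarrow> int" where
  "shift2 TypeA p q = q - p" | "shift2 TypeB p q = - p" | "shift2 TypeC p q = - p"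

text \<open>Up to the factor \<open>s\<close> this is
  \<open>omega s c (e d) - omega s d' (B\<^sub>1 c)\<close> with \<open>c = (p, q)\<close>: the
  change of central coordinate found by comparing both sides of the conjugation equation.\<close>

fun cocycle1 :: "lift_type \<Rightarrow> int \<Rightarrow> int \<Rightarrow> int \<Rightarrow> int \<Rightarrow> int \<Rightarrow> int \<Rightarrow> int \<Rightarrow> int" where
  "cocycle1 TypeA p q e x y x' y' = p * e * y - q * e * x - (x' * (- p) - y' * (q - p))"
| "cocycle1 TypeB p q e x y x' y' = p * e * y - q * e * x - (x' * (- p) - y' * q)"
| "cocycle1 TypeC p q e x y x' y' = p * e * y - q * e * x - (x' * (- p) - y' * (q - p))"

fun cocycle2 :: "lift_type \<Rightarrow> int \<Rightarrow> int \<Rightarrow> int \<Rightarrow> int \<Rightarrow> int \<Rightarrow> int \<Rightarrow> int \<Rightarrow> int" where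
  "cocycle2 TypeA p q e a b a' b' = p * e * b - q * e * a - (a' * p - b' * (- q))"
| "cocycle2 TypeB p q e a b a' b' = p * e * b - q * e * a - (a' * (p + q) - b' * (- q))"
| "cocycle2 TypeC p q e a b a' b' = p * e * b - q * e * a - (a' * (p + q) - b' * (- q))"

lemma conjugate_1_iff:
  assumes "e = 1 \<or> e = -1"
  shows "Tmat s (B1 \<rho>) (vec2 x' y') z' ** Tmat s (mat2 e 0 0 e) (vec2 p q) \<zeta> =
      Tmat s (mat2 e 0 0 e) (vec2 p q) \<zeta> ** Tmat s (B1 \<rho>) (vec2 x y) z \<longleftrightarrow>
    x' = shift1 \<rho> p q + e * x \<and> y' = p + q + e * y \<and> z' = z + s * cocycle1 \<rho> p q e x y x' y'"
proof -
  have "e * e = 1" using assms by auto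
  then show ?thesis by (cases \<rho>) (auto simp: Tmat_mult algebra_simps)
qed

lemma conjugate_2_iff:
  assumes "e = 1 \<or> e = -1"
  shows "Tmat s (B2 \<rho>) (vec2 a' b') z' ** Tmat s (mat2 e 0 0 e) (vec2 p q) \<zeta> =
      Tmat s (mat2 e 0 0 e) (vec2 p q) \<zeta> ** Tmat s (B2 \<rho>) (vec2 a b) z \<longleftrightarrow>
    a' = p + q + e * a \<and> b' = shift2 \<rho> p q + e * b \<and> z' = z + s * cocycle2 \<rho> p q e a b a' b'"
proof -
  have "e * e = 1" using assms by auto
  then show ?thesis by (cases \<rho>) (auto simp: Tmat_mult algebra_simps)
qed

lemma k_coord_shift:
  "k_coord \<rho> (shift1 \<rho> p q + e * x) (p + q + e * y) (shift2 \<rho> p q + e * b) = e * k_coord \<rho> x y b"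
  by (cases \<rho>) (simp_all add: algebra_simps)

text \<open>Two of the three shift equations are unimodular in \<open>(p, q)\<close> and give the
  witnesses: the first and third in type A, the second and third in types B and C. The remaining
  equation is the condition on \<open>k\<close>.\<close>

lemma k_coord_shift_exists:
  assumes "k_coord \<rho> x' y' b' = e * k_coord \<rho> x y b"
  obtains p q where "x' = shift1 \<rho> p q + e * x" "y' = p + q + e * y" "b' = shift2 \<rho> p q + e * b"
proof (cases \<rho>)
  case TypeA
  show ?thesis
    by (rule that[of "x' - e * x + (b' - e * b)" "x' - e * x + 2 * (b' - e * b)"])
      (use assms in \<open>simp_all add: TypeA algebra_simps\<close>)
next
  case TypeB
  show ?thesis
    by (rule that[of "- (b' - e * b)" "y' - e * y + (b' - e * b)"])
      (use assms in \<open>simp_all add: TypeB algebra_simps\<close>)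
next
  case TypeC
  show ?thesis
    by (rule that[of "- (b' - e * b)" "y' - e * y + (b' - e * b)"])
      (use assms in \<open>simp_all add: TypeC algebra_simps\<close>)
qed

text \<open>Conjugation fixes the central element that the power of \<open>T\<^sub>1\<close>
  represents, so \<open>m1 * z + kappa1\<close> is unchanged when \<open>z\<close> moves by the
  cocycle.\<close>

lemma kappa1_shift:
  assumes "e = 1 \<or> e = -1" "x' = shift1 \<rho> p q + e * x" "y' = p + q + e * y"
  shows "kappa1 \<rho> s x' y' + int (m1 \<rho>) * (s * cocycle1 \<rho> p q e x y x' y') = kappa1 \<rho> s x y"
  using assms(1) unfolding assms(2,3)
  by (cases \<rho>) (auto simp: m1_eq power2_eq_square algebra_simps)

lemma kappa2_shift:
  assumes "e = 1 \<or> e = -1" "a' = p + q + e * a" "b' = shift2 \<rho> p q + e * b"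
  shows "kappa2 \<rho> s a' b' + int (m2 \<rho>) * (s * cocycle2 \<rho> p q e a b a' b') = kappa2 \<rho> s a b"
  using assms(1) unfolding assms(2,3)
  by (cases \<rho>) (auto simp: m2_eq power2_eq_square algebra_simps)

lemma m_nonzero: "int (m1 \<rho>) \<noteq> 0" "int (m2 \<rho>) \<noteq> 0"
  by (cases \<rho>; simp add: m1_eq m2_eq)+

lemma conjugate_imp_k:
  assumes "g \<in> heis_levi s"
    "Tmat s (B1 \<rho>) (vec2 x' y') z1' ** g = g ** Tmat s (B1 \<rho>) (vec2 x y) z1"
    "Tmat s (B2 \<rho>) (vec2 y' b') z2' ** g = g ** Tmat s (B2 \<rho>) (vec2 y b) z2"
  shows "k_coord \<rho> x' y' b' = k_coord \<rho> x y b \<or> k_coord \<rho> x' y' b' = - k_coord \<rho> x y b"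
proof -
  obtain e p q z where e: "e = 1 \<or> e = -1" and g: "g = Tmat s (mat2 e 0 0 e) (vec2 p q) z"
    using assms(1) unfolding heis_levi_iff by blast
  have "x' = shift1 \<rho> p q + e * x" "y' = p + q + e * y" "b' = shift2 \<rho> p q + e * b"
    using assms(2,3) unfolding g conjugate_1_iff[OF e] conjugate_2_iff[OF e] by auto
  then have "k_coord \<rho> x' y' b' = e * k_coord \<rho> x y b" using k_coord_shift by simp
  then show ?thesis using e by auto
qed

lemma conjugate_iff:
  "(\<exists>g\<in>heis_levi s. \<exists>z1 z2 z1' z2'.
      Tmat s (B1 \<rho>) (vec2 x' y') z1' ** g = g ** Tmat s (B1 \<rho>) (vec2 x y) z1 \<and>
      Tmat s (B2 \<rho>) (vec2 y' b') z2' ** g = g ** Tmat s (B2 \<rho>) (vec2 y b) z2) \<longleftrightarrow>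
    k_coord \<rho> x' y' b' = k_coord \<rho> x y b \<or> k_coord \<rho> x' y' b' = - k_coord \<rho> x y b" (is "?L \<longleftrightarrow> ?R")
proof
  assume ?L then show ?R using conjugate_imp_k by blast
next
  assume ?R
  then obtain e where e: "e = 1 \<or> e = -1" "k_coord \<rho> x' y' b' = e * k_coord \<rho> x y b" by force
  obtain p q where pq: "x' = shift1 \<rho> p q + e * x" "y' = p + q + e * y" "b' = shift2 \<rho> p q + e * b"
    using k_coord_shift_exists[OF e(2)] .
  define g where "g = Tmat s (mat2 e 0 0 e) (vec2 p q) 0"
  have "g \<in> heis_levi s" unfolding heis_levi_iff g_def using e(1) by blast
  moreover have "Tmat s (B1 \<rho>) (vec2 x' y') (0 + s * cocycle1 \<rho> p q e x y x' y') ** g = g ** Tmat s (B1 \<rho>) (vec2 x y) 0"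
    "Tmat s (B2 \<rho>) (vec2 y' b') (0 + s * cocycle2 \<rho> p q e y b y' b') ** g = g ** Tmat s (B2 \<rho>) (vec2 y b) 0"
    unfolding g_def conjugate_1_iff[OF e(1)] conjugate_2_iff[OF e(1)] using pq by simp_all
  ultimately show ?L by blast
qed

lemma conjugate_lift_iff:
  assumes "is_lift s \<rho> (vec2 x y) (vec2 y b) z1 z2" "is_lift s \<rho> (vec2 x' y') (vec2 y' b') z1' z2'"
  shows "(\<exists>g\<in>heis_levi s.
      Tmat s (B1 \<rho>) (vec2 x' y') z1' ** g = g ** Tmat s (B1 \<rho>) (vec2 x y) z1 \<and>
      Tmat s (B2 \<rho>) (vec2 y' b') z2' ** g = g ** Tmat s (B2 \<rho>) (vec2 y b) z2) \<longleftrightarrow>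
    k_coord \<rho> x' y' b' = k_coord \<rho> x y b \<or> k_coord \<rho> x' y' b' = - k_coord \<rho> x y b" (is "?L \<longleftrightarrow> ?R")
proof
  assume ?L then show ?R using conjugate_imp_k by blast
next
  assume ?R
  then obtain e where e: "e = 1 \<or> e = -1" "k_coord \<rho> x' y' b' = e * k_coord \<rho> x y b" by force
  obtain p q where pq: "x' = shift1 \<rho> p q + e * x" "y' = p + q + e * y" "b' = shift2 \<rho> p q + e * b"
    using k_coord_shift_exists[OF e(2)] .
  define g where "g = Tmat s (mat2 e 0 0 e) (vec2 p q) 0"
  have rel: "int (m1 \<rho>) * z1 + kappa1 \<rho> s x y = 0" "int (m2 \<rho>) * z2 + kappa2 \<rho> s y b = 0"
    "int (m1 \<rho>) * z1' + kappa1 \<rho> s x' y' = 0" "int (m2 \<rho>) * z2' + kappa2 \<rho> s y' b' = 0"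
    using assms by (simp_all add: is_lift_def relation_1 relation_2)
  \<comment> \<open>The central coordinate of a lift is fixed by its relation, and must agree with
    the one forced by conjugation. Both have the same multiple by \<open>m1\<close>, which is then
    cancelled.\<close>
  have "int (m1 \<rho>) * z1' = int (m1 \<rho>) * (z1 + s * cocycle1 \<rho> p q e x y x' y')"
    using rel(1,3) kappa1_shift[OF e(1) pq(1,2), of s] by (simp add: distrib_left)
  then have z1': "z1' = z1 + s * cocycle1 \<rho> p q e x y x' y'" using m_nonzero[of \<rho>] by (metis mult_left_cancel)
  have "int (m2 \<rho>) * z2' = int (m2 \<rho>) * (z2 + s * cocycle2 \<rho> p q e y b y' b')"
    using rel(2,4) kappa2_shift[OF e(1) pq(2,3), of s] by (simp add: distrib_left)
  then have z2': "z2' = z2 + s * cocycle2 \<rho> p q e y b y' b'" using m_nonzero[of \<rho>] by (metis mult_left_cancel)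
  have "g \<in> heis_levi s" unfolding heis_levi_iff g_def using e(1) by blast
  moreover have "Tmat s (B1 \<rho>) (vec2 x' y') z1' ** g = g ** Tmat s (B1 \<rho>) (vec2 x y) z1"
    "Tmat s (B2 \<rho>) (vec2 y' b') z2' ** g = g ** Tmat s (B2 \<rho>) (vec2 y b) z2"
    unfolding g_def conjugate_1_iff[OF e(1)] conjugate_2_iff[OF e(1)] using pq z1' z2' by simp_all
  ultimately show ?L by blast
qed

section \<open>The central obstruction\<close>

lemma obstruction_zero_iff:
  "central_obstruction s \<rho> (vec2 x y) (vec2 a b) = (0, 0) \<longleftrightarrow> (\<exists>z1 z2. is_lift s \<rho> (vec2 x y) (vec2 a b) z1 z2)"
proof -
  have "n mod m = 0 \<longleftrightarrow> (\<exists>z. m * z + n = 0)" for n m :: int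
  proof
    assume "n mod m = 0"
    then obtain w where "n = m * w" by auto
    then show "\<exists>z. m * z + n = 0" by (intro exI[of _ "- w"]) simp
  next
    assume "\<exists>z. m * z + n = 0"
    then obtain z where "n = m * (- z)" by (metis add.commute eq_neg_iff_add_eq_0 mult_minus_right)
    then show "n mod m = 0" by simp
  qed
  then show ?thesis
    by (simp add: central_obstruction_def is_lift_def relation_1 relation_2 kappa_1 kappa_2)
qed

text \<open>With \<open>a = y\<close>, each quadratic form that matters is congruent to
  \<open>k^2\<close> modulo 3 or modulo 2, the latter doubled to modulus 4. The explicit quotients
  are the expanded differences.\<close>

lemma obstruction_value:
  assumes "k = k_coord \<rho> x y b"
  shows "central_obstruction s \<rho> (vec2 x y) (vec2 y b) =
    (case \<rho> of
       TypeA \<Rightarrow> ((- s * k^2) mod 3, (2 * s * k^2) mod 4)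
     | TypeB \<Rightarrow> ((- 2 * s * k^2) mod 4, 0)
     | TypeC \<Rightarrow> ((- s * k^2) mod 3, 0))"
proof (cases \<rho>)
  case TypeA
  have "- s * (x^2 - x*y + y^2) - (- s * k^2) = 3 * (s * (x^2 - x*y + 3*b^2 + 4*x*b - 2*y*b))"
    "2 * s * (y^2 + b^2) - 2 * s * k^2 = 4 * (- s * (2*x^2 - 2*x*y + 4*b^2 + 6*x*b - 3*y*b))"
    by (simp_all add: assms TypeA power2_eq_square algebra_simps)
  then have "(- s * (x^2 - x*y + y^2)) mod 3 = (- s * k^2) mod 3" "(2 * s * (y^2 + b^2)) mod 4 = (2 * s * k^2) mod 4"
    unfolding mod_eq_dvd_iff by (metis dvd_triv_left)+
  then show ?thesis unfolding central_obstruction_def kappa_1 kappa_2 by (simp add: TypeA m1_eq m2_eq)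
next
  case TypeB
  have "- 2 * s * (x^2 + y^2) - (- 2 * s * k^2) = 4 * (s * (x*y + 2*b^2 + 2*x*b + 2*y*b))"
    by (simp add: assms TypeB power2_eq_square algebra_simps)
  then have "(- 2 * s * (x^2 + y^2)) mod 4 = (- 2 * s * k^2) mod 4"
    unfolding mod_eq_dvd_iff by (metis dvd_triv_left)
  moreover have "(6 * s * (y^2 + y*b + b^2)) mod 6 = 0" by (simp add: mult.assoc)
  ultimately show ?thesis unfolding central_obstruction_def kappa_1 kappa_2 by (simp add: TypeB m1_eq m2_eq)
next
  case TypeC
  have "- s * (x^2 - x*y + y^2) - (- s * k^2) = 3 * (s * (x*y + 3*b^2 + 2*x*b + 2*y*b))"
    by (simp add: assms TypeC power2_eq_square algebra_simps)
  then have "(- s * (x^2 - x*y + y^2)) mod 3 = (- s * k^2) mod 3"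
    unfolding mod_eq_dvd_iff by (metis dvd_triv_left)
  moreover have "(6 * s * (y^2 + y*b + b^2)) mod 6 = 0" by (simp add: mult.assoc)
  ultimately show ?thesis unfolding central_obstruction_def kappa_1 kappa_2 by (simp add: TypeC m1_eq m2_eq)
qed

lemma of_int_div_Ints_iff:
  assumes "(m :: int) \<noteq> 0" shows "(of_int n / of_int m :: rat) \<in> \<int> \<longleftrightarrow> m dvd n"
proof
  assume "(of_int n / of_int m :: rat) \<in> \<int>"
  then obtain w where "(of_int n :: rat) / of_int m = of_int w" by (rule Ints_cases)
  then have "(of_int n :: rat) = of_int (w * m)" using assms by (simp add: field_simps)
  then show "m dvd n" by (simp only: of_int_eq_iff) simp
next
  assume "m dvd n"
  then show "(of_int n / of_int m :: rat) \<in> \<int>" using assms by (auto simp: dvd_def)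
qed

lemma lift_exists_square_zero_iff:
  assumes "k = k_coord \<rho> x y b"
  shows "(\<exists>z1 z2. is_lift s \<rho> (vec2 x y) (vec2 y b) z1 z2) \<longleftrightarrow> nu \<rho> dvd s * k^2"
proof -
  define n where "n = s * k^2"
  \<comment> \<open>The factor 2 turns modulus 4 into modulus 2; in type A this combines with
    modulus 3 to give 6.\<close>
  have "(- n) mod 3 = 0 \<and> (2 * n) mod 4 = 0 \<longleftrightarrow> 6 dvd n" "(- 2 * n) mod 4 = 0 \<longleftrightarrow> 2 dvd n" "(- n) mod 3 = 0 \<longleftrightarrow> 3 dvd n"
    by presburger+
  then show ?thesis
    unfolding obstruction_zero_iff[symmetric] obstruction_value[OF assms]
    by (cases \<rho>) (simp_all add: nu_eq n_def mult.assoc)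
qed

section \<open>The cusp\<close>

lemma lattice_index_image:
  fixes F :: "'a::plus \<Rightarrow> 'b::plus"
  assumes add: "\<And>a b. F (a + b) = F a + F b" and inj: "inj F"
  shows "lattice_index (F ` L) (F ` H) = lattice_index L H"
    "finite (lcosets (F ` L) (F ` H)) \<longleftrightarrow> finite (lcosets L H)"
proof -
  have eq: "lcosets (F ` L) (F ` H) = (`) F ` lcosets L H"
    by (simp add: lcosets_def image_image add)
  have "inj_on ((`) F) (lcosets L H)" using inj by (simp add: inj_on_def inj_image_eq_iff)
  then show "lattice_index (F ` L) (F ` H) = lattice_index L H"
    "finite (lcosets (F ` L) (F ` H)) \<longleftrightarrow> finite (lcosets L H)"
    unfolding eq lattice_index_def by (simp_all add: card_image finite_image_iff)
qed

lemma coset_eq_iff: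
  fixes M :: "int^'n^'m"
  shows "(+) v ` range ((*v) M) = (+) v' ` range ((*v) M) \<longleftrightarrow> v - v' \<in> range ((*v) M)"
proof
  assume eq: "(+) v ` range ((*v) M) = (+) v' ` range ((*v) M)"
  have "v + M *v 0 \<in> (+) v ` range ((*v) M)" by blast
  then obtain c where "v = v' + M *v c" unfolding eq by auto
  then show "v - v' \<in> range ((*v) M)" by auto
next
  assume "v - v' \<in> range ((*v) M)"
  then obtain c where c: "v = v' + M *v c" by (auto simp: algebra_simps)
  have "v + M *v x = v' + M *v (c + x)" "v' + M *v x = v + M *v (x - c)" for x
    by (simp_all add: c matrix_vector_right_distrib matrix_vector_mult_diff_distrib)
  then show "(+) v ` range ((*v) M) = (+) v' ` range ((*v) M)"
    unfolding image_image by (intro subset_antisym image_subsetI) (metis rangeI)+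
qed

text \<open>Column operations bring the lower row of the matrix to the form \<open>(g, 0)\<close>; the
  cosets are then represented by the pairs in a box with sides \<open>det M / g\<close> and \<open>g\<close>.\<close>

lemma lattice_index_det:
  fixes M :: "int^2^2"
  assumes det: "det M \<noteq> 0"
  shows "finite (lcosets UNIV (range ((*v) M)))" "int (lattice_index UNIV (range ((*v) M))) = \<bar>det M\<bar>"
proof -
  define a b c d where "a = M$1$1" and "b = M$1$2" and "c = M$2$1" and "d = M$2$2"
  have M: "M = mat2 a b c d" by (simp add: vec_eq_iff forall_2 a_def b_def c_def d_def)
  have detM: "det M = a * d - b * c" by (simp add: det_2 a_def b_def c_def d_def)
  define g where "g = gcd c d"
  have "c \<noteq> 0 \<or> d \<noteq> 0" using det detM by auto
  then have g: "g > 0" by (auto simp: g_def)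
  obtain c' d' where cd: "c = g * c'" "d = g * d'" by (metis dvd_def g_def gcd_dvd1 gcd_dvd2)
  obtain u w where "u * c + w * d = g" using bezout_int[of c d] by (auto simp: g_def)
  then have "g * (u * c' + w * d') = g * 1" by (simp add: cd algebra_simps)
  then have uw: "u * c' + w * d' = 1" using g by (metis mult_left_cancel less_irrefl)
  \<comment> \<open>\<open>M\<close> sends \<open>(u, w)\<close> to \<open>(p0, g)\<close> and
    \<open>(d', - c')\<close> to \<open>(e, 0)\<close>. By \<open>uw\<close> these two source
    vectors form a basis, so their images generate the lattice.\<close>
  define p0 e where "p0 = a * u + b * w" and "e = a * d' - b * c'"
  have e: "det M = e * g" "e \<noteq> 0" using det by (auto simp: detM e_def cd algebra_simps)
  define H where "H = range ((*v) M)"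
  have memH: "vec2 p q \<in> H \<longleftrightarrow> (\<exists>i j. p = j * p0 + i * e \<and> q = j * g)" for p q
  proof
    assume "vec2 p q \<in> H"
    then obtain v where v: "vec2 p q = M *v v" by (auto simp: H_def)
    define \<alpha> \<beta> where "\<alpha> = v$1" and "\<beta> = v$2"
    have "v = vec2 \<alpha> \<beta>" by (simp add: vec_eq_iff forall_2 \<alpha>_def \<beta>_def)
    then have pq: "p = a * \<alpha> + b * \<beta>" "q = c * \<alpha> + d * \<beta>" using v by (simp_all add: M)
    define i j where "i = w * \<alpha> - u * \<beta>" and "j = c' * \<alpha> + d' * \<beta>"
    have "q = j * g" by (simp add: pq cd j_def algebra_simps)
    moreover have "j * p0 + i * e = (u * c' + w * d') * (a * \<alpha> + b * \<beta>)"
      by (simp add: i_def j_def p0_def e_def algebra_simps)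
    ultimately show "\<exists>i j. p = j * p0 + i * e \<and> q = j * g"
      using uw pq(1) by (intro exI[of _ i] exI[of _ j]) simp
  next
    assume "\<exists>i j. p = j * p0 + i * e \<and> q = j * g"
    then obtain i j where ij: "p = j * p0 + i * e" "q = j * g" by blast
    have "c * (u * j + d' * i) + d * (w * j - c' * i) = g * j * (u * c' + w * d')"
      by (simp add: cd algebra_simps)
    then have "c * (u * j + d' * i) + d * (w * j - c' * i) = q" by (simp add: uw ij)
    moreover have "a * (u * j + d' * i) + b * (w * j - c' * i) = p"
      by (simp add: ij p0_def e_def algebra_simps)
    ultimately have "vec2 p q = M *v vec2 (u * j + d' * i) (w * j - c' * i)"
      by (simp add: M)
    then show "vec2 p q \<in> H" by (auto simp: H_def)
  qed
  define S where "S = {0..<\<bar>e\<bar>} \<times> {0..<g}"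
  define rep where "rep = (\<lambda>(i, j). (+) (vec2 i j) ` H)"
  have rep_eq: "rep (i, j) = rep (i', j') \<longleftrightarrow> vec2 (i - i') (j - j') \<in> H" for i j i' j'
  proof -
    have "vec2 i j - vec2 i' j' = vec2 (i - i') (j - j')" by (simp add: vec_eq_iff forall_2)
    then show ?thesis by (simp add: rep_def H_def coset_eq_iff)
  qed
  have "inj_on rep S"
  proof (rule inj_onI, clarify)
    fix i j i' j' assume S: "(i, j) \<in> S" "(i', j') \<in> S" and "rep (i, j) = rep (i', j')"
    then obtain I J where IJ: "i - i' = J * p0 + I * e" "j - j' = J * g"
      using rep_eq memH by auto
    have "\<bar>J * g\<bar> < g" using S IJ(2) by (auto simp: S_def)
    then have "\<bar>J\<bar> * g < 1 * g" using g by (simp add: abs_mult)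
    then have "\<bar>J\<bar> < 1" using g by simp
    then have J: "J = 0" by simp
    have "\<bar>I * e\<bar> < \<bar>e\<bar>" using S IJ(1) J by (auto simp: S_def)
    then have "\<bar>I\<bar> * \<bar>e\<bar> < 1 * \<bar>e\<bar>" by (simp add: abs_mult)
    then have "\<bar>I\<bar> < 1" by (simp only: mult_less_cancel_right)
    then show "i = i' \<and> j = j'" using IJ J by simp
  qed
  moreover have "rep ` S = lcosets UNIV H"
  proof
    show "rep ` S \<subseteq> lcosets UNIV H" by (auto simp: rep_def lcosets_def)
    show "lcosets UNIV H \<subseteq> rep ` S"
    proof
      fix K assume "K \<in> lcosets UNIV H"
      then obtain v where v: "K = (+) v ` H" by (auto simp: lcosets_def)
      define p q where "p = v$1" and "q = v$2"
      have K: "K = rep (p, q)" using v by (simp add: rep_def p_def q_def vec2_collapse)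
      define J p1 where "J = q div g" and "p1 = p - J * p0"
      have "e dvd p1 - p1 mod \<bar>e\<bar>" by (metis abs_dvd_iff dvd_minus_mod)
      then obtain I where "p1 - p1 mod \<bar>e\<bar> = e * I" by (rule dvdE)
      then have "p - p1 mod \<bar>e\<bar> = J * p0 + I * e" by (simp add: p1_def algebra_simps)
      moreover have "q - q mod g = J * g" by (simp add: J_def minus_mod_eq_div_mult)
      ultimately have "K = rep (p1 mod \<bar>e\<bar>, q mod g)" unfolding K rep_eq memH by blast
      then show "K \<in> rep ` S" using g e(2) by (auto simp: S_def)
    qed
  qed
  ultimately have bij: "bij_betw rep S (lcosets UNIV H)" by (simp add: bij_betw_def)
  have "finite S" "int (card S) = \<bar>e\<bar> * g" using g by (auto simp: S_def)
  then show "finite (lcosets UNIV (range ((*v) M)))" "int (lattice_index UNIV (range ((*v) M))) = \<bar>det M\<bar>"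
    using bij_betw_finite[OF bij] bij_betw_same_card[OF bij] g
    by (simp_all add: H_def lattice_index_def e(1) abs_mult)
qed

section \<open>The map induced by the logarithm, and its cusp matrices\<close>

lemma int_comb_add: "int_comb b (c + c') = int_comb b c + int_comb b c'"
  by (simp add: int_comb_def vector_add_ldistrib vector_sadd_rdistrib sum.distrib)

lemma int_comb_2: "int_comb b c = c $ 1 *s b 1 + c $ 2 *s b (2::2)"
  by (simp add: int_comb_def sum_2)

text \<open>The logarithm of \<open>T(U\<^sub>h, (d, 0), z)\<close>. The quantity assumed nonzero is
  the determinant of its induced map in standard coordinates, that is, of
  \<open>mat2 (s * d) z h d\<close>.\<close>

locale cusp =
  fixes s h d z :: int
  assumes disc: "s * d^2 - h * z \<noteq> 0"
begin

definition N where "N = nilp s h d 0 z"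

lemma N_mult: "N *v v = vector [s * d * v$3 + z * v$4, h * v$3 + d * v$4, 0, 0]"
  by (simp add: N_def nilp_def vec_eq_iff forall_4 vector_4 matrix_vector_mult_def sum_4)

lemma kernel: "N *v v = 0 \<longleftrightarrow> v$3 = 0 \<and> v$4 = 0"
proof
  assume "N *v v = 0"
  then have 1: "s * d * v$3 + z * v$4 = 0" and 2: "h * v$3 + d * v$4 = 0"
    by (simp_all add: N_mult vec_eq_iff forall_4 vector_4)
  have "(s * d^2 - h * z) * v$3 = 0" "(s * d^2 - h * z) * v$4 = 0"
    using 1 2 by algebra+
  then show "v$3 = 0 \<and> v$4 = 0" using disc by simp
qed (simp add: N_mult vec_eq_iff forall_4 vector_4)

lemma saturation: "saturation N = {v. v$3 = 0 \<and> v$4 = 0}"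
proof (intro set_eqI iffI)
  fix v assume "v \<in> saturation N"
  then obtain w :: "rat^4" where w: "(\<chi> i. of_int (v $ i)) = map_matrix of_int N *v w" by (auto simp: saturation_def)
  have "(of_int (v$3) :: rat) = (map_matrix of_int N *v w) $ 3" "(of_int (v$4) :: rat) = (map_matrix of_int N *v w) $ 4"
    by (simp_all flip: w)
  then show "v \<in> {v. v$3 = 0 \<and> v$4 = 0}"
    by (simp add: matrix_vector_mult_def sum_4 N_def nilp_def vector_4 map_matrix_def)
next
  fix v :: "int^4" assume v: "v \<in> {v. v$3 = 0 \<and> v$4 = 0}"
  define \<Delta> :: rat where "\<Delta> = of_int (s * d^2 - h * z)"
  have \<Delta>: "\<Delta> \<noteq> 0" using disc by (simp add: \<Delta>_def del: of_int_diff of_int_mult)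
  have \<Delta>': "\<Delta> = of_int s * of_int d * of_int d - of_int h * of_int z" by (simp add: \<Delta>_def power2_eq_square)
  define p q :: rat where "p = of_int (v$1)" and "q = of_int (v$2)"
  \<comment> \<open>Cramer's rule for the two upper rows of \<open>N\<close>; the denominator is the
    discriminant.\<close>
  define w3 w4 where "w3 = (of_int d * p - of_int z * q) / \<Delta>" and "w4 = (of_int s * of_int d * q - of_int h * p) / \<Delta>"
  have "of_int s * of_int d * w3 + of_int z * w4 = (\<Delta> * p) / \<Delta>" "of_int h * w3 + of_int d * w4 = (\<Delta> * q) / \<Delta>"
    unfolding w3_def w4_def \<Delta>' by (simp_all add: add_divide_distrib[symmetric] diff_divide_distrib[symmetric] algebra_simps)
  then have "of_int s * of_int d * w3 + of_int z * w4 = p" "of_int h * w3 + of_int d * w4 = q" using \<Delta> by simp_all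
  then have "(\<chi> i. of_int (v $ i)) = map_matrix of_int N *v vector [0, 0, w3, w4]"
    using v by (simp add: vec_eq_iff forall_4 matrix_vector_mult_def sum_4 N_def nilp_def vector_4 map_matrix_def p_def q_def)
  then show "v \<in> saturation N" unfolding saturation_def by blast
qed

lemma saturation_kernel: "saturation N = {v. N *v v = 0}"
  by (simp add: saturation kernel)

lemma range_subset: "range ((*v) N) \<subseteq> saturation N"
  by (auto simp: saturation N_mult vector_4)

definition l0 :: "2 \<Rightarrow> int^4" where "l0 i = (if i = 1 then axis 1 1 else axis 2 1)"
definition v0 :: "2 \<Rightarrow> int^4" where "v0 i = (if i = 1 then axis 3 1 else axis 4 1)"

lemma int_comb_l0: "int_comb l0 c = vector [c$1, c$2, 0, 0]"
  and int_comb_v0: "int_comb v0 c = vector [0, 0, c$1, c$2]"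
  by (simp_all add: int_comb_2 l0_def v0_def vec_eq_iff forall_4 vector_4 axis_def)

lemma basis_l0: "is_Z_basis l0 (saturation N)"
  unfolding is_Z_basis_def bij_betw_def
proof
  show "inj (int_comb l0)"
    by (rule injI) (simp add: int_comb_l0 vec_eq_iff forall_4 forall_2 vector_4)
  show "range (int_comb l0) = saturation N"
  proof (intro set_eqI iffI)
    fix v assume "v \<in> saturation N"
    then have "v = int_comb l0 (vec2 (v$1) (v$2))"
      by (simp add: saturation int_comb_l0 vec_eq_iff forall_4 vector_4)
    then show "v \<in> range (int_comb l0)" by blast
  qed (auto simp: saturation int_comb_l0 vector_4)
qed

lemma saturation_coset_eq: "(+) v ` saturation N = (+) v' ` saturation N \<longleftrightarrow> v - v' \<in> saturation N"
proof
  assume eq: "(+) v ` saturation N = (+) v' ` saturation N"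
  have "v + 0 \<in> (+) v ` saturation N" by (rule imageI) (simp add: saturation)
  then obtain c where "c \<in> saturation N" "v = v' + c" unfolding eq by auto
  then show "v - v' \<in> saturation N" by simp
next
  assume d: "v - v' \<in> saturation N"
  have "v + x = v' + ((v - v') + x)" "v' + x = v + (x - (v - v'))" for x by simp_all
  moreover have "(v - v') + x \<in> saturation N" "x - (v - v') \<in> saturation N" if "x \<in> saturation N" for x
    using d that by (simp_all add: saturation)
  ultimately show "(+) v ` saturation N = (+) v' ` saturation N" by (metis (no_types, lifting) image_subset_iff rev_image_eqI subset_antisym)
qed

lemma quotient_basis_v0: "is_quotient_basis v0 (saturation N)"
  unfolding is_quotient_basis_def bij_betw_def
proof
  show "inj (\<lambda>c. (+) (int_comb v0 c) ` saturation N)"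
    by (rule injI, unfold saturation_coset_eq) (simp add: int_comb_v0 saturation vector_4 vec_eq_iff forall_2)
  have "\<exists>c. (+) v ` saturation N = (+) (int_comb v0 c) ` saturation N" for v
    by (rule exI[of _ "vec2 (v$3) (v$4)"], unfold saturation_coset_eq) (simp add: int_comb_v0 saturation vector_4)
  then show "range (\<lambda>c. (+) (int_comb v0 c) ` saturation N) = lcosets UNIV (saturation N)"
    unfolding lcosets_def by (intro subset_antisym image_subsetI) (metis rangeI)+
qed

lemma cusp_matrix_exists: "is_cusp_matrix N (mat2 (s * d) z h d)"
  unfolding is_cusp_matrix_def
  by (rule exI[of _ v0], rule exI[of _ l0])
    (simp add: quotient_basis_v0 basis_l0 forall_2 sum_2 N_mult vec_eq_iff forall_4 vector_4 v0_def l0_def axis_def)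

text \<open>\<open>N\<close> kills its saturation and so factors through the quotient. The basis
  \<open>l\<close> identifies the saturation with the plane lattice and the image of
  \<open>N\<close> with that of \<open>M\<close>, whichever bases are chosen.\<close>

lemma cusp_matrix_index:
  assumes M: "is_cusp_matrix N M"
  shows "det M \<noteq> 0" "lattice_index (saturation N) (range ((*v) N)) = lattice_index UNIV (range ((*v) M))"
proof -
  obtain v l :: "2 \<Rightarrow> int^4" where v: "is_quotient_basis v (saturation N)" and l: "is_Z_basis l (saturation N)"
    and Nv: "\<And>j. N *v v j = (\<Sum>i\<in>UNIV. M $ i $ j *s l i)" using M by (auto simp: is_cusp_matrix_def)
  have Nvc: "N *v int_comb v c = int_comb l (M *v c)" for c
  proof -
    have "N *v int_comb v c = c$1 *s (N *v v 1) + c$2 *s (N *v v 2)"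
      by (simp add: int_comb_2 N_mult vec_eq_iff forall_4 vector_4 algebra_simps)
    also have "\<dots> = int_comb l (M *v c)"
      unfolding Nv by (simp add: sum_2 int_comb_2 matrix_vector_mult_def vec_eq_iff algebra_simps)
    finally show ?thesis .
  qed
  have injl: "inj (int_comb l)" and rl: "range (int_comb l) = saturation N"
    using l by (auto simp: is_Z_basis_def bij_betw_def)
  have rN: "range ((*v) N) = int_comb l ` range ((*v) M)"
  proof (intro set_eqI iffI)
    fix y assume "y \<in> range ((*v) N)"
    then obtain x where x: "y = N *v x" by auto
    have "(+) x ` saturation N \<in> lcosets UNIV (saturation N)" by (auto simp: lcosets_def)
    then have "(+) x ` saturation N \<in> range (\<lambda>c. (+) (int_comb v c) ` saturation N)"
      using v by (simp add: is_quotient_basis_def bij_betw_def)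
    then obtain c where "(+) x ` saturation N = (+) (int_comb v c) ` saturation N" by blast
    then have "N *v (x - int_comb v c) = 0" unfolding saturation_coset_eq by (simp add: saturation_kernel)
    then have "y = int_comb l (M *v c)" using x Nvc by (simp add: matrix_vector_mult_diff_distrib)
    then show "y \<in> int_comb l ` range ((*v) M)" by blast
  next
    fix y assume "y \<in> int_comb l ` range ((*v) M)"
    then obtain c where "y = int_comb l (M *v c)" by auto
    then show "y \<in> range ((*v) N)" using Nvc by (metis rangeI)
  qed
  have "int_comb l ` UNIV = saturation N" using rl by simp
  then show "lattice_index (saturation N) (range ((*v) N)) = lattice_index UNIV (range ((*v) M))"
    unfolding rN using lattice_index_image(1)[OF int_comb_add injl, of UNIV] by simp
  have injM: "c = 0" if "M *v c = 0" for c
  proof -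
    have "int_comb l (M *v c) = 0" using that by (simp add: int_comb_2)
    then have "int_comb v c \<in> saturation N" using Nvc by (simp add: saturation_kernel)
    then have "int_comb v c - int_comb v 0 \<in> saturation N" by (simp add: int_comb_2)
    then have "(+) (int_comb v c) ` saturation N = (+) (int_comb v 0) ` saturation N"
      by (simp only: saturation_coset_eq)
    then show "c = 0" using v unfolding is_quotient_basis_def bij_betw_def by (auto dest: injD)
  qed
  show "det M \<noteq> 0"
  proof
    assume "det M = 0"
    then have D: "M$1$1 * M$2$2 = M$1$2 * M$2$1" by (simp add: det_2)
    \<comment> \<open>The columns of the adjugate, one up to sign, lie in the kernel of a singular
      matrix. Injectivity makes them vanish, so \<open>M = 0\<close>, which is not
      injective.\<close>
    have "M *v vec2 (M$2$2) (- M$2$1) = 0" "M *v vec2 (M$1$2) (- M$1$1) = 0"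
      using D by (simp_all add: vec_eq_iff forall_2 matrix_vector_mult_def sum_2 algebra_simps)
    then have "vec2 (M$2$2) (- M$2$1) = 0" "vec2 (M$1$2) (- M$1$1) = 0" using injM by blast+
    then have "M = 0" by (simp add: vec_eq_iff forall_2)
    then have "M *v vec2 1 0 = 0" by (simp add: vec_eq_iff forall_2 matrix_vector_mult_def sum_2)
    then have "vec2 1 0 = (0 :: int^2)" by (rule injM)
    then show False by (simp add: vec_eq_iff forall_2)
  qed
qed

lemma index: "int (lattice_index (saturation N) (range ((*v) N))) = \<bar>s * d^2 - h * z\<bar>"
  using cusp_matrix_index[OF cusp_matrix_exists] lattice_index_det(2)[of "mat2 (s * d) z h d"]
  by (simp add: det_2 power2_eq_square algebra_simps)

end

lemma map_matrix_minus_one: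
  "map_matrix of_int P - (mat 1 :: rat^'n^'n) = map_matrix of_int (P - mat 1)"
  by (simp add: map_matrix_def vec_eq_iff mat_def)

lemma unipotent_log_nilp:
  assumes "P - mat 1 = nilp s h d 0 z"
  shows "unipotent_log (map_matrix of_int P) = map_matrix of_int (nilp s h d 0 z)"
proof -
  define R :: "rat^4^4" where "R = map_matrix of_int (nilp s h d 0 z)"
  have R2: "R ** R = 0"
    by (simp add: R_def nilp_def map_matrix_def vec_eq_iff forall_4 vector_4 matrix_matrix_mult_def sum_4)
  have "mpow R 1 = R" "mpow R 2 = 0" "mpow R 3 = 0"
    by (simp_all add: mpow_numeral R2)
  moreover have "{1..3::nat} = {1, 2, 3}" by auto
  moreover have "map_matrix f (0 :: rat^4^4) = 0" if "f 0 = 0" for f :: "rat \<Rightarrow> rat"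
    using that by (simp add: map_matrix_def vec_eq_iff)
  moreover have "map_matrix (\<lambda>c. c) R = R" "map_matrix ((*) 1) R = R" by (simp_all add: map_matrix_def vec_eq_iff)
  ultimately show ?thesis
    unfolding unipotent_log_def map_matrix_minus_one assms R_def[symmetric] by simp
qed

text \<open>The relations eliminate \<open>z1\<close> and \<open>z2\<close>, and \<open>nu\<close>
  clears the denominators of the displayed coordinates; what remains is \<open>s\<close> times a
  perfect square.\<close>

lemma discriminant:
  assumes k: "k = k_coord \<rho> x y b" and lift: "is_lift s \<rho> (vec2 x y) (vec2 y b) z1 z2"
  shows "nu \<rho> * (s * (xpar \<rho> x y b)^2 - hpar \<rho> * (z1 + z2 + zpar \<rho> s x y y b)) = s * k^2"
proof -
  have "int (m1 \<rho>) * z1 + kappa1 \<rho> s x y = 0" "int (m2 \<rho>) * z2 + kappa2 \<rho> s y b = 0"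
    using lift by (simp_all add: is_lift_def relation_1 relation_2)
  then show ?thesis
    by (cases \<rho>) (simp_all add: k m1_eq m2_eq nu_eq hpar_def power2_eq_square algebra_simps)
qed

lemma cusp_monodromy:
  assumes s: "s \<noteq> 0" and k: "k = k_coord \<rho> x y b" "k \<noteq> 0"
    and lift: "is_lift s \<rho> (vec2 x y) (vec2 y b) z1 z2"
    and P: "P = monodromy s \<rho> (vec2 x y) (vec2 y b) z1 z2"
  obtains h d z where "cusp s h d z" "P - mat 1 = cusp.N s h d z"
    "nu \<rho> * \<bar>s * d^2 - h * z\<bar> = \<bar>s\<bar> * k^2"
proof -
  define h d z where "h = hpar \<rho>" and "d = xpar \<rho> x y b" and "z = z1 + z2 + zpar \<rho> s x y y b"
  have disc: "nu \<rho> * (s * d^2 - h * z) = s * k^2"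
    using discriminant[OF k(1) lift] by (simp add: h_def d_def z_def)
  then have "s * d^2 - h * z \<noteq> 0" using s k(2) by (metis mult_eq_0_iff power_eq_0_iff)
  then have c: "cusp s h d z" by (rule cusp.intro)
  moreover have "P - mat 1 = cusp.N s h d z"
    by (simp add: cusp.N_def[OF c] P monodromy_eq Tmat_minus_one flip: h_def d_def z_def)
  moreover have "nu \<rho> * \<bar>s * d^2 - h * z\<bar> = \<bar>s\<bar> * k^2"
    using arg_cong[OF disc, of abs] by (simp add: abs_mult nu_def)
  ultimately show ?thesis by (rule that)
qed

lemma index_eq_quotient:
  assumes c: "cusp s h d z" and nu: "nu \<rho> * \<bar>s * d^2 - h * z\<bar> = \<bar>s\<bar> * k^2"
  shows "of_nat (lattice_index (saturation (cusp.N s h d z)) (range ((*v) (cusp.N s h d z)))) =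
    (of_int (\<bar>s\<bar> * k^2) / of_int (nu \<rho>) :: rat)"
proof -
  have "nu \<rho> \<noteq> 0" by (cases \<rho>) (simp_all add: nu_eq)
  moreover have "of_nat n = (of_int \<bar>s * d^2 - h * z\<bar> :: rat)" if "int n = \<bar>s * d^2 - h * z\<bar>" for n
    using that by (metis of_int_of_nat_eq)
  note this[OF cusp.index[OF c]]
  ultimately show ?thesis unfolding nu[symmetric] of_int_mult by simp
qed

theorem theorem2p5:
  fixes s :: int and \<rho> :: lift_type
  assumes "s \<noteq> 0"
  shows
    "\<comment> \<open>the table\<close>
     (m1 \<rho>, m2 \<rho>, nu \<rho>) = (case \<rho> of TypeA \<Rightarrow> (3, 4, 6) | TypeB \<Rightarrow> (4, 6, 2) | TypeC \<Rightarrow> (3, 6, 3)) \<and>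
     B1 \<rho> ** B2 \<rho> = Ush (case \<rho> of TypeA \<Rightarrow> 1 | TypeB \<Rightarrow> 1 | TypeC \<Rightarrow> 2) \<and>

     \<comment> \<open>elliptic relations and the square-zero locus\<close>
     (\<forall>x y a b :: int.
        (\<forall>z. mpow (Tmat s (B1 \<rho>) (vec2 x y) z) (m1 \<rho>) = mat 1 \<longleftrightarrow> of_int z = z1_coord s \<rho> x y) \<and>
        (\<forall>z. mpow (Tmat s (B2 \<rho>) (vec2 a b) z) (m2 \<rho>) = mat 1 \<longleftrightarrow> of_int z = z2_coord s \<rho> a b) \<and>
        ((\<exists>z1 z2. is_lift s \<rho> (vec2 x y) (vec2 a b) z1 z2) \<longleftrightarrow>
           z1_coord s \<rho> x y \<in> \<int> \<and> z2_coord s \<rho> a b \<in> \<int>) \<and>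
        (\<forall>z1 z2. mpow (monodromy s \<rho> (vec2 x y) (vec2 a b) z1 z2 - mat 1) 2 = 0 \<longleftrightarrow> a = y)) \<and>

     \<comment> \<open>the complete conjugacy invariant, for the action on pairs (d1, d2) and on lifts\<close>
     (\<forall>x y b x' y' b' :: int.
        ((\<exists>g\<in>heis_levi s. \<exists>z1 z2 z1' z2'.
             Tmat s (B1 \<rho>) (vec2 x' y') z1' ** g = g ** Tmat s (B1 \<rho>) (vec2 x y) z1 \<and>
             Tmat s (B2 \<rho>) (vec2 y' b') z2' ** g = g ** Tmat s (B2 \<rho>) (vec2 y b) z2) \<longleftrightarrow>
           k_coord \<rho> x' y' b' = k_coord \<rho> x y b \<or> k_coord \<rho> x' y' b' = - k_coord \<rho> x y b) \<and>
        (\<forall>z1 z2 z1' z2'.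
           is_lift s \<rho> (vec2 x y) (vec2 y b) z1 z2 \<longrightarrow>
           is_lift s \<rho> (vec2 x' y') (vec2 y' b') z1' z2' \<longrightarrow>
           ((\<exists>g\<in>heis_levi s.
               Tmat s (B1 \<rho>) (vec2 x' y') z1' ** g = g ** Tmat s (B1 \<rho>) (vec2 x y) z1 \<and>
               Tmat s (B2 \<rho>) (vec2 y' b') z2' ** g = g ** Tmat s (B2 \<rho>) (vec2 y b) z2) \<longleftrightarrow>
             k_coord \<rho> x' y' b' = k_coord \<rho> x y b \<or> k_coord \<rho> x' y' b' = - k_coord \<rho> x y b))) \<and>

     \<comment> \<open>kappa is the obstruction to lifting\<close>
     (\<forall>d1 d2 :: int^2.
        (\<forall>z. mpow (Tmat s (B1 \<rho>) d1 z) (m1 \<rho>) =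
             Tmat s (mat 1) 0 (int (m1 \<rho>) * z + kappa s (m1 \<rho>) (B1 \<rho>) d1)) \<and>
        (\<forall>z. mpow (Tmat s (B2 \<rho>) d2 z) (m2 \<rho>) =
             Tmat s (mat 1) 0 (int (m2 \<rho>) * z + kappa s (m2 \<rho>) (B2 \<rho>) d2)) \<and>
        (central_obstruction s \<rho> d1 d2 = (0, 0) \<longleftrightarrow> (\<exists>z1 z2. is_lift s \<rho> d1 d2 z1 z2))) \<and>

     \<comment> \<open>its value on the square-zero locus, and the existence of lifts\<close>
     (\<forall>x y b k :: int. k = k_coord \<rho> x y b \<longrightarrow>
        central_obstruction s \<rho> (vec2 x y) (vec2 y b) =
          (case \<rho> of
             TypeA \<Rightarrow> ((- s * k^2) mod 3, (2 * s * k^2) mod 4)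
           | TypeB \<Rightarrow> ((- 2 * s * k^2) mod 4, 0)
           | TypeC \<Rightarrow> ((- s * k^2) mod 3, 0)) \<and>
        ((\<exists>z1 z2. is_lift s \<rho> (vec2 x y) (vec2 y b) z1 z2) \<longleftrightarrow>
           (of_int (s * k^2) / of_int (nu \<rho>) :: rat) \<in> \<int>) \<and>
        ((of_int (s * k^2) / of_int (nu \<rho>) :: rat) \<in> \<int> \<longleftrightarrow> nu \<rho> dvd s * k^2)) \<and>

     \<comment> \<open>the cusp\<close>
     (\<forall>(x :: int) y b k z1 z2 P N.
        k = k_coord \<rho> x y b \<longrightarrow> k \<noteq> 0 \<longrightarrow> is_lift s \<rho> (vec2 x y) (vec2 y b) z1 z2 \<longrightarrow>
        P = monodromy s \<rho> (vec2 x y) (vec2 y b) z1 z2 \<longrightarrow> N = P - mat 1 \<longrightarrow>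
        map_matrix of_int N = unipotent_log (map_matrix of_int P) \<and>
        saturation N = {v. N *v v = 0} \<and>
        (\<exists>l :: 2 \<Rightarrow> int^4. is_Z_basis l (saturation N)) \<and>
        range ((*v) N) \<subseteq> saturation N \<and>
        of_nat (lattice_index (saturation N) (range ((*v) N))) =
          (of_int (\<bar>s\<bar> * k^2) / of_int (nu \<rho>) :: rat) \<and>
        (\<exists>M. is_cusp_matrix N M) \<and>
        (\<forall>M. is_cusp_matrix N M \<longrightarrow>
           det M \<noteq> 0 \<and>
           (\<forall>(D :: complex \<Rightarrow> complex^2^2) r. 0 < r \<longrightarrow>
              (\<forall>i j. (\<lambda>t. D t $ i $ j) holomorphic_on ball 0 r) \<longrightarrow>
              (\<exists>\<epsilon>0. 0 < \<epsilon>0 \<and> \<epsilon>0 \<le> r \<and>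
                 (\<forall>\<epsilon>. 0 < \<epsilon> \<longrightarrow> \<epsilon> \<le> \<epsilon>0 \<longrightarrow>
                    (\<forall>(X :: 'b cspace) f. is_normalization X f (central_fibre M D \<epsilon>) \<longrightarrow>
                       finite (connected_components_of (ctop X)) \<and>
                       card (connected_components_of (ctop X)) =
                         lattice_index (saturation N) (range ((*v) N))))))))"
proof (intro conjI)
  let "?table \<and> ?product \<and> ?elliptic \<and> ?conjugacy \<and> ?kappa \<and> ?value \<and> ?cusp" = ?thesis
  have nu: "nu \<rho> \<noteq> 0" by (cases \<rho>) (simp_all add: nu_eq)
  show ?table by (cases \<rho>) (simp_all add: m1_eq m2_eq nu_eq)
  show ?product by (cases \<rho>) (simp_all add: Ush_def)
  show ?elliptic
    by (simp add: relation_1 relation_2 z1_coord_iff z2_coord_iff lift_exists_iff square_zero_iff)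
  show ?conjugacy by (intro allI impI conjI conjugate_iff conjugate_lift_iff)
  show ?kappa
    by (metis vec2_collapse Tmat_power_1 Tmat_power_2 kappa_1 kappa_2 obstruction_zero_iff)
  show ?value
    using obstruction_value lift_exists_square_zero_iff of_int_div_Ints_iff[OF nu] by presburger
  show ?cusp
  proof (intro allI impI conjI)
    fix x y b k z1 z2 :: int and P N :: "int^4^4"
    assume k: "k = k_coord \<rho> x y b" "k \<noteq> 0" and lift: "is_lift s \<rho> (vec2 x y) (vec2 y b) z1 z2"
      and P: "P = monodromy s \<rho> (vec2 x y) (vec2 y b) z1 z2" and N: "N = P - mat 1"
    obtain h d z where c: "cusp s h d z" and PN: "P - mat 1 = cusp.N s h d z"
      and nuD: "nu \<rho> * \<bar>s * d^2 - h * z\<bar> = \<bar>s\<bar> * k^2"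
      using cusp_monodromy[OF assms k lift P] .
    interpret cusp s h d z by (rule c)
    have N': "N = cusp.N s h d z" using N PN by simp
    show "map_matrix of_int N = unipotent_log (map_matrix of_int P)"
      using unipotent_log_nilp PN by (simp add: N' N_def)
    show "saturation N = {v. N *v v = 0}" unfolding N' by (rule saturation_kernel)
    show "\<exists>l :: 2 \<Rightarrow> int^4. is_Z_basis l (saturation N)" unfolding N' using basis_l0 by blast
    show "range ((*v) N) \<subseteq> saturation N" unfolding N' by (rule range_subset)
    show "of_nat (lattice_index (saturation N) (range ((*v) N))) =
        (of_int (\<bar>s\<bar> * k^2) / of_int (nu \<rho>) :: rat)"
      unfolding N' by (rule index_eq_quotient[OF c nuD])
    show "\<exists>M. is_cusp_matrix N M" unfolding N' using cusp_matrix_exists by blast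
    fix M assume M: "is_cusp_matrix N M"
    note M' = cusp_matrix_index[OF M[unfolded N']]
    show "det M \<noteq> 0" by (rule M'(1))
    fix D :: "complex \<Rightarrow> complex^2^2" and r :: real
    assume r: "0 < r" and D: "\<forall>i j. (\<lambda>t. D t $ i $ j) holomorphic_on ball 0 r"
    \<comment> \<open>The bound \<open>\<epsilon>0 = r\<close> suffices, since the count of
      components holds for every positive \<open>\<epsilon> \<le> r\<close>.\<close>
    show "\<exists>\<epsilon>0. 0 < \<epsilon>0 \<and> \<epsilon>0 \<le> r \<and> (\<forall>\<epsilon>. 0 < \<epsilon> \<longrightarrow> \<epsilon> \<le> \<epsilon>0 \<longrightarrow>
        (\<forall>(X :: 'b cspace) f. is_normalization X f (central_fibre M D \<epsilon>) \<longrightarrow>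
          finite (connected_components_of (ctop X)) \<and>
          card (connected_components_of (ctop X)) = lattice_index (saturation N) (range ((*v) N))))"
      unfolding N' M'(2)
      using r card_components_of_normalized_central_fibre[OF D[rule_format] _ _ _ lattice_index_det(1)[OF M'(1)]]
      by blast
  qed
qed

end
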